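(* Let $(M^n,g)$ be a complex nilmanifold of complex dimension $n$, i.e. a compact Hermitian manifold whose universal covering space is holomorphically isometric to $(G,J,g)$, where $G$ is an even-dimensional connected and simply-connected nilpotent Lie group, $J$ is a left invariant (integrable) complex structure on $G$, and $g$ is a left invariant metric on $G$ compatible with $J$. Let $R$ be the curvature tensor of the Chern connection of $g$, and suppose that its holomorphic sectional curvature $H$ is equal to a constant $c$, i.e. $R_{X\overline{X}X\overline{X}} = c\,|X|^4$ for every type $(1,0)$ tangent vector $X$. Then $c=0$, $R=0$ (that is, $g$ is Chern flat), and $G$ is a complex Lie group (with $J$ as its associated complex structure).
   Context: The Chern connection $\nabla$ of a Hermitian manifold $(M^n,g)$ with complex structure $J$ is the unique connection on the tangent bundle with $\nabla g=0$, $\nabla J=0$ and whose torsion $T$ satisfies $T(X,\overline{Y})=0$ for all type $(1,0)$ vectors $X,Y$. Extend $g=\langle\,,\,\rangle$ complex bilinearly, write $|X|^2=\langle X,\overline{X}\rangle$ for a type $(1,0)$ vector $X$, and set $$R_{X\overline{Y}Z\overline{W}} = \langle \nabla_X\nabla_{\overline{Y}}Z-\nabla_{\overline{Y}}\nabla_XZ-\nabla_{[X,\overline{Y}]}Z,\ \overline{W}\rangle$$ for type $(1,0)$ vectors $X,Y,Z,W$; these are the only possibly non-zero components of $R$. The holomorphic sectional curvature is $H(X)=R_{X\overline{X}X\overline{X}}/|X|^4$ for non-zero type $(1,0)$ tangent vectors $X$. A compact Hermitian manifold is called a Lie-Hermitian manifold if its universal covering space is holomorphically isometric to some $(G,J,g)$,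 where $G$ is an even-dimensional connected, simply-connected Lie group with a left invariant complex structure $J$ and a compatible left invariant metric $g$; the deck transformation group consists of holomorphic isometries of $(G,J,g)$. It is called a complex nilmanifold when $G$ is nilpotent. "$G$ is a complex Lie group (with $J$ as its associated complex structure)" means that on the Lie algebra $\mathfrak{g}$ of $G$ one has $[Jx,y]=J[x,y]$ for all $x,y\in\mathfrak{g}$. *)

theory Defs
  imports "HOL-Analysis.Analysis" "HOL-Algebra.Group"
begin

primrec times_diff_on ::
  "nat \<Rightarrow> 'a::real_normed_vector set \<Rightarrow> ('a \<Rightarrow> 'b::real_normed_vector) \<Rightarrow> bool"
where
  "times_diff_on 0 S f \<longleftrightarrow> continuous_on S f"
| "times_diff_on (Suc k) S f \<longleftrightarrow>
     (\<forall>x\<in>S. f differentiable (at x)) \<and>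
     (\<forall>v. times_diff_on k S (\<lambda>x. frechet_derivative f (at x) v))"

text \<open>Only used for open \<open>S\<close>.\<close>

definition smooth_on ::
  "'a::real_normed_vector set \<Rightarrow> ('a \<Rightarrow> 'b::real_normed_vector) \<Rightarrow> bool"
where "smooth_on S f \<longleftrightarrow> (\<forall>k. times_diff_on k S f)"

type_synonym ('m, 'e) chart = "'m set \<times> ('m \<Rightarrow> 'e)"

type_synonym ('m, 'e) atlas = "('m, 'e) chart set"

abbreviation chart_inv :: "('m, 'e) chart \<Rightarrow> 'e \<Rightarrow> 'm"
where "chart_inv c \<equiv> inv_into (fst c) (snd c)"

definition smooth_atlas ::
  "('m::{t2_space, second_countable_topology}, 'e::euclidean_space) atlas \<Rightarrow> bool"
where
  "smooth_atlas A \<longleftrightarrow>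
     (\<Union>(fst ` A)) = UNIV \<and>
     (\<forall>c\<in>A. open (fst c) \<and> open (snd c ` fst c) \<and>
            homeomorphism (fst c) (snd c ` fst c) (snd c) (chart_inv c)) \<and>
     (\<forall>c\<in>A. \<forall>d\<in>A. smooth_on (snd c ` (fst c \<inter> fst d)) (snd d \<circ> chart_inv c))"

text \<open>A preferred chart around each point. The tangent space at \<open>p\<close> is identified with the
  model space by means of the differential of this chart, so a tangent vector at \<open>p\<close> is an
  element of the model space, and a vector field is a function from the manifold to the model
  space. All notions below are independent of the choice.\<close>

definition chart_at :: "('m, 'e) atlas \<Rightarrow> 'm \<Rightarrow> ('m, 'e) chart"
where "chart_at A p = (SOME c. c \<in> A \<and> p \<in> fst c)"

definition smooth_fun ::
  "('m, 'e::real_normed_vector) atlas \<Rightarrow> 'm set \<Rightarrow> ('m \<Rightarrow> 'b::real_normed_vector) \<Rightarrow> bool"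
where
  "smooth_fun A W f \<longleftrightarrow> (\<forall>c\<in>A. smooth_on (snd c ` (fst c \<inter> W)) (f \<circ> chart_inv c))"

definition dfun ::
  "('m, 'e::real_normed_vector) atlas \<Rightarrow> ('m \<Rightarrow> 'b::real_normed_vector) \<Rightarrow> 'm \<Rightarrow> 'e \<Rightarrow> 'b"
where
  "dfun A f p v =
     frechet_derivative (f \<circ> chart_inv (chart_at A p)) (at (snd (chart_at A p) p)) v"

definition smooth_map ::
  "('m::topological_space, 'e::real_normed_vector) atlas \<Rightarrow>
   ('k::topological_space, 'f::real_normed_vector) atlas \<Rightarrow> ('m \<Rightarrow> 'k) \<Rightarrow> bool"
where
  "smooth_map A B F \<longleftrightarrow>
     continuous_on UNIV F \<and>
     (\<forall>c\<in>A. \<forall>d\<in>B. smooth_on (snd c ` (fst c \<inter> F -` fst d)) (snd d \<circ> F \<circ> chart_inv c))"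

definition dmap ::
  "('m, 'e::real_normed_vector) atlas \<Rightarrow> ('k, 'f::real_normed_vector) atlas \<Rightarrow>
   ('m \<Rightarrow> 'k) \<Rightarrow> 'm \<Rightarrow> 'e \<Rightarrow> 'f"
where "dmap A B F p v = dfun A (snd (chart_at B (F p)) \<circ> F) p v"

definition prod_atlas ::
  "('m, 'e) atlas \<Rightarrow> ('k, 'f) atlas \<Rightarrow> ('m \<times> 'k, 'e \<times> 'f) atlas"
where
  "prod_atlas A B = {(fst c \<times> fst d, map_prod (snd c) (snd d)) | c d. c \<in> A \<and> d \<in> B}"

definition smooth_field ::
  "('m, 'e::real_normed_vector) atlas \<Rightarrow> 'm set \<Rightarrow> ('m \<Rightarrow> 'e) \<Rightarrow> bool"
where
  "smooth_field A W X \<longleftrightarrow>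
     (\<forall>c\<in>A. smooth_fun A (fst c \<inter> W) (\<lambda>q. dfun A (snd c) q (X q)))"

text \<open>The Lie bracket: \<open>[X,Y] \<phi> = X (Y \<phi>) - Y (X \<phi>)\<close> for the components of the preferred
  chart \<open>\<phi>\<close> at \<open>p\<close>, whose differential at \<open>p\<close> is the identity under the identification above.\<close>

definition lie_bracket ::
  "('m, 'e::real_normed_vector) atlas \<Rightarrow> ('m \<Rightarrow> 'e) \<Rightarrow> ('m \<Rightarrow> 'e) \<Rightarrow> 'm \<Rightarrow> 'e"
where
  "lie_bracket A X Y p =
     (let \<phi> = snd (chart_at A p)
      in dfun A (\<lambda>q. dfun A \<phi> q (Y q)) p (X p) - dfun A (\<lambda>q. dfun A \<phi> q (X q)) p (Y p))"

text \<open>Multiplication by \<open>\<i>\<close> on the model space. As the transition maps of a complex atlas are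
  holomorphic, this is also the complex structure on each tangent space.\<close>

definition J :: "complex ^ 'n \<Rightarrow> complex ^ 'n"
where "J v = \<i> *s v"

definition complex_atlas ::
  "('m::{t2_space, second_countable_topology}, complex ^ 'n::finite) atlas \<Rightarrow> bool"
where
  "complex_atlas A \<longleftrightarrow>
     smooth_atlas A \<and>
     (\<forall>c\<in>A. \<forall>d\<in>A. \<forall>x \<in> snd c ` (fst c \<inter> fst d). \<forall>v.
        frechet_derivative (snd d \<circ> chart_inv c) (at x) (J v) =
        J (frechet_derivative (snd d \<circ> chart_inv c) (at x) v))"

definition holomorphic_map ::
  "('m::topological_space, complex ^ 'n::finite) atlas \<Rightarrow>
   ('k::topological_space, complex ^ 'l::finite) atlas \<Rightarrow> ('m \<Rightarrow> 'k) \<Rightarrow> bool"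
where
  "holomorphic_map A B F \<longleftrightarrow>
     smooth_map A B F \<and> (\<forall>p v. dmap A B F p (J v) = J (dmap A B F p v))"

type_synonym ('m, 'e) metric = "'m \<Rightarrow> 'e \<Rightarrow> 'e \<Rightarrow> real"

definition riemannian_metric ::
  "('m::topological_space, 'e::real_normed_vector) atlas \<Rightarrow> ('m, 'e) metric \<Rightarrow> bool"
where
  "riemannian_metric A g \<longleftrightarrow>
     (\<forall>p. bilinear (g p) \<and> (\<forall>v w. g p v w = g p w v) \<and> (\<forall>v. v \<noteq> 0 \<longrightarrow> g p v v > 0)) \<and>
     (\<forall>W X Y. open W \<longrightarrow> smooth_field A W X \<longrightarrow> smooth_field A W Y \<longrightarrow>
        smooth_fun A W (\<lambda>q. g q (X q) (Y q)))"

definition hermitian_manifold ::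
  "('m::{t2_space, second_countable_topology}, complex ^ 'n::finite) atlas \<Rightarrow>
   ('m, complex ^ 'n) metric \<Rightarrow> bool"
where
  "hermitian_manifold A g \<longleftrightarrow>
     complex_atlas A \<and> riemannian_metric A g \<and> (\<forall>p v w. g p (J v) (J w) = g p v w)"

text \<open>\<open>D X Y\<close> is the covariant derivative of \<open>Y\<close> in the direction of \<open>X\<close>. A connection acts on
  smooth vector fields on open subsets and is compatible with restriction; its values on
  non-smooth fields are irrelevant.\<close>

type_synonym ('m, 'e) conn = "('m \<Rightarrow> 'e) \<Rightarrow> ('m \<Rightarrow> 'e) \<Rightarrow> 'm \<Rightarrow> 'e"

definition connection ::
  "('m::topological_space, 'e::real_normed_vector) atlas \<Rightarrow> ('m, 'e) conn \<Rightarrow> bool"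
where
  "connection A D \<longleftrightarrow>
     (\<forall>W X Y. open W \<longrightarrow> smooth_field A W X \<longrightarrow> smooth_field A W Y \<longrightarrow>
        smooth_field A W (D X Y) \<and>
        (\<forall>X' Y'. (\<forall>p\<in>W. X' p = X p \<and> Y' p = Y p) \<longrightarrow> (\<forall>p\<in>W. D X' Y' p = D X Y p)) \<and>
        (\<forall>Z. smooth_field A W Z \<longrightarrow>
           (\<forall>p\<in>W. D (\<lambda>q. X q + Z q) Y p = D X Y p + D Z Y p \<and>
                  D X (\<lambda>q. Y q + Z q) p = D X Y p + D X Z p)) \<and>
        (\<forall>f :: 'm \<Rightarrow> real. smooth_fun A W f \<longrightarrow>
           (\<forall>p\<in>W. D (\<lambda>q. f q *\<^sub>R X q) Y p = f p *\<^sub>R D X Y p \<and>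
                  D X (\<lambda>q. f q *\<^sub>R Y q) p = dfun A f p (X p) *\<^sub>R Y p + f p *\<^sub>R D X Y p)))"

text \<open>A complexified tangent vector \<open>x + i y\<close> with \<open>x\<close>, \<open>y\<close> real tangent vectors is encoded as
  the pair \<open>(x, y)\<close>; this formal \<open>i\<close> is unrelated to the multiplication by \<open>\<i>\<close> in \<open>J\<close>.\<close>

definition cnj_vec :: "'e::real_vector \<times> 'e \<Rightarrow> 'e \<times> 'e"
where "cnj_vec Z = (fst Z, - snd Z)"

definition cnj_field :: "('m \<Rightarrow> 'e::real_vector \<times> 'e) \<Rightarrow> 'm \<Rightarrow> 'e \<times> 'e"
where "cnj_field Z p = cnj_vec (Z p)"

text \<open>Type \<open>(1,0)\<close>: the complex linear extension of \<open>J\<close> acts as the formal \<open>i\<close>.\<close>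

definition type_10 :: "(complex ^ 'n) \<times> (complex ^ 'n) \<Rightarrow> bool"
where "type_10 Z \<longleftrightarrow> (J (fst Z), J (snd Z)) = (- snd Z, fst Z)"

definition smooth_cfield ::
  "('m, 'e::real_normed_vector) atlas \<Rightarrow> 'm set \<Rightarrow> ('m \<Rightarrow> 'e \<times> 'e) \<Rightarrow> bool"
where "smooth_cfield A W Z \<longleftrightarrow> smooth_field A W (fst \<circ> Z) \<and> smooth_field A W (snd \<circ> Z)"

definition smooth_10_field ::
  "('m, complex ^ 'n::finite) atlas \<Rightarrow> 'm set \<Rightarrow> ('m \<Rightarrow> (complex ^ 'n) \<times> (complex ^ 'n)) \<Rightarrow> bool"
where "smooth_10_field A W Z \<longleftrightarrow> smooth_cfield A W Z \<and> (\<forall>p\<in>W. type_10 (Z p))"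

definition cext ::
  "(('m \<Rightarrow> 'e) \<Rightarrow> ('m \<Rightarrow> 'e) \<Rightarrow> 'm \<Rightarrow> 'e::real_vector) \<Rightarrow>
   ('m \<Rightarrow> 'e \<times> 'e) \<Rightarrow> ('m \<Rightarrow> 'e \<times> 'e) \<Rightarrow> 'm \<Rightarrow> 'e \<times> 'e"
where
  "cext B X Y p =
     (B (fst \<circ> X) (fst \<circ> Y) p - B (snd \<circ> X) (snd \<circ> Y) p,
      B (fst \<circ> X) (snd \<circ> Y) p + B (snd \<circ> X) (fst \<circ> Y) p)"

definition cmetric :: "('m, 'e) metric \<Rightarrow> 'm \<Rightarrow> 'e \<times> 'e \<Rightarrow> 'e \<times> 'e \<Rightarrow> complex"
where
  "cmetric g p Z W =
     Complex (g p (fst Z) (fst W) - g p (snd Z) (snd W))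
             (g p (fst Z) (snd W) + g p (snd Z) (fst W))"

definition torsion ::
  "('m, 'e::real_normed_vector) atlas \<Rightarrow> ('m, 'e) conn \<Rightarrow>
   ('m \<Rightarrow> 'e \<times> 'e) \<Rightarrow> ('m \<Rightarrow> 'e \<times> 'e) \<Rightarrow> 'm \<Rightarrow> 'e \<times> 'e"
where
  "torsion A D X Y p = cext D X Y p - cext D Y X p - cext (lie_bracket A) X Y p"

definition chern_connection ::
  "('m::topological_space, complex ^ 'n::finite) atlas \<Rightarrow> ('m, complex ^ 'n) metric \<Rightarrow>
   ('m, complex ^ 'n) conn \<Rightarrow> bool"
where
  "chern_connection A g D \<longleftrightarrow>
     connection A D \<and>
     (\<forall>W X Y Z. open W \<longrightarrow> smooth_field A W X \<longrightarrow> smooth_field A W Y \<longrightarrow> smooth_field A W Z \<longrightarrow>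
        (\<forall>p\<in>W. dfun A (\<lambda>q. g q (Y q) (Z q)) p (X p) =
                 g p (D X Y p) (Z p) + g p (Y p) (D X Z p))) \<and>
     (\<forall>W X Y. open W \<longrightarrow> smooth_field A W X \<longrightarrow> smooth_field A W Y \<longrightarrow>
        (\<forall>p\<in>W. D X (\<lambda>q. J (Y q)) p = J (D X Y p))) \<and>
     (\<forall>W X Y. open W \<longrightarrow> smooth_10_field A W X \<longrightarrow> smooth_10_field A W Y \<longrightarrow>
        (\<forall>p\<in>W. torsion A D X (cnj_field Y) p = 0))"

definition curvature ::
  "('m, 'e::real_normed_vector) atlas \<Rightarrow> ('m, 'e) conn \<Rightarrow>
   ('m \<Rightarrow> 'e \<times> 'e) \<Rightarrow> ('m \<Rightarrow> 'e \<times> 'e) \<Rightarrow> ('m \<Rightarrow> 'e \<times> 'e) \<Rightarrow> 'm \<Rightarrow> 'e \<times> 'e"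
where
  "curvature A D X Y Z p =
     cext D X (cext D Y Z) p - cext D Y (cext D X Z) p - cext D (cext (lie_bracket A) X Y) Z p"

text \<open>The second and fourth arguments are conjugated here: pass the type \<open>(1,0)\<close> fields themselves.\<close>

definition curv_comp ::
  "('m, 'e::real_normed_vector) atlas \<Rightarrow> ('m, 'e) metric \<Rightarrow> ('m, 'e) conn \<Rightarrow>
   ('m \<Rightarrow> 'e \<times> 'e) \<Rightarrow> ('m \<Rightarrow> 'e \<times> 'e) \<Rightarrow> ('m \<Rightarrow> 'e \<times> 'e) \<Rightarrow> ('m \<Rightarrow> 'e \<times> 'e) \<Rightarrow> 'm \<Rightarrow> complex"
where
  "curv_comp A g D X Y Z W p =
     cmetric g p (curvature A D X (cnj_field Y) Z p) (cnj_vec (W p))"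

text \<open>Since \<open>R\<close> is a tensor, the value at \<open>p\<close> only depends on \<open>X p\<close>; the numerator is evaluated
  through a local field \<open>X\<close>. The denominator is the fourth power of the norm of \<open>X p\<close>.\<close>

definition hol_sect_curv ::
  "('m, 'e::real_normed_vector) atlas \<Rightarrow> ('m, 'e) metric \<Rightarrow> ('m, 'e) conn \<Rightarrow>
   ('m \<Rightarrow> 'e \<times> 'e) \<Rightarrow> 'm \<Rightarrow> complex"
where
  "hol_sect_curv A g D X p =
     curv_comp A g D X X X X p / (cmetric g p (X p) (cnj_vec (X p)))\<^sup>2"

definition constant_hol_sect_curv ::
  "('m::topological_space, complex ^ 'n::finite) atlas \<Rightarrow> ('m, complex ^ 'n) metric \<Rightarrow>
   ('m, complex ^ 'n) conn \<Rightarrow> real \<Rightarrow> bool"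
where
  "constant_hol_sect_curv A g D c \<longleftrightarrow>
     (\<forall>W X. open W \<longrightarrow> smooth_10_field A W X \<longrightarrow>
        (\<forall>p\<in>W. X p \<noteq> 0 \<longrightarrow> hol_sect_curv A g D X p = complex_of_real c))"

definition flat ::
  "('m::topological_space, 'e::real_normed_vector) atlas \<Rightarrow> ('m, 'e) conn \<Rightarrow> bool"
where
  "flat A D \<longleftrightarrow>
     (\<forall>W X Y Z. open W \<longrightarrow> smooth_cfield A W X \<longrightarrow> smooth_cfield A W Y \<longrightarrow> smooth_cfield A W Z \<longrightarrow>
        (\<forall>p\<in>W. curvature A D X Y Z p = 0))"

definition lie_group ::
  "('g::{t2_space, second_countable_topology}, 'e::euclidean_space) atlas \<Rightarrow> 'g monoid \<Rightarrow> bool"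
where
  "lie_group A G \<longleftrightarrow>
     smooth_atlas A \<and> group G \<and> carrier G = UNIV \<and>
     smooth_map (prod_atlas A A) A (\<lambda>(x, y). x \<otimes>\<^bsub>G\<^esub> y) \<and>
     smooth_map A A (\<lambda>x. inv\<^bsub>G\<^esub> x)"

text \<open>The Lie algebra is the tangent space at the identity, with the bracket of left invariant
  vector fields.\<close>

definition left_inv_field ::
  "('g, 'e::real_normed_vector) atlas \<Rightarrow> 'g monoid \<Rightarrow> 'e \<Rightarrow> 'g \<Rightarrow> 'e"
where "left_inv_field A G x a = dmap A A (\<lambda>b. a \<otimes>\<^bsub>G\<^esub> b) \<one>\<^bsub>G\<^esub> x"

definition lie_alg_bracket ::
  "('g, 'e::real_normed_vector) atlas \<Rightarrow> 'g monoid \<Rightarrow> 'e \<Rightarrow> 'e \<Rightarrow> 'e"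
where
  "lie_alg_bracket A G x y =
     lie_bracket A (left_inv_field A G x) (left_inv_field A G y) \<one>\<^bsub>G\<^esub>"

primrec lower_central_series ::
  "('g, 'e::real_normed_vector) atlas \<Rightarrow> 'g monoid \<Rightarrow> nat \<Rightarrow> 'e set"
where
  "lower_central_series A G 0 = UNIV"
| "lower_central_series A G (Suc k) =
     span {lie_alg_bracket A G x y | x y. y \<in> lower_central_series A G k}"

text \<open>As usual, a connected Lie group is called nilpotent if its Lie algebra is nilpotent.\<close>

definition nilpotent_lie_group ::
  "('g::{t2_space, second_countable_topology}, 'e::euclidean_space) atlas \<Rightarrow> 'g monoid \<Rightarrow> bool"
where
  "nilpotent_lie_group A G \<longleftrightarrow>
     lie_group A G \<and> connected (UNIV :: 'g set) \<and> (\<exists>k. lower_central_series A G k = {0})"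

definition left_inv_complex_structure ::
  "('g::{t2_space, second_countable_topology}, complex ^ 'n::finite) atlas \<Rightarrow> 'g monoid \<Rightarrow> bool"
where
  "left_inv_complex_structure A G \<longleftrightarrow>
     complex_atlas A \<and>
     (\<forall>a p v. dmap A A (\<lambda>x. a \<otimes>\<^bsub>G\<^esub> x) p (J v) = J (dmap A A (\<lambda>x. a \<otimes>\<^bsub>G\<^esub> x) p v))"

definition left_inv_metric ::
  "('g, 'e::real_normed_vector) atlas \<Rightarrow> 'g monoid \<Rightarrow> ('g, 'e) metric \<Rightarrow> bool"
where
  "left_inv_metric A G h \<longleftrightarrow>
     (\<forall>a p v w. h (a \<otimes>\<^bsub>G\<^esub> p) (dmap A A (\<lambda>x. a \<otimes>\<^bsub>G\<^esub> x) p v) (dmap A A (\<lambda>x. a \<otimes>\<^bsub>G\<^esub> x) p w)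
                = h p v w)"

definition complex_lie_group ::
  "('g, complex ^ 'n::finite) atlas \<Rightarrow> 'g monoid \<Rightarrow> bool"
where
  "complex_lie_group A G \<longleftrightarrow>
     (\<forall>x y. lie_alg_bracket A G (J x) y = J (lie_alg_bracket A G x y))"

text \<open>\<open>\<pi>\<close> exhibits the Hermitian manifold with atlas \<open>B\<close> and metric \<open>h\<close> as the universal cover of
  the one with atlas \<open>A\<close> and metric \<open>g\<close>, both the complex structure and the metric upstairs being
  the pulled back ones. Then all deck transformations are holomorphic isometries.\<close>

definition hermitian_universal_cover ::
  "('g::{t2_space, second_countable_topology}, complex ^ 'n::finite) atlas \<Rightarrow>
   ('g, complex ^ 'n) metric \<Rightarrow>
   ('m::{t2_space, second_countable_topology}, complex ^ 'n) atlas \<Rightarrow>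
   ('m, complex ^ 'n) metric \<Rightarrow> ('g \<Rightarrow> 'm) \<Rightarrow> bool"
where
  "hermitian_universal_cover B h A g \<pi> \<longleftrightarrow>
     simply_connected (UNIV :: 'g set) \<and>
     covering_space UNIV \<pi> UNIV \<and>
     holomorphic_map B A \<pi> \<and>
     (\<forall>p v w. g (\<pi> p) (dmap B A \<pi> p v) (dmap B A \<pi> p w) = h p v w)"

definition complex_nilmanifold ::
  "('m::{t2_space, second_countable_topology}, complex ^ 'n::finite) atlas \<Rightarrow>
   ('m, complex ^ 'n) metric \<Rightarrow>
   ('g::{t2_space, second_countable_topology}, complex ^ 'n) atlas \<Rightarrow>
   ('g, complex ^ 'n) metric \<Rightarrow> 'g monoid \<Rightarrow> ('g \<Rightarrow> 'm) \<Rightarrow> bool"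
where
  "complex_nilmanifold A g B h G \<pi> \<longleftrightarrow>
     hermitian_manifold A g \<and> compact (UNIV :: 'm set) \<and>
     nilpotent_lie_group B G \<and> left_inv_complex_structure B G \<and>
     hermitian_manifold B h \<and> left_inv_metric B G h \<and>
     hermitian_universal_cover B h A g \<pi>"

end

theory Submission
  imports Defs
begin

text \<open>Left invariant fields of \<open>G\<close> descend to local frames of \<open>M\<close>, in which the Chern connection has
  constant coefficients. On the space \<open>V\<close> of left invariant \<open>(1,0)\<close> fields let \<open>L\<^sub>X\<close> be the map
  \<open>Z \<mapsto> [cnj X, Z]\<^sup>1\<^sup>0\<close>; then the covariant derivatives in the directions \<open>cnj X\<close> and \<open>X\<close> are \<open>L\<^sub>X\<close> and
  \<open>- L\<^sub>X\<^sup>*\<close>, and \<open>H = c\<close> reads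
  \<open>|L\<^sub>X\<^sup>* X|\<^sup>2 - |L\<^sub>X X|\<^sup>2 - 2 Re \<langle>L\<^bsub>L\<^sub>X X\<^esub> X, X\<rangle> = c |X|\<^sup>4\<close>.
  By nilpotency and integrability, long products of operators \<open>L\<^sub>X\<close> vanish, so there are a
  non-zero \<open>b\<close> with \<open>L\<^sub>X b = 0\<close> for all \<open>X\<close>, which gives \<open>c \<ge> 0\<close>, and a non-zero \<open>a\<close> orthogonal to all
  images of the \<open>L\<^sub>X\<close>, which gives \<open>c \<le> 0\<close>. Polarizing at such a \<open>b\<close> shows that \<open>L\<^sub>b = 0\<close> and that \<open>b\<close> is
  itself orthogonal to all images of the \<open>L\<^sub>X\<close>. If some \<open>L\<^sub>X\<close> were
  non-zero, a non-zero value of a longest non-vanishing product would be such a \<open>b\<close> and lie in the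
  image of some \<open>L\<^sub>X\<close>; so all \<open>L\<^sub>X\<close> vanish: the connection is flat, and \<open>[cnj X, Z] = 0\<close>
  says that the bracket is complex linear.\<close>

section \<open>Smooth functions on open sets\<close>

text \<open>Constant \<open>H\<close> fixes only the symmetrization of \<open>R\<close>, and the
  Chern curvature lacks the symmetries that would recover \<open>R\<close> from it. So the quartic
  has to be tested on vectors singled out by nilpotency: at \<open>b\<close> every term containing
  \<open>L\<close> drops out, at \<open>a\<close> every term containing the adjoint, and what is
  left has a sign. A deck transformation need not preserve a left invariant field, so these fields
  are pushed down only over evenly covered open sets. This suffices because curvature is local, and
  because the brackets and inner products of the resulting frame are constants of the Lie algebra.
  The covering is given as a topological one with a smooth projection, so its local sections are a
  priori only continuous. That they are smooth, and with them the frame, follows from the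
  invertibility of the differential of the projection; this is where the smooth inverse function
  theorem enters. The symmetry of second derivatives is needed to identify the bracket with the
  commutator of derivations.\<close>

lemma frechet_derivative_cong_nhds:
  assumes "eventually (\<lambda>y. f y = g y) (nhds x)"
  shows "frechet_derivative f (at x) = frechet_derivative g (at x)"
proof -
  obtain S where S: "open S" "x \<in> S" "\<And>y. y \<in> S \<Longrightarrow> f y = g y"
    using assms unfolding eventually_nhds by blast
  have "(f has_derivative f') (at x) \<longleftrightarrow> (g has_derivative f') (at x)" for f'
    using S has_derivative_transform_within_open[of f f' x UNIV S g]
      has_derivative_transform_within_open[of g f' x UNIV S f] by fastforce
  then show ?thesis unfolding frechet_derivative_def by simp
qed

lemma frechet_derivative_cong_open:
  assumes "open S" "x \<in> S" "\<And>y. y \<in> S \<Longrightarrow> f y = g y"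
  shows "frechet_derivative f (at x) = frechet_derivative g (at x)"
  using assms by (intro frechet_derivative_cong_nhds) (auto simp: eventually_nhds)

lemma differentiable_cong_open:
  assumes "open S" "x \<in> S" "\<And>y. y \<in> S \<Longrightarrow> f y = g y"
  shows "f differentiable (at x) \<longleftrightarrow> g differentiable (at x)"
proof -
  have "(f has_derivative f') (at x) \<longleftrightarrow> (g has_derivative f') (at x)" for f'
    using assms has_derivative_transform_within_open[of f f' x UNIV S g]
      has_derivative_transform_within_open[of g f' x UNIV S f] by fastforce
  then show ?thesis unfolding differentiable_def by simp
qed

lemma times_diff_on_cong:
  assumes "open S" "\<And>x. x \<in> S \<Longrightarrow> f x = g x"
  shows "times_diff_on k S f \<longleftrightarrow> times_diff_on k S g"
  using assms(2)
proof (induction k arbitrary: f g)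
  case 0
  then show ?case by (simp cong: continuous_on_cong)
next
  case (Suc k)
  have "times_diff_on k S (\<lambda>x. frechet_derivative f (at x) v) \<longleftrightarrow>
        times_diff_on k S (\<lambda>x. frechet_derivative g (at x) v)" for v
    by (rule Suc.IH) (use frechet_derivative_cong_open[OF assms(1) _ Suc.prems] in simp)
  moreover have "f differentiable (at x) \<longleftrightarrow> g differentiable (at x)" if "x \<in> S" for x
    by (rule differentiable_cong_open[OF assms(1) that Suc.prems])
  ultimately show ?case by simp
qed

lemma times_diff_on_subset: "times_diff_on k S f \<Longrightarrow> T \<subseteq> S \<Longrightarrow> times_diff_on k T f"
  by (induction k arbitrary: f) (auto intro: continuous_on_subset)

lemma times_diff_on_SucD: "times_diff_on (Suc k) S f \<Longrightarrow> times_diff_on k S f"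
proof (induction k arbitrary: f)
  case 0
  then show ?case
    by (auto intro!: continuous_at_imp_continuous_on differentiable_imp_continuous_within)
next
  case (Suc k)
  show ?case unfolding times_diff_on.simps(2)[of k]
    using Suc.IH[OF times_diff_on.simps(2)[THEN iffD1, OF Suc.prems, THEN conjunct2, THEN spec]]
      times_diff_on.simps(2)[THEN iffD1, OF Suc.prems, THEN conjunct1] by blast
qed

lemma times_diff_on_local:
  assumes "\<And>x. x \<in> S \<Longrightarrow> \<exists>T. open T \<and> x \<in> T \<and> times_diff_on k T f"
  shows "times_diff_on k S f"
  using assms
proof (induction k arbitrary: f)
  case 0
  then show ?case
    by (metis continuous_at_imp_continuous_on continuous_on_eq_continuous_at times_diff_on.simps(1))
next
  case (Suc k)
  have "f differentiable (at x)" if "x \<in> S" for x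
    using Suc.prems[OF that] by auto
  moreover have "times_diff_on k S (\<lambda>x. frechet_derivative f (at x) v)" for v
  proof (rule Suc.IH)
    fix x assume "x \<in> S"
    then obtain T where "open T" "x \<in> T" "times_diff_on (Suc k) T f" using Suc.prems by blast
    then show "\<exists>T. open T \<and> x \<in> T \<and> times_diff_on k T (\<lambda>x. frechet_derivative f (at x) v)" by auto
  qed
  ultimately show ?case by simp
qed

lemma times_diff_on_const: "times_diff_on k S (\<lambda>x. c)"
  by (induction k arbitrary: c) (auto)

text \<open>\<open>frechet_derivative\<close> is a chosen value; as derivatives are unique, an
  explicit \<open>D\<close> may stand in for it on an open set. The closure proofs below go through
  this rule.\<close>

lemma times_diff_on_SucI:
  assumes "open S" "\<And>x. x \<in> S \<Longrightarrow> (f has_derivative D x) (at x)"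
    "\<And>v. times_diff_on k S (\<lambda>x. D x v)"
  shows "times_diff_on (Suc k) S f"
proof -
  have "times_diff_on k S (\<lambda>x. frechet_derivative f (at x) v)" for v
    using assms(3)[of v] times_diff_on_cong[OF assms(1), of "\<lambda>x. D x v" "\<lambda>x. frechet_derivative f (at x) v"]
      frechet_derivative_at[OF assms(2)] by auto
  moreover have "f differentiable (at x)" if "x \<in> S" for x
    using assms(2)[OF that] by (rule differentiableI)
  ultimately show ?thesis by simp
qed

lemma times_diff_on_has_derivative:
  "times_diff_on (Suc k) S f \<Longrightarrow> x \<in> S \<Longrightarrow> (f has_derivative frechet_derivative f (at x)) (at x)"
  by (simp add: frechet_derivative_works)

lemma times_diff_on_derivative:
  "times_diff_on (Suc k) S f \<Longrightarrow> times_diff_on k S (\<lambda>x. frechet_derivative f (at x) v)"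
  by simp

lemma times_diff_on_add:
  assumes "open S" "times_diff_on k S f" "times_diff_on k S g"
  shows "times_diff_on k S (\<lambda>x. f x + g x)"
  using assms(2,3)
proof (induction k arbitrary: f g)
  case 0
  then show ?case by (simp add: continuous_on_add)
next
  case (Suc k)
  have D: "((\<lambda>x. f x + g x) has_derivative
      (\<lambda>v. frechet_derivative f (at x) v + frechet_derivative g (at x) v)) (at x)" if "x \<in> S" for x
    by (rule has_derivative_add[OF times_diff_on_has_derivative[OF Suc.prems(1) that]
          times_diff_on_has_derivative[OF Suc.prems(2) that]])
  show ?case
    by (rule times_diff_on_SucI[OF assms(1) D]) (assumption, rule Suc.IH[OF times_diff_on_derivative[OF Suc.prems(1)] times_diff_on_derivative[OF Suc.prems(2)]])
qed

lemma times_diff_on_sum: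
  assumes "open S" "\<And>i. i \<in> I \<Longrightarrow> times_diff_on k S (f i)"
  shows "times_diff_on k S (\<lambda>x. \<Sum>i\<in>I. f i x)"
  using assms(2)
  by (induction I rule: infinite_finite_induct)
    (auto intro: times_diff_on_const times_diff_on_add assms(1))

lemma times_diff_on_bilinear:
  assumes "bounded_bilinear h" "open S" "times_diff_on k S f" "times_diff_on k S g"
  shows "times_diff_on k S (\<lambda>x. h (f x) (g x))"
  using assms(3,4)
proof (induction k arbitrary: f g)
  case 0
  then show ?case using bounded_bilinear.continuous_on[OF assms(1)] by auto
next
  case (Suc k)
  note P = times_diff_on_SucD[OF Suc.prems(1)] times_diff_on_SucD[OF Suc.prems(2)]
    times_diff_on_derivative[OF Suc.prems(1)] times_diff_on_derivative[OF Suc.prems(2)]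
  have D: "((\<lambda>x. h (f x) (g x)) has_derivative
      (\<lambda>v. h (f x) (frechet_derivative g (at x) v) + h (frechet_derivative f (at x) v) (g x))) (at x)"
    if "x \<in> S" for x
    by (rule bounded_bilinear.FDERIV[OF assms(1) times_diff_on_has_derivative[OF Suc.prems(1) that]
          times_diff_on_has_derivative[OF Suc.prems(2) that]])
  show ?case
    by (rule times_diff_on_SucI[OF assms(2) D]) (assumption, rule times_diff_on_add[OF assms(2) Suc.IH[OF P(1,4)] Suc.IH[OF P(3,2)]])
qed

lemma times_diff_on_bounded_linear:
  assumes "bounded_linear h" "open S" "times_diff_on k S f"
  shows "times_diff_on k S (\<lambda>x. h (f x))"
  using assms(3)
proof (induction k arbitrary: f)
  case 0
  then show ?case using bounded_linear.continuous_on[OF assms(1)] by auto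
next
  case (Suc k)
  have D: "((\<lambda>x. h (f x)) has_derivative (\<lambda>v. h (frechet_derivative f (at x) v))) (at x)" if "x \<in> S" for x
    by (rule bounded_linear.has_derivative[OF assms(1) times_diff_on_has_derivative[OF Suc.prems that]])
  show ?case
    by (rule times_diff_on_SucI[OF assms(2) D]) (assumption, rule Suc.IH[OF times_diff_on_derivative[OF Suc.prems]])
qed

lemma times_diff_on_id: "open S \<Longrightarrow> times_diff_on k S (\<lambda>x. x)"
  by (cases k) (auto intro: times_diff_on_const)

lemma linear_sum_Basis:
  fixes h :: "'a::euclidean_space \<Rightarrow> 'b::real_vector"
  assumes "linear h"
  shows "h v = (\<Sum>b\<in>Basis. (v \<bullet> b) *\<^sub>R h b)"
proof -
  have "h v = h (\<Sum>b\<in>Basis. (v \<bullet> b) *\<^sub>R b)" by (simp add: euclidean_representation)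
  then show ?thesis by (simp add: linear_sum[OF assms] linear_cmul[OF assms])
qed

text \<open>The chain rule feeds the derivative of \<open>f\<close> with a vector that moves with
  the point, whereas \<open>times_diff_on\<close> differentiates in fixed directions only. Expanding
  that vector in \<open>Basis\<close> leaves sums of products of class \<open>k\<close> functions;
  the induction keeps \<open>g\<close> and replaces \<open>f\<close> by its partial
  derivatives.\<close>

lemma times_diff_on_compose:
  fixes f :: "'a::euclidean_space \<Rightarrow> 'b::real_normed_vector"
    and g :: "'c::real_normed_vector \<Rightarrow> 'a"
  assumes "open S" "open T" "times_diff_on k T f" "times_diff_on k S g" "g ` S \<subseteq> T"
  shows "times_diff_on k S (\<lambda>x. f (g x))"
  using assms(3,4)
proof (induction k arbitrary: f)
  case 0
  then show ?case using assms(5) by (auto intro: continuous_on_compose2)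
next
  case (Suc k)
  let ?D = "\<lambda>x v. \<Sum>b\<in>Basis. (frechet_derivative g (at x) v \<bullet> b) *\<^sub>R frechet_derivative f (at (g x)) b"
  have D: "((\<lambda>x. f (g x)) has_derivative ?D x) (at x)" if "x \<in> S" for x
  proof -
    have f: "f differentiable (at (g x))" and g: "g differentiable (at x)"
      using Suc.prems that assms(5) by auto
    have "?D x v = frechet_derivative f (at (g x)) (frechet_derivative g (at x) v)" for v
      by (rule linear_sum_Basis[OF linear_frechet_derivative[OF f], symmetric])
    moreover have "((\<lambda>x. f (g x)) has_derivative
        (\<lambda>v. frechet_derivative f (at (g x)) (frechet_derivative g (at x) v))) (at x)"
      using diff_chain_at[OF g[unfolded frechet_derivative_works] f[unfolded frechet_derivative_works]]
      by (simp add: o_def)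
    ultimately show ?thesis by simp
  qed
  note P = times_diff_on_SucD[OF Suc.prems(2)] times_diff_on_derivative[OF Suc.prems(1)]
    times_diff_on_derivative[OF Suc.prems(2)]
  have "times_diff_on k S (\<lambda>x. ?D x v)" for v
    by (intro times_diff_on_sum assms(1) times_diff_on_bilinear[OF bounded_bilinear_scaleR]
        times_diff_on_bounded_linear[OF bounded_linear_inner_left] P(3) Suc.IH[OF P(2,1)])
  with D show ?case by (rule times_diff_on_SucI[OF assms(1)])
qed

section \<open>Closure properties of smooth functions\<close>

lemma smooth_on_cong: "open S \<Longrightarrow> (\<And>x. x \<in> S \<Longrightarrow> f x = g x) \<Longrightarrow> smooth_on S f \<longleftrightarrow> smooth_on S g"
  unfolding smooth_on_def using times_diff_on_cong[of S f g] by simp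

lemma smooth_on_subset: "smooth_on S f \<Longrightarrow> T \<subseteq> S \<Longrightarrow> smooth_on T f"
  unfolding smooth_on_def using times_diff_on_subset by blast

lemma smooth_on_local:
  assumes "\<And>x. x \<in> S \<Longrightarrow> \<exists>T. open T \<and> x \<in> T \<and> smooth_on T f"
  shows "smooth_on S f"
  unfolding smooth_on_def using assms unfolding smooth_on_def by (meson times_diff_on_local)

lemma smooth_on_const: "smooth_on S (\<lambda>x. c)"
  unfolding smooth_on_def by (simp add: times_diff_on_const)

lemma smooth_on_id: "open S \<Longrightarrow> smooth_on S (\<lambda>x. x)"
  unfolding smooth_on_def by (simp add: times_diff_on_id)

lemma smooth_on_add: "open S \<Longrightarrow> smooth_on S f \<Longrightarrow> smooth_on S g \<Longrightarrow> smooth_on S (\<lambda>x. f x + g x)"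
  unfolding smooth_on_def by (simp add: times_diff_on_add)

lemma smooth_on_sum:
  "open S \<Longrightarrow> (\<And>i. i \<in> I \<Longrightarrow> smooth_on S (f i)) \<Longrightarrow> smooth_on S (\<lambda>x. \<Sum>i\<in>I. f i x)"
  unfolding smooth_on_def by (simp add: times_diff_on_sum)

lemma smooth_on_bilinear:
  "bounded_bilinear h \<Longrightarrow> open S \<Longrightarrow> smooth_on S f \<Longrightarrow> smooth_on S g \<Longrightarrow> smooth_on S (\<lambda>x. h (f x) (g x))"
  unfolding smooth_on_def by (simp add: times_diff_on_bilinear)

lemma smooth_on_bounded_linear:
  "bounded_linear h \<Longrightarrow> open S \<Longrightarrow> smooth_on S f \<Longrightarrow> smooth_on S (\<lambda>x. h (f x))"
  unfolding smooth_on_def by (simp add: times_diff_on_bounded_linear)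

lemma smooth_on_compose:
  fixes f :: "'a::euclidean_space \<Rightarrow> 'b::real_normed_vector"
  shows "open S \<Longrightarrow> open T \<Longrightarrow> smooth_on T f \<Longrightarrow> smooth_on S g \<Longrightarrow> g ` S \<subseteq> T \<Longrightarrow>
    smooth_on S (\<lambda>x. f (g x))"
  unfolding smooth_on_def by (simp add: times_diff_on_compose)

lemma smooth_on_imp_continuous_on: "smooth_on S f \<Longrightarrow> continuous_on S f"
  unfolding smooth_on_def by (metis times_diff_on.simps(1))

lemma smooth_on_imp_differentiable: "smooth_on S f \<Longrightarrow> x \<in> S \<Longrightarrow> f differentiable (at x)"
  unfolding smooth_on_def by (metis times_diff_on.simps(2))

lemma smooth_on_frechet_derivative:
  "smooth_on S f \<Longrightarrow> smooth_on S (\<lambda>x. frechet_derivative f (at x) v)"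
  unfolding smooth_on_def by (metis times_diff_on.simps(2))

lemma smooth_on_frechet_derivative_field:
  fixes f :: "'a::euclidean_space \<Rightarrow> 'b::real_normed_vector"
  assumes "open S" "smooth_on S f" "smooth_on S X"
  shows "smooth_on S (\<lambda>x. frechet_derivative f (at x) (X x))"
proof -
  have "frechet_derivative f (at x) (X x) =
      (\<Sum>b\<in>Basis. (X x \<bullet> b) *\<^sub>R frechet_derivative f (at x) b)" if "x \<in> S" for x
    by (rule linear_sum_Basis[OF linear_frechet_derivative[OF smooth_on_imp_differentiable[OF assms(2) that]]])
  moreover have "smooth_on S (\<lambda>x. \<Sum>b\<in>Basis. (X x \<bullet> b) *\<^sub>R frechet_derivative f (at x) b)"
    using assms by (intro smooth_on_sum smooth_on_bilinear[OF bounded_bilinear_scaleR]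
      smooth_on_bounded_linear[OF bounded_linear_inner_left] smooth_on_frechet_derivative)
  ultimately show ?thesis
    using smooth_on_cong[OF assms(1), where f="\<lambda>x. frechet_derivative f (at x) (X x)"] by simp
qed

lemma smooth_on_Pair:
  assumes "open S" "smooth_on S f" "smooth_on S g"
  shows "smooth_on S (\<lambda>x. (f x, g x))"
proof -
  have "bounded_linear (\<lambda>x. (x, 0))" "bounded_linear (\<lambda>x. (0, x))"
    by (auto intro!: bounded_linear_Pair bounded_linear_ident bounded_linear_zero)
  then have "smooth_on S (\<lambda>x. (f x, 0) + (0, g x))"
    using assms by (intro smooth_on_add smooth_on_bounded_linear[of "\<lambda>x. (x, 0)"]
       smooth_on_bounded_linear[of "\<lambda>x. (0, x)"])
  then show ?thesis by simp
qed

text \<open>The parallelogram argument: the second difference of \<open>f\<close> over the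
  parallelogram with sides \<open>t u\<close> and \<open>t v\<close> is symmetric in
  \<open>u\<close> and \<open>v\<close>, and two applications of the mean value theorem turn it into
  \<open>t * t\<close> times a mixed derivative at a nearby point, in either order of
  differentiation.\<close>

lemma second_derivative_symmetric_real:
  fixes f :: "'a::real_normed_vector \<Rightarrow> real"
  assumes S: "open S" "x \<in> S" and f: "smooth_on S f"
  shows "frechet_derivative (\<lambda>y. frechet_derivative f (at y) u) (at x) v =
         frechet_derivative (\<lambda>y. frechet_derivative f (at y) v) (at x) u"
proof -
  let ?D = "\<lambda>u y. frechet_derivative f (at y) u"
  let ?DD = "\<lambda>u v y. frechet_derivative (?D u) (at y) v"
  have cont: "isCont (?DD u v) x" for u v
    using smooth_on_imp_continuous_on[OF smooth_on_frechet_derivative[OF smooth_on_frechet_derivative[OF f]]]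
      S continuous_on_eq_continuous_at by blast
  have line: "((\<lambda>s. F (a + s *\<^sub>R w)) has_real_derivative frechet_derivative F (at (a + s *\<^sub>R w)) w) (at s)"
    if "smooth_on S F" "a + s *\<^sub>R w \<in> S" for F :: "'a \<Rightarrow> real" and a w s
  proof -
    have "(F has_derivative frechet_derivative F (at (a + s *\<^sub>R w))) (at (a + s *\<^sub>R w))"
      using smooth_on_imp_differentiable[OF that] by (simp add: frechet_derivative_works)
    moreover have "((\<lambda>s. a + s *\<^sub>R w) has_derivative (\<lambda>t. t *\<^sub>R w)) (at s)"
      by (auto intro!: derivative_eq_intros)
    ultimately have "((\<lambda>s. F (a + s *\<^sub>R w)) has_derivative
        (\<lambda>t. frechet_derivative F (at (a + s *\<^sub>R w)) (t *\<^sub>R w))) (at s)"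
      using diff_chain_at[of "\<lambda>s. a + s *\<^sub>R w" _ s F] by (simp add: o_def)
    moreover have "frechet_derivative F (at (a + s *\<^sub>R w)) (t *\<^sub>R w) =
        frechet_derivative F (at (a + s *\<^sub>R w)) w * t" for t
      using linear_cmul[OF linear_frechet_derivative[OF smooth_on_imp_differentiable[OF that]]] by simp
    ultimately show ?thesis by (simp add: has_field_derivative_def)
  qed
  have key: "\<exists>y\<in>ball x e. f (x + t *\<^sub>R u + t *\<^sub>R v) - f (x + t *\<^sub>R u) - f (x + t *\<^sub>R v) + f x = t * t * ?DD u v y"
    if e: "e > 0" "ball x e \<subseteq> S" and t: "t > 0" "t * (norm u + norm v) < e" for e t u v
  proof -
    have inb: "x + a *\<^sub>R u + b *\<^sub>R v \<in> ball x e" if "0 \<le> a" "a \<le> t" "0 \<le> b" "b \<le> t" for a b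
    proof -
      have "norm (a *\<^sub>R u + b *\<^sub>R v) \<le> a * norm u + b * norm v"
        using norm_triangle_ineq[of "a *\<^sub>R u" "b *\<^sub>R v"] that by simp
      also have "\<dots> \<le> t * norm u + t * norm v"
        using that by (intro add_mono mult_right_mono) auto
      also have "\<dots> < e" using t by (simp add: algebra_simps)
      finally have "norm (- (a *\<^sub>R u + b *\<^sub>R v)) < e" by (simp only: norm_minus_cancel)
      then show ?thesis by (simp add: dist_norm algebra_simps)
    qed
    let ?\<phi> = "\<lambda>s. f (x + t *\<^sub>R v + s *\<^sub>R u) - f (x + s *\<^sub>R u)"
    have "\<exists>s>0. s < t \<and> ?\<phi> t - ?\<phi> 0 = (t - 0) * (?D u (x + t *\<^sub>R v + s *\<^sub>R u) - ?D u (x + s *\<^sub>R u))"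
    proof (rule MVT2[OF t(1)])
      fix s assume s: "0 \<le> s" "s \<le> t"
      have "x + t *\<^sub>R v + s *\<^sub>R u \<in> S" "x + s *\<^sub>R u \<in> S"
        using inb[of s t] inb[of s 0] s t e by (auto simp: add_ac)
      then show "(?\<phi> has_real_derivative (?D u (x + t *\<^sub>R v + s *\<^sub>R u) - ?D u (x + s *\<^sub>R u))) (at s)"
        by (intro DERIV_diff line f)
    qed
    then obtain s where s: "s > 0" "s < t"
      "?\<phi> t - ?\<phi> 0 = t * (?D u (x + t *\<^sub>R v + s *\<^sub>R u) - ?D u (x + s *\<^sub>R u))" by auto
    let ?\<psi> = "\<lambda>r. ?D u (x + s *\<^sub>R u + r *\<^sub>R v)"
    have "\<exists>r>0. r < t \<and> ?\<psi> t - ?\<psi> 0 = (t - 0) * ?DD u v (x + s *\<^sub>R u + r *\<^sub>R v)"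
    proof (rule MVT2[OF t(1)])
      fix r assume r: "0 \<le> r" "r \<le> t"
      have "x + s *\<^sub>R u + r *\<^sub>R v \<in> S" using inb[of s r] s r e by auto
      then show "(?\<psi> has_real_derivative ?DD u v (x + s *\<^sub>R u + r *\<^sub>R v)) (at r)"
        by (intro line smooth_on_frechet_derivative f)
    qed
    then obtain r where r: "r > 0" "r < t" "?\<psi> t - ?\<psi> 0 = t * ?DD u v (x + s *\<^sub>R u + r *\<^sub>R v)" by auto
    have "f (x + t *\<^sub>R u + t *\<^sub>R v) - f (x + t *\<^sub>R u) - f (x + t *\<^sub>R v) + f x = ?\<phi> t - ?\<phi> 0"
      by (simp add: add_ac)
    also have "\<dots> = t * (?\<psi> t - ?\<psi> 0)" using s(3) by (simp add: add_ac)
    also have "\<dots> = t * t * ?DD u v (x + s *\<^sub>R u + r *\<^sub>R v)" using r(3) by simp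
    finally show ?thesis using inb[of s r] s r by auto
  qed
  show ?thesis
  proof (rule ccontr)
    assume ne: "?DD u v x \<noteq> ?DD v u x"
    \<comment> \<open>Half the gap: values closer than \<open>d\<close> to the two distinct numbers
      cannot coincide.\<close>
    define d where "d = dist (?DD u v x) (?DD v u x) / 2"
    have d: "d > 0" using ne by (simp add: d_def)
    obtain e1 where e1: "e1 > 0" "\<And>y. dist y x < e1 \<Longrightarrow> dist (?DD u v y) (?DD u v x) < d"
      using cont[of u v] d unfolding continuous_at_eps_delta by (metis dist_commute)
    obtain e2 where e2: "e2 > 0" "\<And>y. dist y x < e2 \<Longrightarrow> dist (?DD v u y) (?DD v u x) < d"
      using cont[of v u] d unfolding continuous_at_eps_delta by (metis dist_commute)
    obtain e3 where e3: "e3 > 0" "ball x e3 \<subseteq> S" using S openE by blast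
    define e where "e = min e1 (min e2 e3)"
    have e: "e > 0" "ball x e \<subseteq> S" using e1 e2 e3 by (auto simp: e_def)
    \<comment> \<open>Small enough for the whole parallelogram to lie in the ball; the summand 1
      keeps the denominator positive when \<open>u\<close> and \<open>v\<close> vanish.\<close>
    define t where "t = e / (2 * (norm u + norm v + 1))"
    have t: "t > 0" using e by (simp add: t_def add_nonneg_pos)
    have "t * (norm u + norm v) < e"
      using e by (simp add: t_def divide_simps add_nonneg_pos)
    then have t': "t * (norm u + norm v) < e" "t * (norm v + norm u) < e" by (auto simp: add.commute)
    obtain y where y: "y \<in> ball x e" "f (x + t *\<^sub>R u + t *\<^sub>R v) - f (x + t *\<^sub>R u) - f (x + t *\<^sub>R v) + f x = t * t * ?DD u v y"
      using key[OF e t t'(1)] by blast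
    obtain z where z: "z \<in> ball x e" "f (x + t *\<^sub>R v + t *\<^sub>R u) - f (x + t *\<^sub>R v) - f (x + t *\<^sub>R u) + f x = t * t * ?DD v u z"
      using key[OF e t t'(2)] by blast
    have "t * t * ?DD u v y = t * t * ?DD v u z"
      unfolding y(2)[symmetric] z(2)[symmetric] by (simp add: add_ac)
    then have "?DD u v y = ?DD v u z" using t by simp
    moreover have "dist (?DD u v y) (?DD u v x) < d" using e1(2)[of y] y(1) by (simp add: e_def dist_commute)
    moreover have "dist (?DD v u z) (?DD v u x) < d" using e2(2)[of z] z(1) by (simp add: e_def dist_commute)
    ultimately show False unfolding d_def dist_real_def by (auto simp: abs_if split: if_splits)
  qed
qed

lemma second_derivative_symmetric:
  fixes f :: "'a::real_normed_vector \<Rightarrow> 'b::euclidean_space"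
  assumes S: "open S" "x \<in> S" and f: "smooth_on S f"
  shows "frechet_derivative (\<lambda>y. frechet_derivative f (at y) u) (at x) v =
         frechet_derivative (\<lambda>y. frechet_derivative f (at y) v) (at x) u"
proof (rule euclidean_eqI)
  fix b :: 'b assume "b \<in> Basis"
  have inner: "frechet_derivative (\<lambda>y. F y \<bullet> b) (at y) w = frechet_derivative F (at y) w \<bullet> b"
    if "F differentiable (at y)" for F :: "'a \<Rightarrow> 'b" and y w
    using frechet_derivative_at[OF bounded_linear.has_derivative[OF bounded_linear_inner_left
        that[unfolded frechet_derivative_works], of b]] by metis
  have "frechet_derivative (\<lambda>y. frechet_derivative f (at y) u) (at x) v \<bullet> b =
     frechet_derivative (\<lambda>y. frechet_derivative (\<lambda>y. f y \<bullet> b) (at y) u) (at x) v" for u v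
  proof -
    have "frechet_derivative (\<lambda>y. frechet_derivative f (at y) u) (at x) v \<bullet> b =
        frechet_derivative (\<lambda>y. frechet_derivative f (at y) u \<bullet> b) (at x) v"
      using inner smooth_on_imp_differentiable[OF smooth_on_frechet_derivative[OF f]] S by simp
    also have "\<dots> = frechet_derivative (\<lambda>y. frechet_derivative (\<lambda>y. f y \<bullet> b) (at y) u) (at x) v"
      using inner smooth_on_imp_differentiable[OF f]
      by (subst frechet_derivative_cong_open[OF S]) auto
    finally show ?thesis .
  qed
  then show "frechet_derivative (\<lambda>y. frechet_derivative f (at y) u) (at x) v \<bullet> b =
         frechet_derivative (\<lambda>y. frechet_derivative f (at y) v) (at x) u \<bullet> b"
    using second_derivative_symmetric_real[OF S smooth_on_bounded_linear[OF bounded_linear_inner_left S(1) f]]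
    by simp
qed

section \<open>The smooth inverse function theorem\<close>

text \<open>At a zero of \<open>g\<close> the product rule gets by with continuity of
  \<open>c\<close>, because a derivative of \<open>c\<close> would be multiplied by
  \<open>g x\<close>. This is applied to coefficients whose differentiability is still to be
  shown.\<close>

lemma has_derivative_continuous_scaleR:
  fixes g :: "'a::real_normed_vector \<Rightarrow> 'b::real_normed_vector"
  assumes g: "(g has_derivative g') (at x)" "g x = 0" and c: "isCont c x"
  shows "((\<lambda>y. c y *\<^sub>R g y) has_derivative (\<lambda>h. c x *\<^sub>R g' h)) (at x)"
proof (rule has_derivativeI)
  show "bounded_linear (\<lambda>h. c x *\<^sub>R g' h)"
    using has_derivative_bounded_linear[OF g(1)] bounded_linear_const_scaleR by blast
  have lim: "((\<lambda>y. (g y - g x - g' (y - x)) /\<^sub>R norm (y - x)) \<longlongrightarrow> 0) (at x)"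
    using g(1) by (auto simp: has_derivative_at_within)
  obtain K where K: "\<And>h. norm (g' h) \<le> norm h * K"
    using bounded_linear.bounded[OF has_derivative_bounded_linear[OF g(1)]] by blast
  have c0: "((\<lambda>y. c y - c x) \<longlongrightarrow> 0) (at x)" using c LIM_zero isContD by blast
  have "((\<lambda>y. (c y - c x) *\<^sub>R (g' (y - x) /\<^sub>R norm (y - x))) \<longlongrightarrow> 0) (at x)"
  proof (rule Lim_null_comparison)
    show "((\<lambda>y. \<bar>c y - c x\<bar> * \<bar>K\<bar>) \<longlongrightarrow> 0) (at x)"
      using tendsto_mult[OF tendsto_rabs_zero[OF c0] tendsto_const, of "\<bar>K\<bar>"] by simp
    have "norm (g' (y - x) /\<^sub>R norm (y - x)) \<le> \<bar>K\<bar>" for y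
    proof -
      have "norm (g' (y - x)) \<le> norm (y - x) * \<bar>K\<bar>"
        using K[of "y - x"] by (smt (verit) mult_left_mono norm_ge_zero)
      then show ?thesis
        by (cases "y = x") (auto simp: divide_simps mult.commute)
    qed
    then have "norm ((c y - c x) *\<^sub>R (g' (y - x) /\<^sub>R norm (y - x))) \<le> \<bar>c y - c x\<bar> * \<bar>K\<bar>" for y
      unfolding norm_scaleR[of "c y - c x"] by (rule mult_left_mono) simp
    then show "\<forall>\<^sub>F y in at x. norm ((c y - c x) *\<^sub>R (g' (y - x) /\<^sub>R norm (y - x))) \<le> \<bar>c y - c x\<bar> * \<bar>K\<bar>"
      by (intro always_eventually allI)
  qed
  moreover have "((\<lambda>y. c y *\<^sub>R ((g y - g x - g' (y - x)) /\<^sub>R norm (y - x))) \<longlongrightarrow> c x *\<^sub>R 0) (at x)"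
    using lim c by (intro tendsto_scaleR) (auto simp: isCont_def)
  ultimately have "((\<lambda>y. c y *\<^sub>R ((g y - g x - g' (y - x)) /\<^sub>R norm (y - x)) +
      (c y - c x) *\<^sub>R (g' (y - x) /\<^sub>R norm (y - x))) \<longlongrightarrow> 0) (at x)"
    using tendsto_add by fastforce
  then show "((\<lambda>y. (c y *\<^sub>R g y - c x *\<^sub>R g x - c x *\<^sub>R g' (y - x)) /\<^sub>R norm (y - x)) \<longlongrightarrow> 0) (at x)"
    using g(2) by (simp add: algebra_simps)
qed

text \<open>\<open>T x0\<close> is bounded below by some \<open>m\<close>, and near
  \<open>x0\<close> the operators differ by less than \<open>m / 2\<close>, as is seen on the
  finitely many basis vectors. Hence \<open>w x - w x0\<close> is controlled by its image
  \<open>v x - T x (w x0)\<close>, which tends to 0.\<close>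

lemma continuous_on_linear_solve:
  fixes T :: "'c::real_normed_vector \<Rightarrow> 'e::euclidean_space \<Rightarrow> 'e"
  assumes lin: "\<And>x. x \<in> S \<Longrightarrow> linear (T x)"
    and inj: "\<And>x z. x \<in> S \<Longrightarrow> T x z = 0 \<Longrightarrow> z = 0"
    and eq: "\<And>x. x \<in> S \<Longrightarrow> T x (w x) = v x"
    and T: "\<And>z. continuous_on S (\<lambda>x. T x z)" and v: "continuous_on S v"
  shows "continuous_on S w"
  unfolding continuous_on_iff
proof (intro ballI allI impI)
  fix x0 and e :: real assume x0: "x0 \<in> S" and e: "0 < e"
  have "inj (T x0)" using inj[OF x0] linear_injective_0[OF lin[OF x0]] by blast
  then obtain m where m: "m > 0" "\<And>z. m * norm z \<le> norm (T x0 z)"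
    using linear_inj_bounded_below_pos[OF lin[OF x0]] by metis
  let ?\<epsilon> = "\<lambda>x. \<Sum>b\<in>Basis. norm (T x b - T x0 b)"
  have "continuous_on S ?\<epsilon>" by (intro continuous_intros T)
  then obtain d1 where d1: "d1 > 0" "\<And>x. x \<in> S \<Longrightarrow> dist x x0 < d1 \<Longrightarrow> dist (?\<epsilon> x) (?\<epsilon> x0) < m / 2"
    using x0 m(1) unfolding continuous_on_iff by (metis half_gt_zero)
  have "continuous_on S (\<lambda>x. norm (v x - T x (w x0)))" by (intro continuous_intros T v)
  then obtain d2 where d2: "d2 > 0"
    "\<And>x. x \<in> S \<Longrightarrow> dist x x0 < d2 \<Longrightarrow> dist (norm (v x - T x (w x0))) (norm (v x0 - T x0 (w x0))) < m / 2 * e"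
    using x0 m(1) e unfolding continuous_on_iff by (metis half_gt_zero mult_pos_pos)
  show "\<exists>d>0. \<forall>x\<in>S. dist x x0 < d \<longrightarrow> dist (w x) (w x0) < e"
  proof (intro exI[of _ "min d1 d2"] conjI ballI impI)
    show "0 < min d1 d2" using d1 d2 by simp
    fix x assume x: "x \<in> S" "dist x x0 < min d1 d2"
    let ?z = "w x - w x0"
    have eps: "?\<epsilon> x < m / 2" using d1(2)[of x] x by (simp add: dist_real_def)
    have "T x ?z - T x0 ?z = (\<Sum>b\<in>Basis. (?z \<bullet> b) *\<^sub>R (T x b - T x0 b))"
      using linear_sum_Basis[OF lin[OF x(1)], of ?z] linear_sum_Basis[OF lin[OF x0], of ?z]
      by (simp only: scaleR_diff_right sum_subtractf)
    then have "norm (T x ?z - T x0 ?z) \<le> (\<Sum>b\<in>Basis. norm ?z * norm (T x b - T x0 b))"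
      by (auto intro!: sum_norm_le mult_right_mono Basis_le_norm)
    also have "\<dots> = norm ?z * ?\<epsilon> x" by (simp add: sum_distrib_left)
    also have "\<dots> \<le> norm ?z * (m / 2)" using eps by (intro mult_left_mono) auto
    finally have "m * norm ?z \<le> norm (T x ?z) + norm ?z * (m / 2)"
      using m(2)[of ?z] norm_triangle_ineq[of "T x ?z" "T x0 ?z - T x ?z"]
      by (simp add: norm_minus_commute)
    then have "m / 2 * norm ?z \<le> norm (T x ?z)" by (simp add: field_simps)
    also have "T x ?z = v x - T x (w x0)" using eq[OF x(1)] linear_diff[OF lin[OF x(1)]] by simp
    also have "norm \<dots> < m / 2 * e" using d2(2)[of x] x eq[OF x0] by (simp add: dist_real_def)
    finally show "dist (w x) (w x0) < e" using m(1) by (simp add: dist_norm)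
  qed
qed

text \<open>The derivative of \<open>w\<close> solves a linear system of the same kind, with a right-hand side that
  involves \<open>w\<close> but not its derivatives; this drives the induction on \<open>k\<close>.\<close>

lemma times_diff_on_linear_solve:
  fixes T :: "'c::real_normed_vector \<Rightarrow> 'e::euclidean_space \<Rightarrow> 'e"
  assumes S: "open S"
    and lin: "\<And>x. x \<in> S \<Longrightarrow> linear (T x)"
    and inj: "\<And>x z. x \<in> S \<Longrightarrow> T x z = 0 \<Longrightarrow> z = 0"
    and eq: "\<And>x. x \<in> S \<Longrightarrow> T x (w x) = v x"
    and T: "\<And>z. times_diff_on k S (\<lambda>x. T x z)" and v: "times_diff_on k S v"
  shows "times_diff_on k S w"
  using eq T v
proof (induction k arbitrary: w v)
  case 0
  show ?case using continuous_on_linear_solve[of S T w v, OF lin inj 0(1)] 0(2,3) by simp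
next
  case (Suc k)
  have wk: "times_diff_on k S w"
    by (rule Suc.IH[OF Suc.prems(1)]) (use Suc.prems times_diff_on_SucD in blast)+
  have w0: "isCont w x" if "x \<in> S" for x
  proof -
    have "continuous_on S w" using wk by (induction k) (use times_diff_on_SucD in auto)
    then show ?thesis using wk S that continuous_on_eq_continuous_at by blast
  qed
  let ?r = "\<lambda>x u. frechet_derivative v (at x) u -
     (\<Sum>b\<in>Basis. (w x \<bullet> b) *\<^sub>R frechet_derivative (\<lambda>x. T x b) (at x) u)"
  define Ti where "Ti x = inv_into UNIV (T x)" for x
  have Ti: "T x (Ti x z) = z" "Ti x (T x z) = z" "linear (Ti x)" if "x \<in> S" for x z
  proof -
    have i: "inj (T x)" using inj[OF that] linear_injective_0[OF lin[OF that]] by blast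
    have s: "surj (T x)" using linear_injective_imp_surjective[OF lin[OF that] i] by simp
    show "T x (Ti x z) = z" "Ti x (T x z) = z" using i s by (simp_all add: Ti_def surj_f_inv_f)
    show "linear (Ti x)" unfolding Ti_def
      by (rule inj_linear_imp_inv_linear[OF lin[OF that] i])
  qed
  have D: "(w has_derivative (\<lambda>u. Ti x (?r x u))) (at x)" if x: "x \<in> S" for x
  proof -
    \<comment> \<open>The differentiated function equals \<open>T x (w y)\<close>, with the operator
      frozen at \<open>x\<close>. The factors \<open>T y b - T x b\<close> vanish at
      \<open>y = x\<close>, so continuity of \<open>w\<close> suffices for the product rule.\<close>
    have "((\<lambda>y. v y - (\<Sum>b\<in>Basis. (w y \<bullet> b) *\<^sub>R (T y b - T x b))) has_derivative ?r x) (at x)"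
    proof (intro has_derivative_diff has_derivative_sum has_derivative_continuous_scaleR)
      show "(v has_derivative frechet_derivative v (at x)) (at x)"
        by (rule times_diff_on_has_derivative[OF Suc.prems(3) x])
      fix b :: 'e
      show "((\<lambda>y. T y b - T x b) has_derivative frechet_derivative (\<lambda>x. T x b) (at x)) (at x)"
        using has_derivative_diff[OF times_diff_on_has_derivative[OF Suc.prems(2) x] has_derivative_const]
        by fastforce
      show "isCont (\<lambda>y. w y \<bullet> b) x" using w0[OF x] by (intro continuous_intros)
    qed simp
    then have "((\<lambda>y. Ti x (v y - (\<Sum>b\<in>Basis. (w y \<bullet> b) *\<^sub>R (T y b - T x b)))) has_derivative
        (\<lambda>u. Ti x (?r x u))) (at x)"
      using Ti(3)[OF x] by (intro bounded_linear.has_derivative[of "Ti x"]) (simp_all add: linear_conv_bounded_linear)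
    moreover have "Ti x (v y - (\<Sum>b\<in>Basis. (w y \<bullet> b) *\<^sub>R (T y b - T x b))) = w y" if y: "y \<in> S" for y
    proof -
      have "(\<Sum>b\<in>Basis. (w y \<bullet> b) *\<^sub>R (T y b - T x b)) = T y (w y) - T x (w y)"
        using linear_sum_Basis[OF lin[OF x], of "w y"] linear_sum_Basis[OF lin[OF y], of "w y"]
        by (simp only: scaleR_diff_right sum_subtractf)
      then show ?thesis using Suc.prems(1)[OF y] Ti(2)[OF x] by simp
    qed
    ultimately show ?thesis
      using has_derivative_transform_within_open[OF _ S x] by blast
  qed
  show ?case
  proof (rule times_diff_on_SucI[OF S D])
    fix u
    show "times_diff_on k S (\<lambda>x. Ti x (?r x u))"
    proof (rule Suc.IH)
      fix x assume "x \<in> S" then show "T x (Ti x (?r x u)) = ?r x u" by (rule Ti)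
    next
      show "times_diff_on k S (\<lambda>x. T x z)" for z using Suc.prems(2) times_diff_on_SucD by blast
      have m: "bounded_linear (\<lambda>x. - x :: 'e)" by (simp add: bounded_linear_minus bounded_linear_ident)
      have "times_diff_on k S (\<lambda>x. frechet_derivative v (at x) u + (-
        (\<Sum>b\<in>Basis. (w x \<bullet> b) *\<^sub>R frechet_derivative (\<lambda>x. T x b) (at x) u)))"
        by (intro times_diff_on_add S times_diff_on_bounded_linear[OF m] times_diff_on_sum
            times_diff_on_bilinear[OF bounded_bilinear_scaleR] times_diff_on_derivative Suc.prems
            times_diff_on_bounded_linear[OF bounded_linear_inner_left] wk)
      then show "times_diff_on k S (\<lambda>x. ?r x u)" by simp
    qed
  qed
qed

text \<open>The derivative of \<open>g\<close> at \<open>y\<close> inverts that of \<open>f\<close>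
  at \<open>g y\<close>, so its values solve a linear system whose coefficients are as often
  differentiable as \<open>g\<close> itself. Each round gains one order. A continuous right inverse
  is an input here; only its regularity is at stake.\<close>

lemma smooth_on_local_inverse:
  fixes f :: "'e::euclidean_space \<Rightarrow> 'e"
  assumes S: "open S" and U: "open U" and f: "smooth_on S f"
    and inj: "\<And>x z. x \<in> S \<Longrightarrow> frechet_derivative f (at x) z = 0 \<Longrightarrow> z = 0"
    and g: "continuous_on U g" "g ` U \<subseteq> S" "\<And>y. y \<in> U \<Longrightarrow> f (g y) = y"
  shows "smooth_on U g"
proof -
  let ?T = "\<lambda>x. frechet_derivative f (at x)"
  have lin: "linear (?T x)" if "x \<in> S" for x
    using smooth_on_imp_differentiable[OF f that] by (rule linear_frechet_derivative)
  define Ti where "Ti x = inv_into UNIV (?T x)" for x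
  have Ti: "?T x (Ti x z) = z" "Ti x (?T x z) = z" "linear (Ti x)" if "x \<in> S" for x z
  proof -
    have i: "inj (?T x)" using inj[OF that] linear_injective_0[OF lin[OF that]] by blast
    have s: "surj (?T x)" using linear_injective_imp_surjective[OF lin[OF that] i] by simp
    show "?T x (Ti x z) = z" "Ti x (?T x z) = z" using i s by (simp_all add: Ti_def surj_f_inv_f)
    show "linear (Ti x)" unfolding Ti_def
      by (rule inj_linear_imp_inv_linear[OF lin[OF that] i])
  qed
  have D: "(g has_derivative Ti (g y)) (at y)" if y: "y \<in> U" for y
  proof (rule has_derivative_inverse_basic[where f=f and g=g and T=U])
    have gy: "g y \<in> S" using g(2) y by blast
    show "(f has_derivative ?T (g y)) (at (g y))"
      using smooth_on_imp_differentiable[OF f gy] by (simp add: frechet_derivative_works)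
    show "bounded_linear (Ti (g y))" using Ti(3)[OF gy] by (simp add: linear_conv_bounded_linear)
    show "Ti (g y) \<circ> ?T (g y) = id" using Ti(2)[OF gy] by auto
    show "continuous (at y) g" using g(1) U y continuous_on_eq_continuous_at by blast
  qed (use U y g(3) in auto)
  have "times_diff_on k U g" for k
  proof (induction k)
    case 0
    then show ?case using g(1) by simp
  next
    case (Suc k)
    show ?case
    proof (rule times_diff_on_SucI[OF U D])
      fix v
      show "times_diff_on k U (\<lambda>x. Ti (g x) v)"
      proof (rule times_diff_on_linear_solve[where T="\<lambda>y. ?T (g y)" and v="\<lambda>y. v"])
        show "times_diff_on k U (\<lambda>x. frechet_derivative f (at (g x)) z)" for z
          using smooth_on_frechet_derivative[OF f, of z] Suc g(2)
          by (intro times_diff_on_compose[OF U S, where f="\<lambda>x. frechet_derivative f (at x) z"])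
            (auto simp: smooth_on_def)
      qed (use U g Ti lin inj in \<open>auto intro: times_diff_on_const\<close>)
    qed
  qed
  then show ?thesis by (simp add: smooth_on_def)
qed

section \<open>Charts, vector fields and the Lie bracket\<close>

lemma smooth_on_congI: "open S \<Longrightarrow> smooth_on S g \<Longrightarrow> (\<And>x. x \<in> S \<Longrightarrow> f x = g x) \<Longrightarrow> smooth_on S f"
  using smooth_on_cong[of S f g] by blast

lemma chart_inv_snd:
  assumes "smooth_atlas A" "c \<in> A" "p \<in> fst c"
  shows "chart_inv c (snd c p) = p"
  using assms unfolding smooth_atlas_def homeomorphism_def by metis

lemma snd_chart_inv:
  assumes "x \<in> snd c ` fst c"
  shows "snd c (chart_inv c x) = x" "chart_inv c x \<in> fst c"
  using assms by (auto intro: f_inv_into_f inv_into_into)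

lemma chart_inv_mem:
  assumes "smooth_atlas A" "c \<in> A" "x \<in> snd c ` (fst c \<inter> W)"
  shows "chart_inv c x \<in> fst c \<inter> W"
  using assms chart_inv_snd by fastforce

lemma chart_at_mem:
  assumes "smooth_atlas A"
  shows "chart_at A p \<in> A" "p \<in> fst (chart_at A p)"
proof -
  have "\<exists>c. c \<in> A \<and> p \<in> fst c"
    using assms unfolding smooth_atlas_def by (metis UNIV_I UN_E)
  then have "chart_at A p \<in> A \<and> p \<in> fst (chart_at A p)" unfolding chart_at_def by (rule someI_ex)
  then show "chart_at A p \<in> A" "p \<in> fst (chart_at A p)" by auto
qed

lemma open_fst_chart: "smooth_atlas A \<Longrightarrow> c \<in> A \<Longrightarrow> open (fst c)"
  unfolding smooth_atlas_def by blast

lemma open_chart_image: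
  assumes "smooth_atlas A" "c \<in> A" "open W"
  shows "open (snd c ` (fst c \<inter> W))"
proof -
  have o: "open (snd c ` fst c)" and h: "homeomorphism (fst c) (snd c ` fst c) (snd c) (chart_inv c)"
    using assms unfolding smooth_atlas_def by blast+
  have "openin (top_of_set (snd c ` fst c)) (snd c ` (fst c \<inter> W))"
    using homeomorphism_imp_open_map[OF h] assms(3) by (simp add: openin_open_Int)
  then show ?thesis using o openin_open_trans by blast
qed

lemma continuous_on_chart: "smooth_atlas A \<Longrightarrow> c \<in> A \<Longrightarrow> continuous_on (fst c) (snd c)"
  unfolding smooth_atlas_def homeomorphism_def by blast

lemma continuous_on_chart_inv: "smooth_atlas A \<Longrightarrow> c \<in> A \<Longrightarrow> continuous_on (snd c ` fst c) (chart_inv c)"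
  unfolding smooth_atlas_def homeomorphism_def by blast

lemma smooth_on_transition:
  "smooth_atlas A \<Longrightarrow> c \<in> A \<Longrightarrow> d \<in> A \<Longrightarrow> smooth_on (snd c ` (fst c \<inter> fst d)) (snd d \<circ> chart_inv c)"
  unfolding smooth_atlas_def by blast

lemma smooth_funD:
  "smooth_fun A W f \<Longrightarrow> c \<in> A \<Longrightarrow> smooth_on (snd c ` (fst c \<inter> W)) (\<lambda>x. f (chart_inv c x))"
  unfolding smooth_fun_def o_def by blast

lemma smooth_funI:
  "(\<And>c. c \<in> A \<Longrightarrow> smooth_on (snd c ` (fst c \<inter> W)) (\<lambda>x. f (chart_inv c x))) \<Longrightarrow> smooth_fun A W f"
  unfolding smooth_fun_def o_def by blast

text \<open>One chart around each point is enough: near that point any other chart differs from it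
  by a smooth transition map.\<close>

lemma smooth_fun_chartI:
  fixes A :: "('m::{t2_space, second_countable_topology}, 'e::euclidean_space) atlas"
  assumes A: "smooth_atlas A" and W: "open W"
    and loc: "\<And>p. p \<in> W \<Longrightarrow> \<exists>c\<in>A. \<exists>V. open V \<and> p \<in> V \<and> p \<in> fst c \<and>
      smooth_on (snd c ` (fst c \<inter> V)) (\<lambda>x. f (chart_inv c x))"
  shows "smooth_fun A W f"
proof (rule smooth_funI, rule smooth_on_local)
  fix d x assume d: "d \<in> A" and x: "x \<in> snd d ` (fst d \<inter> W)"
  then obtain p where p: "p \<in> fst d" "p \<in> W" "x = snd d p" by blast
  obtain c V where c: "c \<in> A" "open V" "p \<in> V" "p \<in> fst c"
    "smooth_on (snd c ` (fst c \<inter> V)) (\<lambda>x. f (chart_inv c x))" using loc[OF p(2)] by blast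
  let ?N = "snd d ` (fst d \<inter> (V \<inter> fst c))"
  have N: "open ?N" using open_chart_image[OF A d open_Int[OF c(2) open_fst_chart[OF A c(1)]]] .
  have mem: "chart_inv d y \<in> fst d \<and> chart_inv d y \<in> V \<and> chart_inv d y \<in> fst c" if "y \<in> ?N" for y
    using chart_inv_mem[OF A d that] by blast
  have "smooth_on ?N (\<lambda>y. (\<lambda>x. f (chart_inv c x)) ((snd c \<circ> chart_inv d) y))"
    using mem by (intro smooth_on_compose[OF N open_chart_image[OF A c(1,2)] c(5)]
        smooth_on_subset[OF smooth_on_transition[OF A d c(1)]]) auto
  moreover have "f (chart_inv c ((snd c \<circ> chart_inv d) y)) = f (chart_inv d y)" if "y \<in> ?N" for y
    using mem[OF that] chart_inv_snd[OF A c(1)] by simp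
  ultimately have "smooth_on ?N (\<lambda>x. f (chart_inv d x))"
    by (rule smooth_on_congI[OF N _ sym])
  then show "\<exists>T. open T \<and> x \<in> T \<and> smooth_on T (\<lambda>x. f (chart_inv d x))"
    using N p c(3,4) by blast
qed

lemma smooth_fun_subset: "smooth_fun A W f \<Longrightarrow> V \<subseteq> W \<Longrightarrow> smooth_fun A V f"
  unfolding smooth_fun_def by (meson Int_mono image_mono order_refl smooth_on_subset)

lemma smooth_fun_cong:
  assumes "smooth_atlas A" "open W" "\<And>q. q \<in> W \<Longrightarrow> f q = g q"
  shows "smooth_fun A W f \<longleftrightarrow> smooth_fun A W g"
proof -
  have "smooth_on (snd c ` (fst c \<inter> W)) (f \<circ> chart_inv c) \<longleftrightarrow>
     smooth_on (snd c ` (fst c \<inter> W)) (g \<circ> chart_inv c)" if c: "c \<in> A" for c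
    by (rule smooth_on_cong[OF open_chart_image[OF assms(1) c assms(2)]])
      (use assms(3) chart_inv_mem[OF assms(1) c] in auto)
  then show ?thesis unfolding smooth_fun_def by simp
qed

lemma smooth_fun_congI:
  "smooth_atlas A \<Longrightarrow> open W \<Longrightarrow> smooth_fun A W g \<Longrightarrow> (\<And>q. q \<in> W \<Longrightarrow> f q = g q) \<Longrightarrow> smooth_fun A W f"
  using smooth_fun_cong[of A W f g] by blast

lemma smooth_fun_const: "smooth_fun A W (\<lambda>q. k)"
  by (intro smooth_funI smooth_on_const)

lemma smooth_fun_bilinear:
  "bounded_bilinear h \<Longrightarrow> smooth_atlas A \<Longrightarrow> open W \<Longrightarrow> smooth_fun A W f \<Longrightarrow> smooth_fun A W g \<Longrightarrow>
    smooth_fun A W (\<lambda>q. h (f q) (g q))"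
  by (rule smooth_funI, rule smooth_on_bilinear) (auto intro: open_chart_image smooth_funD)

lemma smooth_fun_bounded_linear:
  "bounded_linear h \<Longrightarrow> smooth_atlas A \<Longrightarrow> open W \<Longrightarrow> smooth_fun A W f \<Longrightarrow> smooth_fun A W (\<lambda>q. h (f q))"
  by (rule smooth_funI, rule smooth_on_bounded_linear) (auto intro: open_chart_image smooth_funD)

lemma smooth_fun_add:
  "smooth_atlas A \<Longrightarrow> open W \<Longrightarrow> smooth_fun A W f \<Longrightarrow> smooth_fun A W g \<Longrightarrow> smooth_fun A W (\<lambda>q. f q + g q)"
  by (rule smooth_funI, rule smooth_on_add) (auto intro: open_chart_image smooth_funD)

lemma smooth_fun_diff:
  assumes "smooth_atlas A" "open W" "smooth_fun A W f" "smooth_fun A W g"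
  shows "smooth_fun A W (\<lambda>q. f q - g q)"
  using smooth_fun_add[OF assms(1-3) smooth_fun_bounded_linear[OF bounded_linear_minus[OF bounded_linear_ident] assms(1,2,4)]]
  by simp

lemma smooth_fun_snd:
  assumes "smooth_atlas A" "c \<in> A"
  shows "smooth_fun A (fst c) (snd c)"
  using smooth_on_transition[OF assms(1) _ assms(2)] unfolding smooth_fun_def by blast

section \<open>Differentials of functions and change of charts\<close>

lemma chart_inv_smooth_differentiable:
  assumes "smooth_atlas A" "smooth_fun A W f" "p \<in> W" "c \<in> A" "p \<in> fst c"
  shows "(\<lambda>x. f (chart_inv c x)) differentiable (at (snd c p))"
  using smooth_on_imp_differentiable[OF smooth_funD[OF assms(2,4)]] assms by blast

lemma dfun_has_derivative:
  assumes "smooth_atlas A" "smooth_fun A W f" "p \<in> W"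
  shows "((\<lambda>x. f (chart_inv (chart_at A p) x)) has_derivative dfun A f p) (at (snd (chart_at A p) p))"
  using chart_inv_smooth_differentiable[OF assms chart_at_mem[OF assms(1)]]
  unfolding frechet_derivative_works dfun_def[abs_def] o_def by simp

lemma dfun_eqI:
  assumes "((\<lambda>x. f (chart_inv (chart_at A p) x)) has_derivative D) (at (snd (chart_at A p) p))"
  shows "dfun A f p = D"
  using frechet_derivative_at[OF assms] unfolding dfun_def[abs_def] o_def by simp

lemma linear_dfun: "smooth_atlas A \<Longrightarrow> smooth_fun A W f \<Longrightarrow> p \<in> W \<Longrightarrow> linear (dfun A f p)"
  using has_derivative_linear[OF dfun_has_derivative] .

lemma frechet_chart_inv_cong:
  assumes "smooth_atlas A" "c \<in> A" "p \<in> fst c" "open W" "p \<in> W" "\<And>q. q \<in> W \<Longrightarrow> f q = g q"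
  shows "frechet_derivative (\<lambda>x. f (chart_inv c x)) (at (snd c p)) =
    frechet_derivative (\<lambda>x. g (chart_inv c x)) (at (snd c p))"
  by (rule frechet_derivative_cong_open[OF open_chart_image[OF assms(1,2,4)]])
    (use assms chart_inv_mem[OF assms(1,2)] in auto)

lemma dfun_cong_open:
  assumes "smooth_atlas A" "open W" "p \<in> W" "\<And>q. q \<in> W \<Longrightarrow> f q = g q"
  shows "dfun A f p = dfun A g p"
  using frechet_chart_inv_cong[OF assms(1) chart_at_mem[OF assms(1)] assms(2,3), of f g] assms(4)
  unfolding dfun_def[abs_def] o_def by simp

lemma dfun_const: "dfun A (\<lambda>q. k) p v = 0"
  unfolding dfun_def o_def by simp

lemma dfun_add:
  assumes "smooth_atlas A" "smooth_fun A W f" "smooth_fun A W g" "p \<in> W"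
  shows "dfun A (\<lambda>q. f q + g q) p v = dfun A f p v + dfun A g p v"
  using dfun_eqI[OF has_derivative_add[OF dfun_has_derivative[OF assms(1,2,4)] dfun_has_derivative[OF assms(1,3,4)]]]
  by (rule fun_cong)

lemma dfun_bounded_linear:
  assumes "bounded_linear h" "smooth_atlas A" "smooth_fun A W f" "p \<in> W"
  shows "dfun A (\<lambda>q. h (f q)) p v = h (dfun A f p v)"
  using dfun_eqI[OF bounded_linear.has_derivative[OF assms(1) dfun_has_derivative[OF assms(2-4)]]]
  by (rule fun_cong)

text \<open>\<open>dfun\<close> uses a chart that jumps with the base point, so it cannot be
  differentiated in the base point as it stands. This chain rule rewrites it in one fixed chart
  \<open>c\<close>, where \<open>dfun A (snd c) p\<close> turns tangent vectors at \<open>p\<close>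
  into components in \<open>c\<close>.\<close>

lemma dfun_chart:
  assumes A: "smooth_atlas A" and W: "open W" "p \<in> W" and f: "smooth_fun A W f" and c: "c \<in> A" "p \<in> fst c"
  shows "dfun A f p v = frechet_derivative (\<lambda>x. f (chart_inv c x)) (at (snd c p)) (dfun A (snd c) p v)"
proof -
  let ?x = "snd (chart_at A p) p" and ?\<psi> = "chart_inv (chart_at A p)"
  have [simp]: "?\<psi> ?x = p" using chart_inv_snd[OF A chart_at_mem[OF A]] .
  have 1: "((\<lambda>x. snd c (?\<psi> x)) has_derivative dfun A (snd c) p) (at ?x)"
    by (rule dfun_has_derivative[OF A smooth_fun_snd[OF A c(1)] c(2)])
  have 2: "((\<lambda>x. f (chart_inv c x)) has_derivative
     frechet_derivative (\<lambda>x. f (chart_inv c x)) (at (snd c p))) (at (snd c (?\<psi> ?x)))"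
    using chart_inv_smooth_differentiable[OF A f W(2) c] by (simp add: frechet_derivative_works)
  have "dfun A (\<lambda>q. f (chart_inv c (snd c q))) p =
     (\<lambda>v. frechet_derivative (\<lambda>x. f (chart_inv c x)) (at (snd c p)) (dfun A (snd c) p v))"
    using diff_chain_at[OF 1 2] by (intro dfun_eqI) (simp add: o_def)
  moreover have "dfun A (\<lambda>q. f (chart_inv c (snd c q))) p = dfun A f p"
    by (rule dfun_cong_open[OF A open_Int[OF W(1) open_fst_chart[OF A c(1)]]])
      (use W c chart_inv_snd[OF A c(1)] in auto)
  ultimately show ?thesis by simp
qed

lemma dfun_snd_chart_at:
  assumes A: "smooth_atlas A"
  shows "dfun A (snd (chart_at A p)) p v = v"
proof -
  have "frechet_derivative (\<lambda>x. snd (chart_at A p) (chart_inv (chart_at A p) x)) (at (snd (chart_at A p) p)) =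
        frechet_derivative (\<lambda>x. x) (at (snd (chart_at A p) p))"
    by (rule frechet_derivative_cong_open[OF open_chart_image[OF A chart_at_mem(1)[OF A] open_UNIV]])
      (use chart_at_mem[OF A] in \<open>auto simp: snd_chart_inv\<close>)
  then show ?thesis by (simp add: dfun_def o_def)
qed

lemma dfun_snd_inj:
  assumes A: "smooth_atlas A" and c: "c \<in> A" "p \<in> fst c" and eq: "dfun A (snd c) p v = dfun A (snd c) p w"
  shows "v = w"
  using dfun_chart[OF A open_fst_chart[OF A chart_at_mem(1)[OF A]] chart_at_mem(2)[OF A]
     smooth_fun_snd[OF A chart_at_mem(1)[OF A]] c] eq dfun_snd_chart_at[OF A] by metis

lemma smooth_fun_dfun:
  fixes A :: "('m::{t2_space, second_countable_topology}, 'e::euclidean_space) atlas"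
  assumes A: "smooth_atlas A" and W: "open W" and f: "smooth_fun A W f" and X: "smooth_field A W X"
  shows "smooth_fun A W (\<lambda>q. dfun A f q (X q))"
proof (rule smooth_funI)
  fix c assume c: "c \<in> A"
  let ?N = "snd c ` (fst c \<inter> W)"
  have N: "open ?N" by (rule open_chart_image[OF A c W])
  have "smooth_fun A (fst c \<inter> W) (\<lambda>q. dfun A (snd c) q (X q))"
    using X c unfolding smooth_field_def by blast
  from smooth_funD[OF this c] have "smooth_on ?N (\<lambda>x. dfun A (snd c) (chart_inv c x) (X (chart_inv c x)))"
    by (simp add: Int_assoc[symmetric])
  then have "smooth_on ?N (\<lambda>x. frechet_derivative (\<lambda>x. f (chart_inv c x)) (at x)
      (dfun A (snd c) (chart_inv c x) (X (chart_inv c x))))"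
    by (intro smooth_on_frechet_derivative_field N smooth_funD[OF f c])
  moreover have "frechet_derivative (\<lambda>x. f (chart_inv c x)) (at x)
      (dfun A (snd c) (chart_inv c x) (X (chart_inv c x))) = dfun A f (chart_inv c x) (X (chart_inv c x))"
    if "x \<in> ?N" for x
    using dfun_chart[OF A W _ f c, of "chart_inv c x"] chart_inv_mem[OF A c that] snd_chart_inv[of x c] that
    by auto
  ultimately show "smooth_on ?N (\<lambda>x. dfun A f (chart_inv c x) (X (chart_inv c x)))"
    by (rule smooth_on_congI[OF N _ sym])
qed

section \<open>Smooth vector fields\<close>

lemma smooth_fieldI:
  assumes "\<And>c. c \<in> A \<Longrightarrow> smooth_fun A (fst c \<inter> W) (\<lambda>q. dfun A (snd c) q (X q))"
  shows "smooth_field A W X"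
  using assms unfolding smooth_field_def by blast

lemma smooth_field_subset: "smooth_field A W X \<Longrightarrow> V \<subseteq> W \<Longrightarrow> smooth_field A V X"
  unfolding smooth_field_def by (meson Int_mono order_refl smooth_fun_subset)

lemma linear_dfun_snd: "smooth_atlas A \<Longrightarrow> c \<in> A \<Longrightarrow> q \<in> fst c \<Longrightarrow> linear (dfun A (snd c) q)"
  by (rule linear_dfun[OF _ smooth_fun_snd])

lemma smooth_field_add:
  assumes A: "smooth_atlas A" and W: "open W" and X: "smooth_field A W X" and Y: "smooth_field A W Y"
  shows "smooth_field A W (\<lambda>q. X q + Y q)"
proof (rule smooth_fieldI)
  fix c assume c: "c \<in> A"
  have o: "open (fst c \<inter> W)" using W open_fst_chart[OF A c] by blast
  have "smooth_fun A (fst c \<inter> W) (\<lambda>q. dfun A (snd c) q (X q) + dfun A (snd c) q (Y q))"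
    using X Y c unfolding smooth_field_def by (intro smooth_fun_add A o) auto
  then show "smooth_fun A (fst c \<inter> W) (\<lambda>q. dfun A (snd c) q (X q + Y q))"
    by (subst smooth_fun_cong[OF A o, where g="\<lambda>q. dfun A (snd c) q (X q) + dfun A (snd c) q (Y q)"])
       (auto simp: linear_add[OF linear_dfun_snd[OF A c]])
qed

lemma smooth_field_scaleR:
  assumes A: "smooth_atlas A" and W: "open W" and f: "smooth_fun A W f" and X: "smooth_field A W X"
  shows "smooth_field A W (\<lambda>q. f q *\<^sub>R X q)"
proof (rule smooth_fieldI)
  fix c assume c: "c \<in> A"
  have o: "open (fst c \<inter> W)" using W open_fst_chart[OF A c] by blast
  have "smooth_fun A (fst c \<inter> W) (\<lambda>q. f q *\<^sub>R dfun A (snd c) q (X q))"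
    using X c unfolding smooth_field_def
    by (intro smooth_fun_bilinear[OF bounded_bilinear_scaleR] A o smooth_fun_subset[OF f]) auto
  then show "smooth_fun A (fst c \<inter> W) (\<lambda>q. dfun A (snd c) q (f q *\<^sub>R X q))"
    by (subst smooth_fun_cong[OF A o, where g="\<lambda>q. f q *\<^sub>R dfun A (snd c) q (X q)"])
       (auto simp: linear_cmul[OF linear_dfun_snd[OF A c]])
qed

lemma smooth_field_zero: "smooth_atlas A \<Longrightarrow> open W \<Longrightarrow> smooth_field A W (\<lambda>q. 0)"
  by (intro smooth_fieldI, subst smooth_fun_cong[where g="\<lambda>q. 0"])
    (auto simp: linear_0[OF linear_dfun_snd] smooth_fun_const intro: open_fst_chart)

lemma smooth_field_sum:
  assumes A: "smooth_atlas A" and W: "open W" and X: "\<And>i. i \<in> I \<Longrightarrow> smooth_field A W (X i)"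
  shows "smooth_field A W (\<lambda>q. \<Sum>i\<in>I. X i q)"
  using X by (induction I rule: infinite_finite_induct)
    (auto intro: smooth_field_zero smooth_field_add A W)

text \<open>The first summand is a second derivative of \<open>f\<close> with the direction frozen
  at \<open>Y x\<close>; by symmetry it is the part that cancels in commutators.\<close>

lemma frechet_derivative_field:
  fixes f :: "'a::euclidean_space \<Rightarrow> 'b::euclidean_space"
  assumes N: "open N" "x \<in> N" and f: "smooth_on N f" and Y: "smooth_on N Y"
  shows "frechet_derivative (\<lambda>x. frechet_derivative f (at x) (Y x)) (at x) v =
    frechet_derivative (\<lambda>y. frechet_derivative f (at y) (Y x)) (at x) v +
    frechet_derivative f (at x) (frechet_derivative Y (at x) v)"
proof -
  let ?D = "\<lambda>y. frechet_derivative f (at y)"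
  let ?DD = "\<lambda>b v. frechet_derivative (\<lambda>y. ?D y b) (at x) v"
  have lin: "linear (?D y)" if "y \<in> N" for y
    by (rule linear_frechet_derivative[OF smooth_on_imp_differentiable[OF f that]])
  have DD: "((\<lambda>y. ?D y b) has_derivative ?DD b) (at x)" for b
    using smooth_on_imp_differentiable[OF smooth_on_frechet_derivative[OF f] N(2)]
    by (simp add: frechet_derivative_works)
  have DY: "(Y has_derivative frechet_derivative Y (at x)) (at x)"
    using smooth_on_imp_differentiable[OF Y N(2)] by (simp add: frechet_derivative_works)
  have "frechet_derivative (\<lambda>y. ?D y (Y y)) (at x) =
     frechet_derivative (\<lambda>y. \<Sum>b\<in>Basis. (Y y \<bullet> b) *\<^sub>R ?D y b) (at x)"
    using linear_sum_Basis[OF lin] by (intro frechet_derivative_cong_open[OF N]) blast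
  also have "\<dots> = (\<lambda>v. \<Sum>b\<in>Basis. (Y x \<bullet> b) *\<^sub>R ?DD b v + (frechet_derivative Y (at x) v \<bullet> b) *\<^sub>R ?D x b)"
    by (rule frechet_derivative_at[symmetric])
      (intro has_derivative_sum has_derivative_scaleR DD bounded_linear.has_derivative[OF bounded_linear_inner_left] DY)
  finally have "frechet_derivative (\<lambda>y. ?D y (Y y)) (at x) v =
     (\<Sum>b\<in>Basis. (Y x \<bullet> b) *\<^sub>R ?DD b v) + (\<Sum>b\<in>Basis. (frechet_derivative Y (at x) v \<bullet> b) *\<^sub>R ?D x b)"
    by (simp add: sum.distrib)
  also have "(\<Sum>b\<in>Basis. (frechet_derivative Y (at x) v \<bullet> b) *\<^sub>R ?D x b) = ?D x (frechet_derivative Y (at x) v)"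
    by (rule linear_sum_Basis[OF lin[OF N(2)], symmetric])
  also have "(\<Sum>b\<in>Basis. (Y x \<bullet> b) *\<^sub>R ?DD b v) = ?DD (Y x) v"
  proof -
    have "?DD (Y x) v = frechet_derivative (\<lambda>y. \<Sum>b\<in>Basis. (Y x \<bullet> b) *\<^sub>R ?D y b) (at x) v"
      using linear_sum_Basis[OF lin]
      by (intro fun_cong[OF frechet_derivative_cong_open[OF N]]) blast
    also have "frechet_derivative (\<lambda>y. \<Sum>b\<in>Basis. (Y x \<bullet> b) *\<^sub>R ?D y b) (at x) =
       (\<lambda>v. \<Sum>b\<in>Basis. (Y x \<bullet> b) *\<^sub>R ?DD b v)"
      by (rule frechet_derivative_at[symmetric]) (intro has_derivative_sum has_derivative_scaleR_right DD)
    finally show ?thesis ..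
  qed
  finally show ?thesis .
qed

text \<open>\<open>lie_bracket\<close> is defined through the preferred chart at \<open>p\<close>
  alone. In the commutator of derivations the second derivatives of \<open>f\<close> cancel, and
  what remains is the derivative of \<open>f\<close> applied to exactly those chart components; so
  the commutator formula extends from the chart to every smooth \<open>f\<close>.\<close>

lemma dfun_lie_bracket:
  fixes A :: "('m::{t2_space, second_countable_topology}, 'e::euclidean_space) atlas"
    and f :: "'m \<Rightarrow> 'b::euclidean_space"
  assumes A: "smooth_atlas A" and W: "open W" "p \<in> W"
    and X: "smooth_field A W X" and Y: "smooth_field A W Y" and f: "smooth_fun A W f"
  shows "dfun A f p (lie_bracket A X Y p) =
    dfun A (\<lambda>q. dfun A f q (Y q)) p (X p) - dfun A (\<lambda>q. dfun A f q (X q)) p (Y p)"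
proof -
  let ?c = "chart_at A p"
  let ?N = "snd ?c ` (fst ?c \<inter> W)" and ?x = "snd ?c p"
  let ?f = "\<lambda>x. f (chart_inv ?c x)"
  let ?h = "\<lambda>X x. dfun A (snd ?c) (chart_inv ?c x) (X (chart_inv ?c x))"
  have c: "?c \<in> A" "p \<in> fst ?c" by (rule chart_at_mem[OF A])+
  have N: "open ?N" "?x \<in> ?N" using open_chart_image[OF A c(1) W(1)] W c by auto
  have px: "chart_inv ?c ?x = p" by (rule chart_inv_snd[OF A c])
  have f': "smooth_on ?N ?f" by (rule smooth_funD[OF f c(1)])
  have h: "smooth_on ?N (?h X)" if "smooth_field A W X" for X
    using smooth_funD[OF that[unfolded smooth_field_def, rule_format, OF c(1)] c(1)]
    by (simp add: Int_assoc[symmetric])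
  have hx: "?h X ?x = X p" for X by (simp add: px dfun_snd_chart_at[OF A])
  have br: "lie_bracket A X Y p = frechet_derivative (?h Y) (at ?x) (X p) - frechet_derivative (?h X) (at ?x) (Y p)"
    unfolding lie_bracket_def Let_def dfun_def[of A "\<lambda>q. dfun A (snd (chart_at A p)) q (_ q)"] o_def ..
  have df: "dfun A (\<lambda>q. dfun A f q (Y q)) p v =
     frechet_derivative (\<lambda>y. frechet_derivative ?f (at y) (Y p)) (at ?x) v +
     frechet_derivative ?f (at ?x) (frechet_derivative (?h Y) (at ?x) v)" if Y: "smooth_field A W Y" for Y v
  proof -
    have "dfun A (\<lambda>q. dfun A f q (Y q)) p =
      frechet_derivative (\<lambda>x. dfun A f (chart_inv ?c x) (Y (chart_inv ?c x))) (at ?x)"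
      unfolding dfun_def[of A "\<lambda>q. dfun A f q (Y q)"] o_def ..
    also have "\<dots> = frechet_derivative (\<lambda>x. frechet_derivative ?f (at x) (?h Y x)) (at ?x)"
    proof (rule frechet_derivative_cong_open[OF N])
      fix x assume x: "x \<in> ?N"
      show "dfun A f (chart_inv ?c x) (Y (chart_inv ?c x)) = frechet_derivative ?f (at x) (?h Y x)"
        using dfun_chart[OF A W(1) _ f c(1), of "chart_inv ?c x"] chart_inv_mem[OF A c(1) x] snd_chart_inv[of x ?c] x
        by auto
    qed
    finally show ?thesis using frechet_derivative_field[OF N f' h[OF Y]] hx by simp
  qed
  have lin: "linear (frechet_derivative ?f (at ?x))"
    by (rule linear_frechet_derivative[OF smooth_on_imp_differentiable[OF f' N(2)]])
  have "dfun A f p v = frechet_derivative ?f (at ?x) v" for v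
    unfolding dfun_def o_def ..
  then show ?thesis
    using second_derivative_symmetric[OF N f', of "Y p" "X p"]
    by (simp only: br df[OF X] df[OF Y] linear_diff[OF lin] add_diff_cancel_left)
qed

text \<open>The definition changes chart with the point. The commutator formula for the coordinates
  of a fixed chart \<open>c\<close> expresses the components of the bracket in \<open>c\<close> by
  smooth functions.\<close>

lemma smooth_field_lie_bracket:
  fixes A :: "('m::{t2_space, second_countable_topology}, 'e::euclidean_space) atlas"
  assumes A: "smooth_atlas A" and W: "open W"
    and X: "smooth_field A W X" and Y: "smooth_field A W Y"
  shows "smooth_field A W (lie_bracket A X Y)"
proof (rule smooth_fieldI)
  fix c assume c: "c \<in> A"
  have o: "open (fst c \<inter> W)" using W open_fst_chart[OF A c] by blast
  have s: "smooth_fun A (fst c \<inter> W) (snd c)" by (rule smooth_fun_subset[OF smooth_fun_snd[OF A c]]) simp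
  have X': "smooth_field A (fst c \<inter> W) X" and Y': "smooth_field A (fst c \<inter> W) Y"
    using smooth_field_subset[OF X] smooth_field_subset[OF Y] by auto
  have "smooth_fun A (fst c \<inter> W) (\<lambda>p. dfun A (\<lambda>q. dfun A (snd c) q (Y q)) p (X p) -
       dfun A (\<lambda>q. dfun A (snd c) q (X q)) p (Y p))"
    by (intro smooth_fun_diff smooth_fun_dfun A o s X' Y')
  then show "smooth_fun A (fst c \<inter> W) (\<lambda>q. dfun A (snd c) q (lie_bracket A X Y q))"
    using dfun_lie_bracket[OF A o _ X' Y' s] by (rule smooth_fun_congI[OF A o])
qed

section \<open>Smooth maps\<close>

lemma open_vimage_smooth_map: "smooth_map A B F \<Longrightarrow> open W \<Longrightarrow> open (F -` W)"
  unfolding smooth_map_def by (blast intro: open_vimage)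

lemma smooth_fun_smooth_map:
  fixes A :: "('m::{t2_space, second_countable_topology}, 'e::euclidean_space) atlas"
    and B :: "('k::{t2_space, second_countable_topology}, 'f::euclidean_space) atlas"
  assumes A: "smooth_atlas A" and B: "smooth_atlas B" and F: "smooth_map A B F"
    and W: "open W" and f: "smooth_fun B W f"
  shows "smooth_fun A (F -` W) (\<lambda>q. f (F q))"
proof (rule smooth_fun_chartI[OF A open_vimage_smooth_map[OF F W]])
  fix p assume "p \<in> F -` W"
  then have p: "F p \<in> W" by simp
  let ?c = "chart_at A p" and ?d = "chart_at B (F p)"
  let ?V = "F -` (W \<inter> fst ?d)"
  have c: "?c \<in> A" "p \<in> fst ?c" and d: "?d \<in> B" "F p \<in> fst ?d"
    by (rule chart_at_mem[OF A] chart_at_mem[OF B])+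
  have V: "open ?V" by (rule open_vimage_smooth_map[OF F open_Int[OF W open_fst_chart[OF B d(1)]]])
  let ?N = "snd ?c ` (fst ?c \<inter> ?V)"
  have N: "open ?N" by (rule open_chart_image[OF A c(1) V])
  have mem: "chart_inv ?c x \<in> fst ?c \<inter> ?V" if "x \<in> ?N" for x
    by (rule chart_inv_mem[OF A c(1) that])
  have "smooth_on (snd ?c ` (fst ?c \<inter> F -` fst ?d)) (snd ?d \<circ> F \<circ> chart_inv ?c)"
    using F c d unfolding smooth_map_def by blast
  then have "smooth_on ?N (\<lambda>x. snd ?d (F (chart_inv ?c x)))"
    using smooth_on_subset[of _ _ ?N] unfolding o_def by blast
  then have "smooth_on ?N (\<lambda>x. (\<lambda>y. f (chart_inv ?d y)) (snd ?d (F (chart_inv ?c x))))"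
    using mem by (intro smooth_on_compose[OF N open_chart_image[OF B d(1) W] smooth_funD[OF f d(1)]]) auto
  then have "smooth_on ?N (\<lambda>x. f (F (chart_inv ?c x)))"
    by (rule smooth_on_congI[OF N]) (use mem chart_inv_snd[OF B d(1)] in auto)
  then show "\<exists>c\<in>A. \<exists>V. open V \<and> p \<in> V \<and> p \<in> fst c \<and> smooth_on (snd c ` (fst c \<inter> V)) (\<lambda>x. f (F (chart_inv c x)))"
    using c d V p by (intro bexI[of _ ?c] exI[of _ ?V]) auto
qed

lemma dmap_has_derivative:
  fixes A :: "('m::{t2_space, second_countable_topology}, 'e::euclidean_space) atlas"
    and B :: "('k::{t2_space, second_countable_topology}, 'f::euclidean_space) atlas"
  assumes A: "smooth_atlas A" and B: "smooth_atlas B" and F: "smooth_map A B F"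
  shows "((\<lambda>x. snd (chart_at B (F p)) (F (chart_inv (chart_at A p) x))) has_derivative dmap A B F p)
    (at (snd (chart_at A p) p))"
  using dfun_has_derivative[OF A smooth_fun_smooth_map[OF A B F open_fst_chart smooth_fun_snd], OF B _ B,
     of "chart_at B (F p)" p] chart_at_mem[OF B, of "F p"]
  unfolding dmap_def[abs_def] o_def by simp

lemma linear_dmap:
  fixes A :: "('m::{t2_space, second_countable_topology}, 'e::euclidean_space) atlas"
    and B :: "('k::{t2_space, second_countable_topology}, 'f::euclidean_space) atlas"
  shows "smooth_atlas A \<Longrightarrow> smooth_atlas B \<Longrightarrow> smooth_map A B F \<Longrightarrow> linear (dmap A B F p)"
  using has_derivative_linear[OF dmap_has_derivative] .

lemma dfun_smooth_map:
  fixes A :: "('m::{t2_space, second_countable_topology}, 'e::euclidean_space) atlas"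
    and B :: "('k::{t2_space, second_countable_topology}, 'f::euclidean_space) atlas"
  assumes A: "smooth_atlas A" and B: "smooth_atlas B" and F: "smooth_map A B F"
    and W: "open W" "F p \<in> W" and f: "smooth_fun B W f"
  shows "dfun A (\<lambda>q. f (F q)) p v = dfun B f (F p) (dmap A B F p v)"
proof -
  let ?c = "chart_at A p" and ?d = "chart_at B (F p)"
  have d: "?d \<in> B" "F p \<in> fst ?d" by (rule chart_at_mem[OF B])+
  have px: "chart_inv ?c (snd ?c p) = p" using chart_inv_snd[OF A chart_at_mem[OF A]] .
  have "dfun A (\<lambda>q. f (chart_inv ?d (snd ?d (F q)))) p = (\<lambda>v. dfun B f (F p) (dmap A B F p v))"
    using diff_chain_at[OF dmap_has_derivative[OF A B F, of p], of "\<lambda>y. f (chart_inv ?d y)"]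
      dfun_has_derivative[OF B f W(2)]
    by (intro dfun_eqI) (simp add: px o_def)
  moreover have "dfun A (\<lambda>q. f (chart_inv ?d (snd ?d (F q)))) p = dfun A (\<lambda>q. f (F q)) p"
    by (rule dfun_cong_open[OF A open_vimage_smooth_map[OF F open_fst_chart[OF B d(1)]]])
      (use d chart_inv_snd[OF B d(1)] in auto)
  ultimately show ?thesis by simp
qed

lemma smooth_mapI:
  fixes B :: "('k::{t2_space, second_countable_topology}, 'f::euclidean_space) atlas"
  assumes B: "smooth_atlas B" and F: "continuous_on UNIV F"
    and sm: "\<And>d. d \<in> B \<Longrightarrow> smooth_fun A (F -` fst d) (\<lambda>q. snd d (F q))"
  shows "smooth_map A B F"
  using F sm unfolding smooth_map_def smooth_fun_def o_def by blast

lemma smooth_map_compose: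
  fixes A :: "('m::{t2_space, second_countable_topology}, 'e::euclidean_space) atlas"
    and B :: "('k::{t2_space, second_countable_topology}, 'f::euclidean_space) atlas"
    and C :: "('l::{t2_space, second_countable_topology}, 'h::euclidean_space) atlas"
  assumes A: "smooth_atlas A" and B: "smooth_atlas B" and C: "smooth_atlas C"
    and H: "smooth_map A B H" and F: "smooth_map B C F"
  shows "smooth_map A C (\<lambda>q. F (H q))"
proof (rule smooth_mapI[OF C])
  show "continuous_on UNIV (\<lambda>q. F (H q))"
    using H F unfolding smooth_map_def by (auto intro: continuous_on_compose2)
  fix d assume d: "d \<in> C"
  show "smooth_fun A ((\<lambda>q. F (H q)) -` fst d) (\<lambda>q. snd d (F (H q)))"
    using smooth_fun_smooth_map[OF A B H open_vimage_smooth_map[OF F open_fst_chart[OF C d]]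
      smooth_fun_smooth_map[OF B C F open_fst_chart[OF C d] smooth_fun_snd[OF C d]]]
    by (simp add: vimage_def)
qed

lemma dmap_compose:
  fixes A :: "('m::{t2_space, second_countable_topology}, 'e::euclidean_space) atlas"
    and B :: "('k::{t2_space, second_countable_topology}, 'f::euclidean_space) atlas"
    and C :: "('l::{t2_space, second_countable_topology}, 'h::euclidean_space) atlas"
  assumes A: "smooth_atlas A" and B: "smooth_atlas B" and C: "smooth_atlas C"
    and H: "smooth_map A B H" and F: "smooth_map B C F"
  shows "dmap A C (\<lambda>q. F (H q)) p v = dmap B C F (H p) (dmap A B H p v)"
proof -
  let ?d = "chart_at C (F (H p))"
  have d: "?d \<in> C" "F (H p) \<in> fst ?d" by (rule chart_at_mem[OF C])+
  show ?thesis
    using dfun_smooth_map[OF A B H open_vimage_smooth_map[OF F open_fst_chart[OF C d(1)]] _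
        smooth_fun_smooth_map[OF B C F open_fst_chart[OF C d(1)] smooth_fun_snd[OF C d(1)]], of p v] d(2)
    unfolding dmap_def o_def by simp
qed

lemma dmap_ident: "smooth_atlas A \<Longrightarrow> dmap A A (\<lambda>q. q) p v = v"
  using dfun_snd_chart_at[of A p v] unfolding dmap_def o_def by simp

text \<open>Tested on the coordinates of the preferred chart at \<open>F p\<close>, pulled back by
  \<open>F\<close>: by the chain rule, differentiating a pulled back function along \<open>X\<close>
  amounts to differentiating the function along \<open>X'\<close>.\<close>

lemma lie_bracket_related:
  fixes A :: "('m::{t2_space, second_countable_topology}, 'e::euclidean_space) atlas"
    and B :: "('k::{t2_space, second_countable_topology}, 'f::euclidean_space) atlas"
  assumes A: "smooth_atlas A" and B: "smooth_atlas B" and F: "smooth_map A B F"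
    and V: "open V" "p \<in> V" and W: "open W" "F ` V \<subseteq> W"
    and X: "smooth_field A V X" and Y: "smooth_field A V Y"
    and X': "smooth_field B W X'" and Y': "smooth_field B W Y'"
    and FX: "\<And>q. q \<in> V \<Longrightarrow> dmap A B F q (X q) = X' (F q)"
    and FY: "\<And>q. q \<in> V \<Longrightarrow> dmap A B F q (Y q) = Y' (F q)"
  shows "dmap A B F p (lie_bracket A X Y p) = lie_bracket B X' Y' (F p)"
proof -
  let ?d = "chart_at B (F p)"
  let ?W = "W \<inter> fst ?d"
  let ?V = "V \<inter> F -` ?W"
  let ?\<phi> = "\<lambda>q. snd ?d (F q)"
  have d: "?d \<in> B" "F p \<in> fst ?d" by (rule chart_at_mem[OF B])+
  have oW: "open ?W" using W open_fst_chart[OF B d(1)] by blast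
  have oV: "open ?V" using V open_vimage_smooth_map[OF F oW] by blast
  have pV: "p \<in> ?V" using V W d by auto
  have s: "smooth_fun B ?W (snd ?d)" by (rule smooth_fun_subset[OF smooth_fun_snd[OF B d(1)]]) simp
  have \<phi>: "smooth_fun A ?V ?\<phi>"
    by (rule smooth_fun_subset[OF smooth_fun_smooth_map[OF A B F oW s]]) blast
  \<comment> \<open>Half of the commutator, stated for arbitrary related fields so that it serves
    again with the two fields exchanged.\<close>
  have step: "dfun A (\<lambda>q. dfun A ?\<phi> q (Y q)) p (X p) = dfun B (\<lambda>r. dfun B (snd ?d) r (Y' r)) (F p) (X' (F p))"
    if Y': "smooth_field B W Y'" and FX: "\<And>q. q \<in> V \<Longrightarrow> dmap A B F q (X q) = X' (F q)"
      and FY: "\<And>q. q \<in> V \<Longrightarrow> dmap A B F q (Y q) = Y' (F q)" for X Y X' Y'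
  proof -
    let ?h = "\<lambda>r. dfun B (snd ?d) r (Y' r)"
    have h: "smooth_fun B ?W ?h"
      by (rule smooth_fun_dfun[OF B oW s smooth_field_subset[OF Y']]) simp
    have "dfun A (\<lambda>q. dfun A ?\<phi> q (Y q)) p = dfun A (\<lambda>q. ?h (F q)) p"
      by (rule dfun_cong_open[OF A oV pV]) (use dfun_smooth_map[OF A B F oW _ s] FY in auto)
    moreover have "dfun A (\<lambda>q. ?h (F q)) p (X p) = dfun B ?h (F p) (X' (F p))"
      using dfun_smooth_map[OF A B F oW _ h, of p "X p"] pV FX by simp
    ultimately show ?thesis by simp
  qed
  have "dmap A B F p (lie_bracket A X Y p) = dfun A ?\<phi> p (lie_bracket A X Y p)"
    by (simp add: dmap_def o_def)
  also have "\<dots> = dfun A (\<lambda>q. dfun A ?\<phi> q (Y q)) p (X p) - dfun A (\<lambda>q. dfun A ?\<phi> q (X q)) p (Y p)"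
    by (rule dfun_lie_bracket[OF A oV pV smooth_field_subset[OF X] smooth_field_subset[OF Y] \<phi>]) auto
  also have "\<dots> = lie_bracket B X' Y' (F p)"
    unfolding lie_bracket_def Let_def
    using step[where X=X and Y=Y and X'=X' and Y'=Y', OF Y' FX FY]
      step[where X=Y and Y=X and X'=Y' and Y'=X', OF X' FY FX] by simp
  finally show ?thesis .
qed

text \<open>This makes continuous local sections of the covering smooth: in charts,
  \<open>\<sigma>\<close> is a continuous right inverse of a map with injective differential between
  spaces of equal dimension.\<close>

lemma smooth_fun_local_inverse:
  fixes A :: "('m::{t2_space, second_countable_topology}, 'e::euclidean_space) atlas"
    and B :: "('k::{t2_space, second_countable_topology}, 'e) atlas"
  assumes A: "smooth_atlas A" and B: "smooth_atlas B" and F: "smooth_map A B F"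
    and inj: "\<And>q v. q \<in> U \<Longrightarrow> dmap A B F q v = 0 \<Longrightarrow> v = 0"
    and U: "open U" and T: "open T" and \<sigma>: "continuous_on T \<sigma>" "\<sigma> ` T \<subseteq> U" "\<And>y. y \<in> T \<Longrightarrow> F (\<sigma> y) = y"
    and f: "smooth_fun A U f"
  shows "smooth_fun B T (\<lambda>y. f (\<sigma> y))"
proof (rule smooth_fun_chartI[OF B T])
  fix y0 assume y0: "y0 \<in> T"
  let ?d = "chart_at B y0" and ?c = "chart_at A (\<sigma> y0)"
  have d: "?d \<in> B" "y0 \<in> fst ?d" and c: "?c \<in> A" "\<sigma> y0 \<in> fst ?c"
    by (rule chart_at_mem[OF A] chart_at_mem[OF B])+
  let ?V = "T \<inter> \<sigma> -` (U \<inter> fst ?c)"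
  have V: "open ?V" by (rule continuous_open_preimage[OF \<sigma>(1) T open_Int[OF U open_fst_chart[OF A c(1)]]])
  let ?\<Omega> = "snd ?d ` (fst ?d \<inter> ?V)" and ?S = "snd ?c ` (fst ?c \<inter> (U \<inter> F -` fst ?d))"
  let ?f = "\<lambda>x. snd ?d (F (chart_inv ?c x))" and ?g = "\<lambda>y. snd ?c (\<sigma> (chart_inv ?d y))"
  have Fd: "open (F -` fst ?d)" by (rule open_vimage_smooth_map[OF F open_fst_chart[OF B d(1)]])
  have \<Omega>: "open ?\<Omega>" by (rule open_chart_image[OF B d(1) V])
  have S: "open ?S" by (rule open_chart_image[OF A c(1) open_Int[OF U Fd]])
  have sF: "smooth_fun A (F -` fst ?d) (\<lambda>q. snd ?d (F q))"
    by (rule smooth_fun_smooth_map[OF A B F open_fst_chart[OF B d(1)] smooth_fun_snd[OF B d(1)]])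
  have memd: "chart_inv ?d y \<in> fst ?d \<inter> ?V" if "y \<in> ?\<Omega>" for y
    by (rule chart_inv_mem[OF B d(1) that])
  have memc: "chart_inv ?c x \<in> fst ?c \<inter> (U \<inter> F -` fst ?d)" if "x \<in> ?S" for x
    by (rule chart_inv_mem[OF A c(1) that])
  have g: "smooth_on ?\<Omega> ?g"
  proof (rule smooth_on_local_inverse[OF S \<Omega>, of ?f])
    show "smooth_on ?S ?f" by (rule smooth_on_subset[OF smooth_funD[OF sF c(1)]]) auto
    show "continuous_on ?\<Omega> ?g"
      by (rule continuous_on_compose2[OF continuous_on_chart[OF A c(1)]
          continuous_on_compose2[OF \<sigma>(1) continuous_on_subset[OF continuous_on_chart_inv[OF B d(1)]]]])
        (use memd in auto)
    show "?g ` ?\<Omega> \<subseteq> ?S"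
    proof (rule image_subsetI)
      fix y assume y: "y \<in> ?\<Omega>"
      show "?g y \<in> ?S"
        by (rule imageI) (use memd[OF y] \<sigma>(3) in auto)
    qed
    show "?f (?g y) = y" if y: "y \<in> ?\<Omega>" for y
    proof -
      have "chart_inv ?c (?g y) = \<sigma> (chart_inv ?d y)" using memd[OF y] by (intro chart_inv_snd[OF A c(1)]) auto
      then show ?thesis using memd[OF y] \<sigma>(3) snd_chart_inv[of y ?d] y by auto
    qed
    fix x z assume x: "x \<in> ?S" and z: "frechet_derivative ?f (at x) z = 0"
    let ?p = "chart_inv ?c x"
    have p: "?p \<in> fst ?c" "?p \<in> U" "F ?p \<in> fst ?d" using memc[OF x] by auto
    have xp: "snd ?c ?p = x" using snd_chart_inv[of x ?c] x by auto
    have lin: "linear (dfun A (snd ?c) ?p)" by (rule linear_dfun_snd[OF A c(1) p(1)])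
    \<comment> \<open>Chart differentials are bijective, so a kernel vector of the coordinate map
      comes from a kernel vector of \<open>dmap\<close>, which is 0.\<close>
    have "inj (dfun A (snd ?c) ?p)" using dfun_snd_inj[OF A c(1) p(1)] by (blast intro: injI)
    then have "surj (dfun A (snd ?c) ?p)" using linear_injective_imp_surjective[OF lin] by simp
    then obtain v where v: "z = dfun A (snd ?c) ?p v" by (metis surjD)
    have "dfun A (\<lambda>q. snd ?d (F q)) ?p v = 0"
      using dfun_chart[OF A Fd _ sF c(1) p(1), of v] p(3) z xp v by simp
    then have "dfun B (snd ?d) (F ?p) (dmap A B F ?p v) = dfun B (snd ?d) (F ?p) 0"
      using dfun_smooth_map[OF A B F open_fst_chart[OF B d(1)] p(3) smooth_fun_snd[OF B d(1)]]
        linear_0[OF linear_dfun_snd[OF B d(1) p(3)]] by simp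
    then have "v = 0" using dfun_snd_inj[OF B d(1) p(3)] inj[OF p(2)] by blast
    then show "z = 0" using v linear_0[OF lin] by simp
  qed
  have "smooth_on ?\<Omega> (\<lambda>y. (\<lambda>x. f (chart_inv ?c x)) (?g y))"
    using memd by (intro smooth_on_compose[OF \<Omega> open_chart_image[OF A c(1) U] smooth_funD[OF f c(1)] g]) auto
  then have "smooth_on ?\<Omega> (\<lambda>y. f (\<sigma> (chart_inv ?d y)))"
    by (rule smooth_on_congI[OF \<Omega>]) (use memd chart_inv_snd[OF A c(1)] in auto)
  then show "\<exists>c\<in>B. \<exists>V. open V \<and> y0 \<in> V \<and> y0 \<in> fst c \<and> smooth_on (snd c ` (fst c \<inter> V)) (\<lambda>x. f (\<sigma> (chart_inv c x)))"
    using d V y0 c(2) \<sigma>(2) by (intro bexI[of _ ?d] exI[of _ ?V]) auto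
qed

section \<open>The complex structure and its integrability\<close>

lemma linear_J: "linear (J :: complex ^ 'n::finite \<Rightarrow> complex ^ 'n)"
  by (rule linearI) (auto simp: J_def vec_eq_iff algebra_simps)

lemma J_J [simp]: "J (J v) = - (v :: complex ^ 'n::finite)"
  by (auto simp: J_def vec_eq_iff mult.assoc[symmetric])

lemma bounded_linear_J: "bounded_linear (J :: complex ^ 'n::finite \<Rightarrow> complex ^ 'n)"
  using linear_J linear_conv_bounded_linear by blast

lemma complex_atlas_smooth: "complex_atlas A \<Longrightarrow> smooth_atlas A"
  unfolding complex_atlas_def by blast

lemma dfun_snd_J:
  assumes A: "complex_atlas A" and c: "c \<in> A" "q \<in> fst c"
  shows "dfun A (snd c) q (J v) = J (dfun A (snd c) q v)"
  using A c chart_at_mem[OF complex_atlas_smooth[OF A], of q]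
  unfolding complex_atlas_def dfun_def by blast

text \<open>In a holomorphic chart \<open>J\<close> acts on components as a constant linear map and
  so commutes with directional derivatives; expanding the four brackets in that chart gives the
  identity.\<close>

lemma nijenhuis_tensor_vanishes:
  assumes A: "complex_atlas A" and W: "open W" "p \<in> W"
    and X: "smooth_field A W X" and Y: "smooth_field A W Y"
  shows "lie_bracket A (\<lambda>q. J (X q)) (\<lambda>q. J (Y q)) p =
    lie_bracket A X Y p + J (lie_bracket A (\<lambda>q. J (X q)) Y p) + J (lie_bracket A X (\<lambda>q. J (Y q)) p)"
proof -
  note A' = complex_atlas_smooth[OF A]
  let ?c = "chart_at A p"
  have c: "?c \<in> A" "p \<in> fst ?c" by (rule chart_at_mem[OF A'])+
  have o: "open (fst ?c \<inter> W)" "p \<in> fst ?c \<inter> W" using W open_fst_chart[OF A' c(1)] c(2) by auto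
  have "dfun A (\<lambda>q. dfun A (snd ?c) q (J (Y q))) p v = J (dfun A (\<lambda>q. dfun A (snd ?c) q (Y q)) p v)"
    if Y: "smooth_field A W Y" for Y v
  proof -
    have "dfun A (\<lambda>q. dfun A (snd ?c) q (J (Y q))) p = dfun A (\<lambda>q. J (dfun A (snd ?c) q (Y q))) p"
      by (rule dfun_cong_open[OF A' o]) (simp add: dfun_snd_J[OF A c(1)])
    moreover have "smooth_fun A (fst ?c \<inter> W) (\<lambda>q. dfun A (snd ?c) q (Y q))"
      using Y c unfolding smooth_field_def by blast
    ultimately show ?thesis using dfun_bounded_linear[OF bounded_linear_J A' _ o(2)] by simp
  qed
  from this[OF X] this[OF Y] show ?thesis
    unfolding lie_bracket_def Let_def by (simp add: linear_diff[OF linear_J])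
qed

section \<open>Left invariant vector fields\<close>

lemma chart_inv_map_prod:
  assumes "smooth_atlas A" "c \<in> A" "d \<in> A" "x \<in> snd c ` fst c" "y \<in> snd d ` fst d"
  shows "inv_into (fst c \<times> fst d) (map_prod (snd c) (snd d)) (x, y) = (chart_inv c x, chart_inv d y)"
proof (rule inv_into_f_eq)
  show "inj_on (map_prod (snd c) (snd d)) (fst c \<times> fst d)"
    using chart_inv_snd[OF assms(1,2)] chart_inv_snd[OF assms(1,3)]
    by (intro map_prod_inj_on) (metis inj_onI)+
qed (use assms(4,5) in \<open>auto simp: snd_chart_inv f_inv_into_f inv_into_into\<close>)

lemma smooth_on_mult_chart:
  fixes B :: "('g::{t2_space, second_countable_topology}, 'e::euclidean_space) atlas"
  assumes G: "lie_group B G" and c: "c1 \<in> B" "c2 \<in> B" "d \<in> B"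
  defines "O1 \<equiv> {z \<in> snd c1 ` fst c1 \<times> snd c2 ` fst c2. chart_inv c1 (fst z) \<otimes>\<^bsub>G\<^esub> chart_inv c2 (snd z) \<in> fst d}"
  shows "open O1" "smooth_on O1 (\<lambda>z. snd d (chart_inv c1 (fst z) \<otimes>\<^bsub>G\<^esub> chart_inv c2 (snd z)))"
proof -
  have B: "smooth_atlas B" and m: "smooth_map (prod_atlas B B) B (\<lambda>(x, y). x \<otimes>\<^bsub>G\<^esub> y)"
    using G unfolding lie_group_def by blast+
  let ?P = "snd c1 ` fst c1 \<times> snd c2 ` fst c2"
  let ?m = "\<lambda>z. chart_inv c1 (fst z) \<otimes>\<^bsub>G\<^esub> chart_inv c2 (snd z)"
  have P: "open ?P"
    using open_chart_image[OF B c(1) open_UNIV] open_chart_image[OF B c(2) open_UNIV] by (auto intro: open_Times)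
  have mc: "continuous_on UNIV (\<lambda>z. fst z \<otimes>\<^bsub>G\<^esub> snd z)"
    using m unfolding smooth_map_def by (simp add: case_prod_beta')
  have "continuous_on ?P (\<lambda>z. (chart_inv c1 (fst z), chart_inv c2 (snd z)))"
    by (intro continuous_on_Pair continuous_on_compose2[OF continuous_on_chart_inv[OF B c(1)] continuous_on_fst[OF continuous_on_id]]
        continuous_on_compose2[OF continuous_on_chart_inv[OF B c(2)] continuous_on_snd[OF continuous_on_id]]) auto
  from continuous_on_compose2[OF mc this] have "continuous_on ?P ?m" by simp
  then have "open (?P \<inter> ?m -` fst d)"
    by (rule continuous_open_preimage[OF _ P open_fst_chart[OF B c(3)]])
  also have "?P \<inter> ?m -` fst d = O1" unfolding O1_def by auto
  finally show O1: "open O1" .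
  let ?c = "(fst c1 \<times> fst c2, map_prod (snd c1) (snd c2))"
  have "?c \<in> prod_atlas B B" using c unfolding prod_atlas_def by blast
  then have s: "smooth_on (snd ?c ` (fst ?c \<inter> (\<lambda>(x, y). x \<otimes>\<^bsub>G\<^esub> y) -` fst d)) (snd d \<circ> (\<lambda>(x, y). x \<otimes>\<^bsub>G\<^esub> y) \<circ> chart_inv ?c)"
    using m c unfolding smooth_map_def by blast
  have "O1 \<subseteq> snd ?c ` (fst ?c \<inter> (\<lambda>(x, y). x \<otimes>\<^bsub>G\<^esub> y) -` fst d)"
  proof
    fix z assume z: "z \<in> O1"
    then have "z = snd ?c (chart_inv c1 (fst z), chart_inv c2 (snd z))"
      unfolding O1_def by (auto simp: snd_chart_inv mem_Times_iff intro!: prod_eqI)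
    moreover have "(chart_inv c1 (fst z), chart_inv c2 (snd z)) \<in> fst ?c \<inter> (\<lambda>(x, y). x \<otimes>\<^bsub>G\<^esub> y) -` fst d"
      using z unfolding O1_def by (auto simp: mem_Times_iff intro: snd_chart_inv)
    ultimately show "z \<in> snd ?c ` (fst ?c \<inter> (\<lambda>(x, y). x \<otimes>\<^bsub>G\<^esub> y) -` fst d)" by blast
  qed
  from smooth_on_subset[OF s this] show "smooth_on O1 (\<lambda>z. snd d (?m z))"
  proof (rule smooth_on_congI[OF O1])
    fix z assume "z \<in> O1"
    then have "fst z \<in> snd c1 ` fst c1" "snd z \<in> snd c2 ` fst c2" unfolding O1_def by auto
    then show "snd d (?m z) = (snd d \<circ> (\<lambda>(x, y). x \<otimes>\<^bsub>G\<^esub> y) \<circ> chart_inv ?c) z"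
      using chart_inv_map_prod[OF B c(1,2), of "fst z" "snd z"] by simp
  qed
qed

lemma smooth_map_left_mult:
  fixes B :: "('g::{t2_space, second_countable_topology}, 'e::euclidean_space) atlas"
  assumes G: "lie_group B G"
  shows "smooth_map B B (\<lambda>b. a \<otimes>\<^bsub>G\<^esub> b)"
proof (rule smooth_mapI)
  show B: "smooth_atlas B" using G unfolding lie_group_def by blast
  have mc: "continuous_on UNIV (\<lambda>z. fst z \<otimes>\<^bsub>G\<^esub> snd z)"
    using G unfolding smooth_map_def lie_group_def by (simp add: case_prod_beta')
  have "continuous_on UNIV (\<lambda>b. (a, b))" by (intro continuous_intros)
  from continuous_on_compose2[OF mc this] show L: "continuous_on UNIV (\<lambda>b. a \<otimes>\<^bsub>G\<^esub> b)" by simp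
  fix d assume d: "d \<in> B"
  let ?c1 = "chart_at B a"
  have c1: "?c1 \<in> B" "a \<in> fst ?c1" by (rule chart_at_mem[OF B])+
  have o: "open ((\<lambda>b. a \<otimes>\<^bsub>G\<^esub> b) -` fst d)" using open_vimage[OF open_fst_chart[OF B d] L] .
  show "smooth_fun B ((\<lambda>b. a \<otimes>\<^bsub>G\<^esub> b) -` fst d) (\<lambda>q. snd d (a \<otimes>\<^bsub>G\<^esub> q))"
  proof (rule smooth_funI)
    fix c assume c: "c \<in> B"
    note M = smooth_on_mult_chart[OF G c1(1) c d]
    let ?N = "snd c ` (fst c \<inter> (\<lambda>b. a \<otimes>\<^bsub>G\<^esub> b) -` fst d)"
    have N: "open ?N" by (rule open_chart_image[OF B c o])
    have "smooth_on ?N (\<lambda>y. (\<lambda>z. snd d (chart_inv ?c1 (fst z) \<otimes>\<^bsub>G\<^esub> chart_inv c (snd z))) (snd ?c1 a, y))"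
      by (rule smooth_on_compose[OF N M smooth_on_Pair[OF N smooth_on_const smooth_on_id[OF N]]])
        (use c1 chart_inv_snd[OF B c1] chart_inv_snd[OF B c] in auto)
    then show "smooth_on ?N (\<lambda>x. snd d (a \<otimes>\<^bsub>G\<^esub> chart_inv c x))"
      using chart_inv_snd[OF B c1] by simp
  qed
qed

text \<open>The value at \<open>a\<close> is the partial derivative of the multiplication in its
  second argument, taken at \<open>a\<close> and the identity. Smooth dependence on \<open>a\<close>
  therefore rests on joint smoothness of the multiplication, not just on that of each left
  translation.\<close>

lemma smooth_field_left_inv_field:
  fixes B :: "('g::{t2_space, second_countable_topology}, 'e::euclidean_space) atlas"
  assumes G: "lie_group B G"
  shows "smooth_field B UNIV (left_inv_field B G x)"
proof (rule smooth_fieldI)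
  have B: "smooth_atlas B" and gr: "group G" "carrier G = UNIV" using G unfolding lie_group_def by blast+
  interpret group G by (rule gr)
  have one: "q \<otimes>\<^bsub>G\<^esub> \<one>\<^bsub>G\<^esub> = q" for q using r_one gr(2) by blast
  fix d assume d: "d \<in> B"
  have o: "open (fst d)" by (rule open_fst_chart[OF B d])
  let ?e = "chart_at B \<one>\<^bsub>G\<^esub>"
  have e: "?e \<in> B" "\<one>\<^bsub>G\<^esub> \<in> fst ?e" by (rule chart_at_mem[OF B])+
  let ?y = "snd ?e \<one>\<^bsub>G\<^esub>"
  let ?N = "snd d ` fst d"
  have N: "open ?N" using open_chart_image[OF B d open_UNIV] by simp
  let ?M = "\<lambda>z. snd d (chart_inv d (fst z) \<otimes>\<^bsub>G\<^esub> chart_inv ?e (snd z))"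
  note M = smooth_on_mult_chart[OF G d e(1) d]
  let ?O = "{z \<in> snd d ` fst d \<times> snd ?e ` fst ?e. chart_inv d (fst z) \<otimes>\<^bsub>G\<^esub> chart_inv ?e (snd z) \<in> fst d}"
  have mem: "(u, ?y) \<in> ?O" if "u \<in> ?N" for u
    using that e chart_inv_snd[OF B e] one snd_chart_inv(2)[OF that] by auto
  have "smooth_on ?N (\<lambda>u. frechet_derivative ?M (at (u, ?y)) (0, x))"
    by (rule smooth_on_compose[OF N M(1) smooth_on_frechet_derivative[OF M(2)], of "\<lambda>u. (u, ?y)" "(0, x)"])
      (use mem in \<open>auto intro!: smooth_on_Pair N smooth_on_id smooth_on_const\<close>)
  then have "smooth_on ?N (\<lambda>u. dfun B (snd d) (chart_inv d u) (left_inv_field B G x (chart_inv d u)))"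
  proof (rule smooth_on_congI[OF N])
    fix u assume u: "u \<in> ?N"
    let ?q = "chart_inv d u"
    have q: "?q \<in> fst d" by (rule snd_chart_inv(2)[OF u])
    have "dfun B (snd d) ?q (left_inv_field B G x ?q) = dfun B (\<lambda>b. snd d (?q \<otimes>\<^bsub>G\<^esub> b)) \<one>\<^bsub>G\<^esub> x"
      unfolding left_inv_field_def
      using dfun_smooth_map[OF B B smooth_map_left_mult[OF G, of ?q] o _ smooth_fun_snd[OF B d], of "\<one>\<^bsub>G\<^esub>" x] q one
      by simp
    also have "\<dots> = frechet_derivative (\<lambda>y. ?M (u, y)) (at ?y) x"
      by (simp add: dfun_def o_def)
    also have "frechet_derivative (\<lambda>y. ?M (u, y)) (at ?y) = (\<lambda>v. frechet_derivative ?M (at (u, ?y)) (0, v))"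
    proof (rule frechet_derivative_at[symmetric])
      have "((\<lambda>y. (u, y)) has_derivative (\<lambda>v. (0, v))) (at ?y)"
        by (intro has_derivative_Pair has_derivative_const has_derivative_ident)
      moreover have "(?M has_derivative frechet_derivative ?M (at (u, ?y))) (at (u, ?y))"
        using smooth_on_imp_differentiable[OF M(2) mem[OF u]] by (simp only: frechet_derivative_works)
      ultimately show "((\<lambda>y. ?M (u, y)) has_derivative (\<lambda>v. frechet_derivative ?M (at (u, ?y)) (0, v))) (at ?y)"
        using diff_chain_at[of "\<lambda>y. (u, y)" "\<lambda>v. (0, v)" ?y ?M] by (simp add: o_def)
    qed
    finally show "dfun B (snd d) ?q (left_inv_field B G x ?q) = frechet_derivative ?M (at (u, ?y)) (0, x)" .
  qed
  then show "smooth_fun B (fst d \<inter> UNIV) (\<lambda>q. dfun B (snd d) q (left_inv_field B G x q))"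
    using d o by (intro smooth_fun_chartI[OF B]) (auto intro!: bexI[of _ d] exI[of _ "fst d"])
qed

lemma left_inv_field_mult:
  fixes B :: "('g::{t2_space, second_countable_topology}, 'e::euclidean_space) atlas"
  assumes G: "lie_group B G"
  shows "left_inv_field B G x (a \<otimes>\<^bsub>G\<^esub> b) = dmap B B (\<lambda>b. a \<otimes>\<^bsub>G\<^esub> b) b (left_inv_field B G x b)"
proof -
  have B: "smooth_atlas B" and gr: "group G" "carrier G = UNIV" using G unfolding lie_group_def by blast+
  interpret group G by (rule gr)
  have *: "(\<lambda>c. a \<otimes>\<^bsub>G\<^esub> b \<otimes>\<^bsub>G\<^esub> c) = (\<lambda>c. a \<otimes>\<^bsub>G\<^esub> (b \<otimes>\<^bsub>G\<^esub> c))" "b \<otimes>\<^bsub>G\<^esub> \<one>\<^bsub>G\<^esub> = b"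
    using m_assoc gr(2) by auto
  show ?thesis
    using dmap_compose[OF B B B smooth_map_left_mult[OF G] smooth_map_left_mult[OF G], of a b "\<one>\<^bsub>G\<^esub>" x]
    unfolding left_inv_field_def * .
qed

lemma left_inv_field_one:
  assumes G: "lie_group B G"
  shows "left_inv_field B G x \<one>\<^bsub>G\<^esub> = x"
proof -
  have B: "smooth_atlas B" and gr: "group G" "carrier G = UNIV" using G unfolding lie_group_def by blast+
  interpret group G by (rule gr)
  have "(\<lambda>b. \<one>\<^bsub>G\<^esub> \<otimes>\<^bsub>G\<^esub> b) = (\<lambda>b. b)" using l_one gr(2) by auto
  then show ?thesis unfolding left_inv_field_def using dmap_ident[OF B] by simp
qed

lemma linear_left_inv_field:
  fixes B :: "('g::{t2_space, second_countable_topology}, 'e::euclidean_space) atlas"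
  assumes G: "lie_group B G"
  shows "linear (\<lambda>x. left_inv_field B G x a)"
proof -
  have B: "smooth_atlas B" using G unfolding lie_group_def by blast
  show ?thesis using linear_dmap[OF B B smooth_map_left_mult[OF G]] unfolding left_inv_field_def .
qed

lemma lie_alg_bracket_bilinear:
  fixes B :: "('g::{t2_space, second_countable_topology}, 'e::euclidean_space) atlas"
  assumes G: "lie_group B G"
  shows "lie_alg_bracket B G x (y + z) = lie_alg_bracket B G x y + lie_alg_bracket B G x z"
    and "lie_alg_bracket B G x (r *\<^sub>R y) = r *\<^sub>R lie_alg_bracket B G x y"
    and "lie_alg_bracket B G y x = - lie_alg_bracket B G x y"
proof -
  have B: "smooth_atlas B" using G unfolding lie_group_def by blast
  let ?c = "chart_at B \<one>\<^bsub>G\<^esub>" and ?X = "left_inv_field B G"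
  have c: "?c \<in> B" "\<one>\<^bsub>G\<^esub> \<in> fst ?c" by (rule chart_at_mem[OF B])+
  have o: "open (fst ?c)" by (rule open_fst_chart[OF B c(1)])
  have lin: "linear (dfun B (snd ?c) q)" if "q \<in> fst ?c" for q by (rule linear_dfun_snd[OF B c(1) that])
  have s: "smooth_fun B (fst ?c) (\<lambda>q. dfun B (snd ?c) q (?X x q))" for x
    by (rule smooth_fun_dfun[OF B o smooth_fun_snd[OF B c(1)] smooth_field_subset[OF smooth_field_left_inv_field[OF G]]]) simp
  have "dfun B (\<lambda>q. dfun B (snd ?c) q (?X (y + z) q)) \<one>\<^bsub>G\<^esub> =
      dfun B (\<lambda>q. dfun B (snd ?c) q (?X y q) + dfun B (snd ?c) q (?X z q)) \<one>\<^bsub>G\<^esub>"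
    by (rule dfun_cong_open[OF B o c(2)])
      (simp add: linear_add[OF linear_left_inv_field[OF G]] linear_add[OF lin])
  then show "lie_alg_bracket B G x (y + z) = lie_alg_bracket B G x y + lie_alg_bracket B G x z"
    unfolding lie_alg_bracket_def lie_bracket_def Let_def
    by (simp add: dfun_add[OF B s s c(2)] linear_add[OF linear_dfun[OF B s c(2)]] linear_add[OF linear_left_inv_field[OF G]])
  have "dfun B (\<lambda>q. dfun B (snd ?c) q (?X (r *\<^sub>R y) q)) \<one>\<^bsub>G\<^esub> =
      dfun B (\<lambda>q. r *\<^sub>R dfun B (snd ?c) q (?X y q)) \<one>\<^bsub>G\<^esub>"
    by (rule dfun_cong_open[OF B o c(2)])
      (simp add: linear_cmul[OF linear_left_inv_field[OF G]] linear_cmul[OF lin])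
  then show "lie_alg_bracket B G x (r *\<^sub>R y) = r *\<^sub>R lie_alg_bracket B G x y"
    unfolding lie_alg_bracket_def lie_bracket_def Let_def
    by (simp add: dfun_bounded_linear[OF bounded_linear_scaleR_right B s c(2)] linear_cmul[OF linear_dfun[OF B s c(2)]]
      linear_cmul[OF linear_left_inv_field[OF G]] scaleR_diff_right)
  show "lie_alg_bracket B G y x = - lie_alg_bracket B G x y"
    unfolding lie_alg_bracket_def lie_bracket_def Let_def by simp
qed

lemma left_inv_field_J:
  assumes "left_inv_complex_structure B G"
  shows "left_inv_field B G (J x) a = J (left_inv_field B G x a)"
  using assms unfolding left_inv_complex_structure_def left_inv_field_def by blast

lemma lie_alg_nijenhuis:
  assumes G: "lie_group B G" and J: "left_inv_complex_structure B G"
  shows "lie_alg_bracket B G (J x) (J y) =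
    lie_alg_bracket B G x y + J (lie_alg_bracket B G (J x) y) + J (lie_alg_bracket B G x (J y))"
proof -
  have B: "complex_atlas B" using J unfolding left_inv_complex_structure_def by blast
  have "(\<lambda>q. J (left_inv_field B G x q)) = left_inv_field B G (J x)" for x
    using left_inv_field_J[OF J] by auto
  then show ?thesis
    using nijenhuis_tensor_vanishes[OF B open_UNIV UNIV_I[of "\<one>\<^bsub>G\<^esub>"] smooth_field_left_inv_field[OF G, of x]
      smooth_field_left_inv_field[OF G, of y]] unfolding lie_alg_bracket_def by simp
qed

section \<open>Hermitian Lie algebras\<close>

text \<open>The Jacobi identity is not among the axioms. \<open>M x\<close> is covariant differentiation in the
  direction \<open>x\<close> for the Chern connection; \<open>torsion1\<close> and \<open>torsion2\<close> are the real and the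
  imaginary part of \<open>T(X, cnj Y) = 0\<close> for \<open>X = x - i j x\<close> and \<open>Y = y - i j y\<close>.\<close>

locale hermitian_lie_algebra =
  fixes br :: "'v::real_vector \<Rightarrow> 'v \<Rightarrow> 'v" and j :: "'v \<Rightarrow> 'v" and ip :: "'v \<Rightarrow> 'v \<Rightarrow> real"
    and M :: "'v \<Rightarrow> 'v \<Rightarrow> 'v"
  assumes br_add: "br x (y + z) = br x y + br x z"
    and br_scaleR: "br x (r *\<^sub>R y) = r *\<^sub>R br x y"
    and br_antisym: "br y x = - br x y"
    and j_add: "j (x + y) = j x + j y" and j_scaleR: "j (r *\<^sub>R x) = r *\<^sub>R j x" and j_j [simp]: "j (j x) = - x"
    and integrable: "br (j x) (j y) = br x y + j (br (j x) y) + j (br x (j y))"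
    and ip_add: "ip (x + y) z = ip x z + ip y z" and ip_scaleR: "ip (r *\<^sub>R x) z = r * ip x z"
    and ip_sym: "ip x y = ip y x" and ip_pos: "x \<noteq> 0 \<Longrightarrow> ip x x > 0"
    and ip_j: "ip (j x) (j y) = ip x y"
    and M_add_left: "M (x + y) z = M x z + M y z" and M_scaleR_left: "M (r *\<^sub>R x) z = r *\<^sub>R M x z"
    and M_add: "M x (y + z) = M x y + M x z" and M_scaleR: "M x (r *\<^sub>R y) = r *\<^sub>R M x y"
    and M_j: "M x (j y) = j (M x y)"
    and M_skew: "ip (M x y) z = - ip y (M x z)"
    and torsion1: "M x y + M (j x) (j y) - (M y x + M (j y) (j x)) = br x y + br (j x) (j y)"
    and torsion2: "M x (j y) - M (j x) y - (M (j y) x - M y (j x)) = br x (j y) - br (j x) y"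
begin

text \<open>Identifying \<open>z\<close> with \<open>z - i j z\<close>, the operators \<open>L x\<close> and \<open>- Ls x\<close> are the covariant
  derivatives in the directions \<open>x + i j x\<close> and \<open>x - i j x\<close>.\<close>

definition L :: "'v \<Rightarrow> 'v \<Rightarrow> 'v" where "L x y = M x y + j (M (j x) y)"

definition Ls :: "'v \<Rightarrow> 'v \<Rightarrow> 'v" where "Ls x y = j (M (j x) y) - M x y"

section \<open>Algebra of the operators \<open>L\<close> and \<open>Ls\<close>\<close>

lemma j_neg: "j (- x) = - j x" using j_scaleR[of "- 1" x] by simp
lemma j_diff: "j (x - y) = j x - j y" using j_add[of x "- y"] by (simp add: j_neg)
lemma j_zero: "j 0 = 0" using j_scaleR[of 0 0] by simp
lemma br_neg: "br x (- y) = - br x y" using br_scaleR[of x "- 1" y] by simp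
lemma br_neg_left: "br (- x) y = - br x y"
  using br_antisym[of "- x" y] br_antisym[of x y] br_neg[of y x] by simp
lemma M_neg: "M x (- y) = - M x y" using M_scaleR[of x "- 1" y] by simp
lemma M_diff: "M x (y - z) = M x y - M x z" using M_add[of x y "- z"] by (simp add: M_neg)
lemma M_neg_left: "M (- x) y = - M x y" using M_scaleR_left[of "- 1" x y] by simp
lemma M_zero_left: "M 0 y = 0" using M_scaleR_left[of 0 0 y] by simp
lemma M_zero: "M x 0 = 0" using M_scaleR[of x 0 0] by simp
lemma ip_neg: "ip (- x) y = - ip x y" using ip_scaleR[of "- 1" x y] by simp
lemma ip_diff: "ip (x - y) z = ip x z - ip y z" using ip_add[of x "- y" z] by (simp add: ip_neg)
lemma ip_add_right: "ip z (x + y) = ip z x + ip z y" using ip_add ip_sym by metis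
lemma ip_neg_right: "ip x (- y) = - ip x y" using ip_neg ip_sym by metis
lemma ip_diff_right: "ip z (x - y) = ip z x - ip z y" using ip_diff ip_sym by metis
lemma ip_scaleR_right: "ip x (r *\<^sub>R y) = r * ip x y" using ip_scaleR ip_sym by metis
lemma ip_zero: "ip 0 x = 0" "ip x 0 = 0" using ip_scaleR[of 0 0 x] ip_sym by auto
lemma ip_nonneg: "ip x x \<ge> 0" using ip_pos[of x] ip_zero by (cases "x = 0") auto
lemma ip_eq_0: "ip x x = 0 \<longleftrightarrow> x = 0" using ip_pos[of x] ip_zero by (cases "x = 0") auto
lemma ip_j_left: "ip (j x) y = - ip x (j y)" using ip_j[of x "j y"] by (simp add: ip_neg_right)
lemmas ip_simps = ip_add ip_add_right ip_neg ip_neg_right ip_diff ip_diff_right ip_zero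

lemma L_add: "L x (y + z) = L x y + L x z" by (simp add: L_def M_add j_add)
lemma L_diff: "L x (y - z) = L x y - L x z" by (simp add: L_def M_diff j_diff)
lemma L_zero: "L x 0 = 0" by (simp add: L_def M_zero j_zero)
lemma L_add_left: "L (x + y) z = L x z + L y z" by (simp add: L_def M_add_left j_add)
lemma L_neg_left: "L (- x) z = - L x z" by (simp add: L_def M_neg_left j_neg)
lemma L_diff_left: "L (x - y) z = L x z - L y z" using L_add_left[of x "- y" z] by (simp add: L_neg_left)
lemma Ls_add: "Ls x (y + z) = Ls x y + Ls x z" by (simp add: Ls_def M_add j_add)
lemma Ls_neg: "Ls x (- y) = - Ls x y" by (simp add: Ls_def M_neg j_neg)
lemma Ls_zero: "Ls x 0 = 0" by (simp add: Ls_def M_zero j_zero)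
lemma Ls_add_left: "Ls (x + y) z = Ls x z + Ls y z" by (simp add: Ls_def M_add_left j_add)
lemma Ls_neg_left: "Ls (- x) z = - Ls x z" by (simp add: Ls_def M_neg_left j_neg)
lemma Ls_zero_left: "Ls 0 z = 0" by (simp add: Ls_def M_zero_left j_zero)

lemma L_j: "L x (j y) = j (L x y)" by (simp add: L_def M_j j_add)
lemma L_j_left: "L (j x) y = - j (L x y)" by (simp add: L_def M_neg_left j_add j_neg)
lemma Ls_j: "Ls x (j y) = j (Ls x y)" by (simp add: Ls_def M_j j_diff)
lemma Ls_j_left: "Ls (j x) y = j (Ls x y)" by (simp add: Ls_def M_neg_left j_diff j_neg)

text \<open>\<open>Ls x\<close> is the adjoint of \<open>L x\<close>, since \<open>j\<close> and the
  operators \<open>M x\<close> are skew and commute.\<close>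

lemma ip_L: "ip (L x y) z = ip y (Ls x z)"
  by (simp add: L_def Ls_def ip_simps M_skew ip_j_left M_j)

lemma M_eq: "M x y = (1/2) *\<^sub>R (L x y - Ls x y)"
  by (simp add: L_def Ls_def scaleR_2[symmetric])

lemma M_j_eq: "M (j x) y = - (1/2) *\<^sub>R j (L x y + Ls x y)"
  by (simp add: M_eq L_j_left Ls_j_left j_add) (simp add: algebra_simps)

text \<open>\<open>T(cnj Y, Z) = 0\<close> writes \<open>[cnj Y, Z]\<close> as the derivative of
  \<open>Z\<close> along \<open>cnj Y\<close> minus that of \<open>cnj Y\<close> along
  \<open>Z\<close>; these have types (1,0) and (0,1), so the former is the (1,0) part of the
  bracket. In real terms, the two torsion identities give the difference and the sum of
  \<open>L y z\<close> and \<open>L z y\<close>, and integrability simplifies the total.\<close>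

lemma L_eq: "L y z = br y z + j (br (j y) z)"
proof -
  have 1: "L y z - L z y = br y z + br (j y) (j z)"
    using torsion1[of y z] by (simp add: L_def M_j algebra_simps)
  have "j (L y z + L z y) = br y (j z) - br (j y) z"
    using torsion2[of y z] by (simp add: L_def M_j j_add algebra_simps)
  then have "j (j (L y z + L z y)) = j (br y (j z) - br (j y) z)" by simp
  then have "- (L y z + L z y) = j (br y (j z)) - j (br (j y) z)" unfolding j_j j_diff .
  then have 2: "L y z + L z y = j (br (j y) z) - j (br y (j z))" by (metis minus_diff_eq minus_minus)
  have "2 *\<^sub>R L y z = (L y z - L z y) + (L y z + L z y)" by (simp add: scaleR_2)
  also have "\<dots> = 2 *\<^sub>R (br y z + j (br (j y) z))"
    unfolding 1 2 integrable by (simp add: scaleR_2)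
  finally show ?thesis by simp
qed

text \<open>Up to a constant factor the left side is the curvature component at
  \<open>X = x - i j x\<close>. Skewness of \<open>M\<close> moves one derivative of each second
  order term onto \<open>x\<close>, which leaves squared norms of \<open>L x x\<close> and
  \<open>Ls x x\<close>; the last term stems from \<open>[x, j x] = j (L x x)\<close>.\<close>

lemma curvature_quartic:
  "2 * ip (M x (M (j x) (j x)) - M (j x) (M x (j x)) - M (br x (j x)) (j x)) x =
   ip (Ls x x) (Ls x x) - ip (L x x) (L x x) - 2 * ip (L (L x x) x) x"
proof -
  have br: "br x (j x) = j (L x x)"
  proof -
    have "2 *\<^sub>R br x x = 0" unfolding scaleR_2 using br_antisym[of x x] by (metis add.right_inverse)
    then have "br x x = 0" by simp
    then show ?thesis using br_antisym[of "j x" x] by (simp add: L_eq j_neg)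
  qed
  have Mx: "M (j x) y = - j (M x y) - j (Ls x y)" for y
    by (simp add: Ls_def j_diff)
  have "M (br x (j x)) (j x) = (1/2) *\<^sub>R (L (L x x) x + Ls (L x x) x)"
    unfolding br M_j_eq by (simp add: L_j Ls_j j_add algebra_simps)
  then have 1: "2 * ip (M (br x (j x)) (j x)) x = 2 * ip (L (L x x) x) x"
    using ip_L[of "L x x" x x] ip_sym[of x "Ls (L x x) x"] by (simp add: ip_scaleR ip_simps)
  note sc = ip_scaleR ip_scaleR_right ip_simps add_divide_distrib diff_divide_distrib ip_sym[of "L x x" "Ls x x"]
  have "M (j x) (j x) = (1/2) *\<^sub>R (L x x + Ls x x)"
    by (simp add: M_j_eq L_j Ls_j j_add algebra_simps)
  moreover have "4 * ip ((1/2) *\<^sub>R (L x x + Ls x x)) ((1/2) *\<^sub>R (L x x - Ls x x)) =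
      ip (L x x) (L x x) - ip (Ls x x) (Ls x x)"
    by (simp add: sc)
  ultimately have 2: "4 * ip (M x (M (j x) (j x))) x = ip (Ls x x) (Ls x x) - ip (L x x) (L x x)"
    using M_skew[of x "M (j x) (j x)" x] M_eq[of x x] by simp
  have "M x (j x) = j ((1/2) *\<^sub>R (L x x - Ls x x))" "M (j x) x = j (- (1/2) *\<^sub>R (L x x + Ls x x))"
    by (simp_all only: M_j M_eq[of x x] M_j_eq j_scaleR)
  moreover have "4 * ip ((1/2) *\<^sub>R (L x x - Ls x x)) (- (1/2) *\<^sub>R (L x x + Ls x x)) =
      ip (Ls x x) (Ls x x) - ip (L x x) (L x x)"
    by (simp add: sc)
  ultimately have 3: "4 * ip (M (j x) (M x (j x))) x = - (ip (Ls x x) (Ls x x) - ip (L x x) (L x x))"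
    using M_skew[of "j x" "M x (j x)" x] ip_j by simp
  show ?thesis using 1 2 3 by (simp add: ip_simps)
qed

text \<open>A formula of Koszul type: \<open>M x\<close> is half of \<open>L x\<close> minus its
  adjoint, and \<open>L_eq\<close> expresses both by the bracket. As \<open>M\<close> is absent from
  the right side, it is determined by \<open>br\<close>, \<open>j\<close> and
  \<open>ip\<close>.\<close>

lemma ip_M: "2 * ip (M x y) z = ip (br x y + j (br (j x) y)) z - ip y (br x z + j (br (j x) z))"
  using ip_L[of x z y] ip_sym[of y "L x z"] ip_sym[of z "Ls x y"]
  by (simp add: M_eq[of x y] ip_scaleR ip_simps flip: L_eq)

section \<open>Nilpotency of products of the operators \<open>L\<close>\<close>

definition proj :: "'v \<Rightarrow> 'v \<Rightarrow> 'v" where "proj P Q = (1/2) *\<^sub>R (P + j Q)"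

text \<open>\<open>proj P Q\<close> is the \<open>(1,0)\<close> part of the complexified vector \<open>P + iQ\<close>, and \<open>L y\<close> is induced
  by the bracket with the \<open>(0,1)\<close> vector \<open>y + i j y\<close> on the quotient by the \<open>(0,1)\<close> vectors.\<close>

lemma L_proj: "L y (proj P Q) = proj (br y P - br (j y) Q) (br y Q + br (j y) P)"
proof -
  have "L y (r *\<^sub>R z) = r *\<^sub>R L y z" for r z
    by (simp add: L_def M_scaleR j_scaleR scaleR_add_right)
  then show ?thesis
    by (simp add: proj_def L_add L_j) (simp add: L_eq j_add j_diff algebra_simps)
qed

definition lprod :: "'v list \<Rightarrow> 'v \<Rightarrow> 'v" where "lprod ys z = foldr L ys z"

lemma lprod_append: "lprod (xs @ ys) z = lprod xs (lprod ys z)"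
  by (simp add: lprod_def)

text \<open>The sets \<open>C k\<close> need not be invariant under \<open>j\<close>, so
  \<open>L\<close> need not map one into the next. What moves down the series is a complexified
  representative \<open>P + iQ\<close> with both parts in \<open>C k\<close>: on it
  \<open>L y\<close> acts through brackets alone, and \<open>proj\<close> is applied only at the
  end.\<close>

lemma lprod_nilpotent:
  assumes C0: "C 0 = UNIV" and CS: "\<And>k x y. y \<in> C k \<Longrightarrow> br x y \<in> C (Suc k)"
    and sub: "\<And>k. subspace (C k)" and Ck: "C k = {0}"
  shows "length ys = k \<Longrightarrow> lprod ys z = 0"
proof -
  have "\<exists>P\<in>C (length ys). \<exists>Q\<in>C (length ys). lprod ys z = proj P Q" for ys
  proof (induction ys)
    case Nil
    \<comment> \<open>\<open>z - i j z\<close> is already of type (1,0) and represents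
      \<open>z\<close>.\<close>
    have "z = proj z (- j z)" by (simp add: proj_def j_neg scaleR_2[symmetric])
    then show ?case using C0 by (auto simp: lprod_def)
  next
    case (Cons y ys)
    then obtain P Q where PQ: "P \<in> C (length ys)" "Q \<in> C (length ys)" "lprod ys z = proj P Q" by blast
    have "br y P - br (j y) Q \<in> C (Suc (length ys))" "br y Q + br (j y) P \<in> C (Suc (length ys))"
      by (rule subspace_diff[OF sub CS[OF PQ(1)] CS[OF PQ(2)]] subspace_add[OF sub CS[OF PQ(2)] CS[OF PQ(1)]])+
    moreover have "lprod (y # ys) z = L y (lprod ys z)" by (simp add: lprod_def)
    ultimately show ?case
      using PQ(3) L_proj by (intro bexI[of _ "br y P - br (j y) Q"] bexI[of _ "br y Q + br (j y) P"]) simp_all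
  qed
  from this[of ys] show "length ys = k \<Longrightarrow> lprod ys z = 0"
    using Ck by (auto simp: proj_def j_zero)
qed

text \<open>A product of maximal length among the non-vanishing ones has its image in the common kernel
  of all \<open>L y\<close>, and the image of its adjoint is orthogonal to all images of the \<open>L y\<close>.\<close>

lemma maximal_lprod:
  assumes nil: "\<And>ys z. length ys = k \<Longrightarrow> lprod ys z = 0" and ex: "(v :: 'v) \<noteq> 0"
  obtains ys z where "lprod ys z \<noteq> 0" "\<And>y ys' z. length ys' = length ys \<Longrightarrow> L y (lprod ys' z) = 0"
    "\<And>y z. lprod ys (L y z) = 0"
proof -
  define P where "P n \<longleftrightarrow> (\<exists>ys z. length ys = n \<and> lprod ys z \<noteq> 0)" for n
  have P0: "P 0" using ex by (auto simp: P_def lprod_def)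
  have "\<not> P n" if "n \<ge> k" for n
  proof
    assume "P n"
    then obtain ys z where ys: "length ys = n" "lprod ys z \<noteq> 0" unfolding P_def by blast
    have "lprod ys z = lprod (take (n - k) ys) (lprod (drop (n - k) ys) z)"
      using lprod_append[of "take (n - k) ys" "drop (n - k) ys" z] by simp
    also have "\<dots> = lprod (take (n - k) ys) 0" using nil ys(1) that by simp
    also have "lprod xs 0 = 0" for xs by (induction xs) (auto simp: lprod_def L_zero)
    finally show False using ys by simp
  qed
  then have bound: "\<forall>n. P n \<longrightarrow> n \<le> k" by (metis nat_le_linear)
  define n where "n = Greatest P"
  have "P n" unfolding n_def using GreatestI_nat[where P=P, OF P0] bound by blast
  have max: "\<not> P (Suc n)" using Greatest_le_nat[of P "Suc n" k] bound unfolding n_def by fastforce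
  obtain ys z where ys: "length ys = n" "lprod ys z \<noteq> 0" using \<open>P n\<close> unfolding P_def by blast
  show ?thesis
  proof (rule that[OF ys(2)])
    \<comment> \<open>Prepending a factor composes with it afterwards, appending one composes with
      it beforehand; either way the product exceeds the maximal length.\<close>
    show "L y (lprod ys' z) = 0" if "length ys' = length ys" for y ys' z
    proof -
      have "lprod (y # ys') z = 0" using max that ys(1) unfolding P_def by auto
      then show ?thesis by (simp add: lprod_def)
    qed
    show "lprod ys (L y z) = 0" for y z
    proof -
      have "lprod (ys @ [y]) z = 0" using max ys(1) unfolding P_def by auto
      then show ?thesis by (simp add: lprod_def)
    qed
  qed
qed

text \<open>Taking adjoints reverses the order of a product, hence \<open>fold\<close> on the right
  where \<open>lprod\<close> uses \<open>foldr\<close>.\<close>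

lemma ip_lprod: "ip (lprod ys z) w = ip z (fold Ls ys w)"
  by (induction ys arbitrary: w) (auto simp: lprod_def ip_L)

text \<open>Comparing the quartic identity at \<open>a + b\<close>, \<open>a - b\<close> and \<open>a\<close> gives, for
  \<open>S a = Ls a b + Ls b a\<close>, the identity \<open>|S a|\<^sup>2 + |L b a|\<^sup>2 = 2 ip a (S (L b a))\<close>. Hence both \<open>S a\<close> and
  \<open>L b a\<close> vanish as soon as \<open>S (L b a)\<close> does, and \<open>L b\<close> is nilpotent.\<close>

lemma L_vanishes_on_kernel:
  assumes nil: "\<And>ys z. length ys = k \<Longrightarrow> lprod ys z = 0"
    and Q: "\<And>x. ip (Ls x x) (Ls x x) - ip (L x x) (L x x) - 2 * ip (L (L x x) x) x = 0"
    and b: "\<And>y. L y b = 0"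
  shows "L b a = 0" "Ls a b = 0"
proof -
  define S where "S a = Ls a b + Ls b a" for a
  \<comment> \<open>At \<open>x = b\<close> only the first term of the quartic survives.\<close>
  have Lsbb: "Ls b b = 0" using Q[of b] by (simp add: b ip_simps ip_eq_0)
  have key: "ip (S a) (S a) + ip (L b a) (L b a) = 2 * ip a (S (L b a))" for a
  proof -
    let ?u = "L b a"
    have "Ls (a + b) (a + b) = Ls a a + S a" "Ls (a - b) (a - b) = Ls a a - S a"
      using Ls_add[of _ a b] Ls_add[of _ a "- b"] Ls_add_left[of a b] Ls_add_left[of a "- b"]
      by (simp_all add: S_def Lsbb Ls_neg Ls_neg_left)
    moreover have "L (a + b) (a + b) = L a a + ?u" "L (a - b) (a - b) = L a a - ?u"
      using L_add[of _ a b] L_diff[of _ a b] L_add_left[of a b] L_diff_left[of a b] by (simp_all add: b)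
    moreover have "L (L a a + ?u) (a + b) = L (L a a) a + L ?u a" "L (L a a - ?u) (a - b) = L (L a a) a - L ?u a"
      by (simp_all add: L_add L_diff L_add_left L_diff_left b)
    ultimately have "ip (S a) (S a) - ip ?u ?u - 2 * ip (L ?u a) b = 0"
      using Q[of "a + b"] Q[of "a - b"] Q[of a] by (simp add: ip_simps)
    \<comment> \<open>Passing to adjoints, the missing summand \<open>Ls b ?u\<close> of
      \<open>S ?u\<close> is supplied at the price of one \<open>ip ?u ?u\<close>. Doubled, this
      reverses the sign of the negative square, which makes the left side of \<open>key\<close>
      definite.\<close>
    moreover have "ip (L ?u a) b = ip a (S ?u) - ip ?u ?u"
      using ip_L[of ?u a b] ip_L[of b a ?u] by (simp add: S_def ip_simps)
    ultimately show ?thesis by simp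
  qed
  have "S a = 0 \<and> L b a = 0" if "(L b ^^ n) a = 0" for n a
    using that
  proof (induction n arbitrary: a)
    case 0
    then show ?case by (simp add: S_def L_zero Ls_zero Ls_zero_left)
  next
    case (Suc n)
    then have "S (L b a) = 0" by (simp add: funpow_swap1)
    then have "ip (S a) (S a) + ip (L b a) (L b a) = 0" using key[of a] by (simp add: ip_zero)
    then show ?case using ip_nonneg[of "S a"] ip_nonneg[of "L b a"] ip_eq_0 by smt
  qed
  moreover have "(L b ^^ k) a = 0" for a
    using nil[of "replicate k b" a] by (simp add: lprod_def foldr_replicate)
  ultimately have *: "S a = 0" "L b a = 0" for a by blast+
  then show "L b a = 0" by blast
  \<comment> \<open>\<open>L b\<close> vanishes identically, hence so does its adjoint, and
    \<open>S a = 0\<close> then leaves \<open>Ls a b = 0\<close>.\<close>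
  have "ip (Ls b a) (Ls b a) = 0" using ip_L[of b "Ls b a" a] * ip_sym by (simp add: ip_zero)
  then have "Ls b a = 0" using ip_eq_0 by blast
  then show "Ls a b = 0" using *(1)[of a] by (simp add: S_def)
qed

lemma constant_curvature_L_zero:
  assumes nil: "\<And>ys z. length ys = k \<Longrightarrow> lprod ys z = 0" and ex: "(v :: 'v) \<noteq> 0"
    and curv: "\<And>x. ip (M x (M (j x) (j x)) - M (j x) (M x (j x)) - M (br x (j x)) (j x)) x = c * (ip x x)\<^sup>2"
  shows "c = 0" "L x y = 0" "M x y = 0"
proof -
  \<comment> \<open>For \<open>Z = z - i j z\<close> one has \<open>|Z|^2 = 2 * ip z z\<close>: the
    complex identity doubles on the left and quadruples on the right, whence
    \<open>2 * c\<close>.\<close>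
  have Q: "ip (Ls x x) (Ls x x) - ip (L x x) (L x x) - 2 * ip (L (L x x) x) x = 2 * c * (ip x x)\<^sup>2" for x
    using curvature_quartic[of x] curv[of x] by simp
  obtain ys z where ys: "lprod ys z \<noteq> 0" "\<And>y ys' z. length ys' = length ys \<Longrightarrow> L y (lprod ys' z) = 0"
    "\<And>y z. lprod ys (L y z) = 0" using maximal_lprod[OF nil ex] by blast
  define b where "b = lprod ys z"
  \<comment> \<open>Feeding \<open>b\<close> to the adjoint of the maximal product guarantees a
    non-zero result, since its pairing with \<open>z\<close> is \<open>ip b b\<close>.\<close>
  define a where "a = fold Ls ys b"
  have b: "b \<noteq> 0" "\<And>y. L y b = 0" using ys by (auto simp: b_def)
  have "ip (Ls b b) (Ls b b) = 2 * c * (ip b b)\<^sup>2" using Q[of b] by (simp add: b ip_zero)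
  then have "0 \<le> c * (ip b b)\<^sup>2" using ip_nonneg[of "Ls b b"] by simp
  then have "0 \<le> c" using ip_pos[OF b(1)] by (simp add: zero_le_mult_iff)
  have "ip z a = ip b b" unfolding a_def by (simp add: b_def flip: ip_lprod)
  then have a: "a \<noteq> 0" using ip_pos[OF b(1)] by (auto simp: ip_zero)
  have Lsa: "Ls y a = 0" for y
  proof -
    have "ip (Ls y a) (Ls y a) = ip (L y (Ls y a)) a" by (rule ip_L[symmetric])
    also have "\<dots> = ip (lprod ys (L y (Ls y a))) b" unfolding a_def by (rule ip_lprod[symmetric])
    also have "\<dots> = 0" by (simp add: ys(3) ip_zero)
    finally show ?thesis using ip_eq_0 by blast
  qed
  have "ip (L (L a a) a) a = 0" by (simp add: ip_L Lsa ip_zero)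
  then have "- ip (L a a) (L a a) = 2 * c * (ip a a)\<^sup>2" using Q[of a] by (simp add: Lsa ip_zero)
  then have "c * (ip a a)\<^sup>2 \<le> 0" using ip_nonneg[of "L a a"] by simp
  then have "c \<le> 0" using ip_pos[OF a] by (simp add: mult_le_0_iff)
  with \<open>0 \<le> c\<close> show c: "c = 0" by simp
  have Lsb: "Ls y b = 0" for y
    by (rule L_vanishes_on_kernel[OF nil _ b(2)]) (use Q c in auto)
  have L: "L x y = 0" for x y
  proof (cases ys)
    \<comment> \<open>If the maximal product is empty, then single factors already vanish.\<close>
    case Nil
    then show ?thesis using ys(2)[of "[]" x y] by (simp add: lprod_def)
  next
    case (Cons y' ys')
    then have "ip b b = ip (lprod ys' z) (Ls y' b)"
      unfolding b_def by (simp add: lprod_def ip_L)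
    then have "ip b b = 0" by (simp add: Lsb ip_zero)
    then show ?thesis using b(1) ip_eq_0 by blast
  qed
  then show "L x y = 0" .
  have "ip (Ls x y) (Ls x y) = 0" using ip_L[of x "Ls x y" y] L by (simp add: ip_zero)
  then have "Ls x y = 0" using ip_eq_0 by blast
  then show "M x y = 0" using M_eq[of x y] L by simp
qed

end

section \<open>The Chern connection in a left invariant frame\<close>

context
  fixes A :: "('m::{t2_space, second_countable_topology}, 'e::euclidean_space) atlas"
    and D :: "('m, 'e) conn" and W :: "'m set"
  assumes A: "smooth_atlas A" and D: "connection A D" and W: "open W"
begin

lemmas connectionD = D[unfolded connection_def, THEN spec, THEN spec, THEN spec, THEN mp, THEN mp, THEN mp, OF W]

lemma smooth_field_connection: "smooth_field A W X \<Longrightarrow> smooth_field A W Y \<Longrightarrow> smooth_field A W (D X Y)"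
  by (rule connectionD[THEN conjunct1])

lemma connection_cong:
  assumes "smooth_field A W X" "smooth_field A W Y" "\<And>q. q \<in> W \<Longrightarrow> X' q = X q"
    "\<And>q. q \<in> W \<Longrightarrow> Y' q = Y q" "p \<in> W"
  shows "D X' Y' p = D X Y p"
  using connectionD[OF assms(1,2), THEN conjunct2, THEN conjunct1, THEN spec, THEN spec, THEN mp, THEN bspec, OF _ assms(5), of X' Y']
    assms(3,4) by simp

lemma connection_add:
  assumes "smooth_field A W X" "smooth_field A W Y" "smooth_field A W Z" "p \<in> W"
  shows "D (\<lambda>q. X q + Z q) Y p = D X Y p + D Z Y p" "D X (\<lambda>q. Y q + Z q) p = D X Y p + D X Z p"
  using connectionD[OF assms(1,2), THEN conjunct2, THEN conjunct2, THEN conjunct1, THEN spec, THEN mp, THEN bspec, OF assms(3,4)]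
  by simp_all

lemma connection_scaleR:
  assumes "smooth_field A W X" "smooth_field A W Y" "smooth_fun A W f" "p \<in> W"
  shows "D (\<lambda>q. f q *\<^sub>R X q) Y p = f p *\<^sub>R D X Y p"
    "D X (\<lambda>q. f q *\<^sub>R Y q) p = dfun A f p (X p) *\<^sub>R Y p + f p *\<^sub>R D X Y p"
  using connectionD[OF assms(1,2), THEN conjunct2, THEN conjunct2, THEN conjunct2, THEN spec, THEN mp, THEN bspec, OF assms(3,4)]
  by simp_all

lemma connection_scaleR_const:
  assumes "smooth_field A W X" "smooth_field A W Y" "p \<in> W"
  shows "D (\<lambda>q. r *\<^sub>R X q) Y p = r *\<^sub>R D X Y p" "D X (\<lambda>q. r *\<^sub>R Y q) p = r *\<^sub>R D X Y p"
  using connection_scaleR[OF assms(1,2) smooth_fun_const[of A W r] assms(3)] by (simp_all add: dfun_const)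

lemma connection_diff:
  assumes "smooth_field A W X" "smooth_field A W Y" "smooth_field A W Z" "p \<in> W"
  shows "D (\<lambda>q. X q - Z q) Y p = D X Y p - D Z Y p" "D X (\<lambda>q. Y q - Z q) p = D X Y p - D X Z p"
proof -
  have Z: "smooth_field A W (\<lambda>q. (- 1) *\<^sub>R Z q)"
    by (rule smooth_field_scaleR[OF A W smooth_fun_const assms(3)])
  show "D (\<lambda>q. X q - Z q) Y p = D X Y p - D Z Y p"
    using connection_add(1)[OF assms(1,2) Z assms(4)] connection_scaleR_const(1)[OF assms(3,2,4), of "- 1"] by simp
  show "D X (\<lambda>q. Y q - Z q) p = D X Y p - D X Z p"
    using connection_add(2)[OF assms(1,2) Z assms(4)] connection_scaleR_const(2)[OF assms(1,3,4), of "- 1"] by simp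
qed

lemma connection_sum_scaleR:
  assumes "finite I" "\<And>i. smooth_field A W (X i)" "\<And>i. smooth_fun A W (f i)" "smooth_field A W Y" "p \<in> W"
  shows "D (\<lambda>q. \<Sum>i\<in>I. f i q *\<^sub>R X i q) Y p = (\<Sum>i\<in>I. f i p *\<^sub>R D (X i) Y p)"
  using assms(1)
proof (induction I)
  case empty
  then show ?case using connection_scaleR_const(1)[OF assms(4,4,5), of 0] by simp
next
  case (insert i I)
  have "smooth_field A W (\<lambda>q. \<Sum>i\<in>I. f i q *\<^sub>R X i q)" "smooth_field A W (\<lambda>q. f i q *\<^sub>R X i q)"
    by (intro smooth_field_sum smooth_field_scaleR A W assms)+
  then show ?case
    using insert connection_add(1)[OF _ assms(4) _ assms(5), of "\<lambda>q. f i q *\<^sub>R X i q" "\<lambda>q. \<Sum>i\<in>I. f i q *\<^sub>R X i q"]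
      connection_scaleR(1)[OF assms(2,4,3,5), of i i] by simp
qed

end

text \<open>The sheet \<open>U\<close> over the evenly covered open set \<open>T\<close>, with the local section \<open>\<sigma>\<close>, carries the
  left invariant fields of the group to a frame \<open>E\<close> over \<open>T\<close>.\<close>

locale local_frame =
  fixes A :: "('m::{t2_space, second_countable_topology}, complex ^ 'n::finite) atlas"
    and g :: "('m, complex ^ 'n) metric"
    and B :: "('g::{t2_space, second_countable_topology}, complex ^ 'n) atlas"
    and h :: "('g, complex ^ 'n) metric"
    and G :: "'g monoid"
    and \<pi> :: "'g \<Rightarrow> 'm" and D :: "('m, complex ^ 'n) conn"
    and T :: "'m set" and U :: "'g set" and \<sigma> :: "'m \<Rightarrow> 'g"
  assumes Ag: "hermitian_manifold A g" and G: "lie_group B G" and JG: "left_inv_complex_structure B G"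
    and Bh: "hermitian_manifold B h" and hG: "left_inv_metric B G h"
    and \<pi>: "holomorphic_map B A \<pi>" and iso: "\<And>p v w. g (\<pi> p) (dmap B A \<pi> p v) (dmap B A \<pi> p w) = h p v w"
    and T: "open T" and U: "open U" and \<sigma>: "continuous_on T \<sigma>" "\<sigma> ` T \<subseteq> U" "\<And>q. q \<in> T \<Longrightarrow> \<pi> (\<sigma> q) = q"
    and \<sigma>\<pi>: "\<And>a. a \<in> U \<Longrightarrow> \<sigma> (\<pi> a) = a" and \<pi>U: "\<pi> ` U \<subseteq> T"
    and chern: "chern_connection A g D"
begin

lemma A: "smooth_atlas A" and B: "smooth_atlas B"
  using Ag Bh complex_atlas_smooth unfolding hermitian_manifold_def by blast+

lemma smooth_\<pi>: "smooth_map B A \<pi>" using \<pi> unfolding holomorphic_map_def by blast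

lemma D: "connection A D" using chern unfolding chern_connection_def by blast

lemmas chern_metric = chern[unfolded chern_connection_def, THEN conjunct2, THEN conjunct1, rule_format]
  and chern_J = chern[unfolded chern_connection_def, THEN conjunct2, THEN conjunct2, THEN conjunct1, rule_format]
  and chern_torsion = chern[unfolded chern_connection_def, THEN conjunct2, THEN conjunct2, THEN conjunct2, rule_format]

definition E :: "complex ^ 'n \<Rightarrow> 'm \<Rightarrow> complex ^ 'n" where
  "E x q = dmap B A \<pi> (\<sigma> q) (left_inv_field B G x (\<sigma> q))"

abbreviation br where "br \<equiv> lie_alg_bracket B G"
abbreviation ip where "ip \<equiv> h \<one>\<^bsub>G\<^esub>"

lemma linear_E: "linear (\<lambda>x. E x q)"
  unfolding E_def
  using linear_compose[OF linear_left_inv_field[OF G] linear_dmap[OF B A smooth_\<pi>]] by (simp add: o_def)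

lemmas E_simps = linear_add[OF linear_E] linear_diff[OF linear_E] linear_neg[OF linear_E]
  linear_cmul[OF linear_E] linear_0[OF linear_E]

lemma E_J: "E (J x) q = J (E x q)"
  using \<pi> unfolding E_def left_inv_field_J[OF JG] holomorphic_map_def by simp

lemma E_metric:
  assumes "q \<in> T"
  shows "g q (E x q) (E y q) = ip x y"
proof -
  have gr: "group G" "carrier G = UNIV" using G unfolding lie_group_def by blast+
  interpret group G by (rule gr)
  have one: "a \<otimes>\<^bsub>G\<^esub> \<one>\<^bsub>G\<^esub> = a" for a using r_one gr(2) by blast
  have "h (\<sigma> q) (left_inv_field B G x (\<sigma> q)) (left_inv_field B G y (\<sigma> q)) = ip x y"
    using hG[unfolded left_inv_metric_def, rule_format, of "\<sigma> q" "\<one>\<^bsub>G\<^esub>" x y]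
    unfolding left_inv_field_def one .
  then show ?thesis using iso[of "\<sigma> q"] \<sigma>(3)[OF assms] unfolding E_def by simp
qed

lemma ip_bilinear: "bilinear ip" and ip_sym: "ip x y = ip y x" and ip_pos: "x \<noteq> 0 \<Longrightarrow> ip x x > 0"
  and ip_J: "ip (J x) (J y) = ip x y"
  using Bh unfolding hermitian_manifold_def riemannian_metric_def by blast+

lemma g_bilinear: "bilinear (g q)" and g_pos: "v \<noteq> 0 \<Longrightarrow> g q v v > 0"
  using Ag unfolding hermitian_manifold_def riemannian_metric_def by blast+

lemma E_eq_0: "q \<in> T \<Longrightarrow> E x q = 0 \<Longrightarrow> x = 0"
  using E_metric[of q x x] ip_pos[of x] bilinear_lzero[OF g_bilinear, of q 0] by force

lemma inj_E: "q \<in> T \<Longrightarrow> inj (\<lambda>x. E x q)"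
  using linear_injective_0[OF linear_E] E_eq_0 by blast

lemma E_eq_iff: "q \<in> T \<Longrightarrow> E x q = E y q \<longleftrightarrow> x = y"
  using inj_E by (auto dest: injD)

lemma E_surj:
  assumes "q \<in> T"
  obtains x where "v = E x q"
  using linear_injective_imp_surjective[OF linear_E inj_E[OF assms]] by (metis dim_UNIV surjD)

text \<open>A local isometry is an immersion; this supplies the injectivity that makes the section
  \<open>\<sigma>\<close> smooth.\<close>

lemma dmap_\<pi>_inj: "dmap B A \<pi> a v = 0 \<Longrightarrow> v = 0"
proof -
  assume "dmap B A \<pi> a v = 0"
  then have "h a v v = 0" using iso[of a v v] bilinear_lzero[OF g_bilinear] by simp
  moreover have "v \<noteq> 0 \<Longrightarrow> h a v v > 0" using Bh unfolding hermitian_manifold_def riemannian_metric_def by blast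
  ultimately show "v = 0" by fastforce
qed

text \<open>In a chart \<open>c\<close>, the components of \<open>E x\<close> are the derivative of
  \<open>snd c \<circ> \<pi>\<close> along the left invariant field, a smooth function on part of
  the group, composed with \<open>\<sigma>\<close>.\<close>

lemma smooth_E: "smooth_field A T (E x)"
proof (rule smooth_fieldI)
  fix c assume c: "c \<in> A"
  let ?X = "left_inv_field B G x"
  let ?V = "\<pi> -` fst c" and ?f = "\<lambda>a. dfun B (\<lambda>b. snd c (\<pi> b)) a (left_inv_field B G x a)"
  have o: "open (fst c)" by (rule open_fst_chart[OF A c])
  have V: "open ?V" by (rule open_vimage_smooth_map[OF smooth_\<pi> o])
  have "smooth_fun B ?V ?f"
    by (rule smooth_fun_dfun[OF B V smooth_fun_smooth_map[OF B A smooth_\<pi> o smooth_fun_snd[OF A c]]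
        smooth_field_subset[OF smooth_field_left_inv_field[OF G]]]) simp
  then have f: "smooth_fun B (U \<inter> ?V) ?f" by (rule smooth_fun_subset) simp
  have "smooth_fun A (fst c \<inter> T) (\<lambda>y. ?f (\<sigma> y))"
    by (rule smooth_fun_local_inverse[OF B A smooth_\<pi> _ open_Int[OF U V] open_Int[OF o T] continuous_on_subset[OF \<sigma>(1)] _ _ f])
      (use dmap_\<pi>_inj \<sigma> in auto)
  then show "smooth_fun A (fst c \<inter> T) (\<lambda>q. dfun A (snd c) q (E x q))"
  proof (rule smooth_fun_congI[OF A open_Int[OF o T]])
    fix q assume "q \<in> fst c \<inter> T"
    then show "dfun A (snd c) q (E x q) = ?f (\<sigma> q)"
      using dfun_smooth_map[OF B A smooth_\<pi> o _ smooth_fun_snd[OF A c], of "\<sigma> q" "?X (\<sigma> q)"] \<sigma>(3)[of q]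
      unfolding E_def by simp
  qed
qed

text \<open>The map \<open>?F\<close> sends the identity to \<open>q\<close> and, near the identity,
  relates left invariant fields to the frame. So the bracket at \<open>q\<close> is read off from
  the bracket at the identity, which is \<open>br\<close> by definition.\<close>

lemma E_bracket:
  assumes q: "q \<in> T"
  shows "lie_bracket A (E x) (E y) q = E (br x y) q"
proof -
  have gr: "group G" "carrier G = UNIV" using G unfolding lie_group_def by blast+
  interpret group G by (rule gr)
  have one: "a \<otimes>\<^bsub>G\<^esub> \<one>\<^bsub>G\<^esub> = a" for a using r_one gr(2) by blast
  let ?a = "\<sigma> q" and ?F = "\<lambda>b. \<pi> (\<sigma> q \<otimes>\<^bsub>G\<^esub> b)"
  let ?V = "(\<lambda>b. ?a \<otimes>\<^bsub>G\<^esub> b) -` U"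
  note Lm = smooth_map_left_mult[OF G, of ?a]
  have F: "smooth_map B A ?F" by (rule smooth_map_compose[OF B B A Lm smooth_\<pi>])
  have dF: "dmap B A ?F b (left_inv_field B G x b) = dmap B A \<pi> (?a \<otimes>\<^bsub>G\<^esub> b) (left_inv_field B G x (?a \<otimes>\<^bsub>G\<^esub> b))" for x b
    unfolding dmap_compose[OF B B A Lm smooth_\<pi>] left_inv_field_mult[OF G] ..
  have "dmap B A ?F \<one>\<^bsub>G\<^esub> (lie_bracket B (left_inv_field B G x) (left_inv_field B G y) \<one>\<^bsub>G\<^esub>) =
      lie_bracket A (E x) (E y) (?F \<one>\<^bsub>G\<^esub>)"
  proof (rule lie_bracket_related[OF B A F open_vimage_smooth_map[OF Lm U] _ T _ _ _ smooth_E smooth_E])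
    show "\<one>\<^bsub>G\<^esub> \<in> ?V" using one \<sigma>(2) q by auto
    show "?F ` ?V \<subseteq> T" using \<pi>U by auto
  qed (auto intro!: smooth_field_subset[OF smooth_field_left_inv_field[OF G]] simp: dF E_def \<sigma>\<pi>)
  moreover have "dmap B A ?F \<one>\<^bsub>G\<^esub> (br x y) = E (br x y) q"
    using dF[of "\<one>\<^bsub>G\<^esub>" "br x y"] unfolding left_inv_field_one[OF G] one E_def .
  ultimately show ?thesis using one \<sigma>(3)[OF q] unfolding lie_alg_bracket_def by simp
qed

section \<open>Connection coefficients in the frame\<close>

definition N :: "'m \<Rightarrow> complex ^ 'n \<Rightarrow> complex ^ 'n \<Rightarrow> complex ^ 'n" where
  "N q x y = (SOME z. E z q = D (E x) (E y) q)"

lemma E_N: "q \<in> T \<Longrightarrow> E (N q x y) q = D (E x) (E y) q"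
  unfolding N_def by (rule someI_ex) (metis E_surj)

lemma D_E_simps:
  assumes "q \<in> T"
  shows "D (E (x + y)) (E z) q = D (E x) (E z) q + D (E y) (E z) q"
    "D (E x) (E (y + z)) q = D (E x) (E y) q + D (E x) (E z) q"
    "D (E (r *\<^sub>R x)) (E y) q = r *\<^sub>R D (E x) (E y) q"
    "D (E x) (E (r *\<^sub>R y)) q = r *\<^sub>R D (E x) (E y) q"
    "D (E x) (E (J y)) q = J (D (E x) (E y) q)"
proof -
  have "E (x + y) = (\<lambda>q. E x q + E y q)" "E (r *\<^sub>R x) = (\<lambda>q. r *\<^sub>R E x q)" "E (J x) = (\<lambda>q. J (E x q))" for x y r
    by (auto simp: E_simps E_J)
  note e = this
  show "D (E (x + y)) (E z) q = D (E x) (E z) q + D (E y) (E z) q"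
    "D (E x) (E (y + z)) q = D (E x) (E y) q + D (E x) (E z) q"
    unfolding e by (rule connection_add[OF A D T smooth_E smooth_E smooth_E assms])+
  show "D (E (r *\<^sub>R x)) (E y) q = r *\<^sub>R D (E x) (E y) q" "D (E x) (E (r *\<^sub>R y)) q = r *\<^sub>R D (E x) (E y) q"
    unfolding e by (rule connection_scaleR_const[OF A D T smooth_E smooth_E assms])+
  show "D (E x) (E (J y)) q = J (D (E x) (E y) q)"
    unfolding e by (rule chern_J[OF T smooth_E smooth_E assms])
qed

lemma D_E_neg: "q \<in> T \<Longrightarrow> D (E (- x)) (E z) q = - D (E x) (E z) q"
  "q \<in> T \<Longrightarrow> D (E x) (E (- z)) q = - D (E x) (E z) q"
  using D_E_simps(3)[of q "- 1" x z] D_E_simps(4)[of q x "- 1" z] by simp_all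

lemma N_simps:
  assumes "q \<in> T"
  shows "N q (x + y) z = N q x z + N q y z" "N q x (y + z) = N q x y + N q x z"
    "N q (r *\<^sub>R x) y = r *\<^sub>R N q x y" "N q x (r *\<^sub>R y) = r *\<^sub>R N q x y" "N q x (J y) = J (N q x y)"
  by (simp_all add: E_N D_E_simps E_simps E_J assms flip: E_eq_iff[OF assms])

text \<open>Frame fields have constant inner products, so the derivative in the metric compatibility
  condition vanishes.\<close>

lemma N_skew:
  assumes "q \<in> T"
  shows "ip (N q x y) z = - ip y (N q x z)"
proof -
  have "dfun A (\<lambda>q. g q (E y q) (E z q)) q = dfun A (\<lambda>q. ip y z) q"
    by (rule dfun_cong_open[OF A T assms]) (rule E_metric)
  moreover have "dfun A (\<lambda>q. g q (E y q) (E z q)) q (E x q) =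
      g q (D (E x) (E y) q) (E z q) + g q (E y q) (D (E x) (E z) q)"
    by (rule chern_metric[OF T smooth_E smooth_E smooth_E assms])
  ultimately have "g q (D (E x) (E y) q) (E z q) + g q (E y q) (D (E x) (E z) q) = 0"
    by (simp add: dfun_const)
  then show ?thesis by (simp add: E_metric[OF assms] flip: E_N[OF assms])
qed

section \<open>Complexified frame fields, torsion and curvature\<close>

definition EE :: "complex ^ 'n \<Rightarrow> complex ^ 'n \<Rightarrow> 'm \<Rightarrow> (complex ^ 'n) \<times> (complex ^ 'n)" where
  "EE a b q = (E a q, E b q)"

lemma EE_comp [simp]: "fst \<circ> EE a b = E a" "snd \<circ> EE a b = E b"
  by (auto simp: EE_def)

lemma smooth_EE: "smooth_cfield A T (EE a b)"
  unfolding smooth_cfield_def by (simp add: smooth_E)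

lemma smooth_10_EE: "smooth_10_field A T (EE x (- J x))"
  unfolding smooth_10_field_def type_10_def using smooth_EE by (simp add: EE_def E_simps E_J linear_neg[OF linear_J])

lemma cnj_EE: "cnj_field (EE a b) = EE a (- b)"
  by (rule ext) (simp add: cnj_field_def cnj_vec_def EE_def E_simps)

lemma cext_bracket_EE:
  "q \<in> T \<Longrightarrow> cext (lie_bracket A) (EE a b) (EE c d) q = EE (br a c - br b d) (br a d + br b c) q"
  by (simp add: cext_def E_bracket EE_def E_simps)

lemma N_torsion:
  assumes q: "q \<in> T"
  shows "N q x y + N q (J x) (J y) - (N q y x + N q (J y) (J x)) = br x y + br (J x) (J y)"
    "N q x (J y) - N q (J x) y - (N q (J y) x - N q y (J x)) = br x (J y) - br (J x) y"
proof -
  have bn2: "br u (- v) = - br u v" for u v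
    using lie_alg_bracket_bilinear(2)[OF G, of u "- 1" v] by simp
  have bn1: "br (- u) v = - br u v" for u v
    using lie_alg_bracket_bilinear(3)[OF G, of "- u" v] lie_alg_bracket_bilinear(3)[OF G, of u v] bn2 by simp
  have "torsion A D (EE x (- J x)) (cnj_field (EE y (- J y))) q = 0"
    by (rule chern_torsion[OF T smooth_10_EE smooth_10_EE q])
  then have t: "cext D (EE x (- J x)) (EE y (J y)) q - cext D (EE y (J y)) (EE x (- J x)) q =
      EE (br x y + br (J x) (J y)) (br x (J y) - br (J x) y) q"
    unfolding torsion_def cnj_EE minus_minus cext_bracket_EE[OF q] bn1 bn2 by simp
  have 1: "D (E x) (E y) q + D (E (J x)) (E (J y)) q - (D (E y) (E x) q + D (E (J y)) (E (J x)) q) =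
      E (br x y + br (J x) (J y)) q"
    using arg_cong[OF t, of fst] by (simp add: cext_def EE_def D_E_neg[OF q])
  have 2: "D (E x) (E (J y)) q - D (E (J x)) (E y) q - (D (E (J y)) (E x) q - D (E y) (E (J x)) q) =
      E (br x (J y) - br (J x) y) q"
    using arg_cong[OF t, of snd] by (simp add: cext_def EE_def D_E_neg[OF q])
  show "N q x y + N q (J x) (J y) - (N q y x + N q (J y) (J x)) = br x y + br (J x) (J y)"
    by (rule E_eq_iff[OF q, THEN iffD1]) (use 1 in \<open>simp only: E_simps E_N[OF q]\<close>)
  show "N q x (J y) - N q (J x) y - (N q (J y) x - N q y (J x)) = br x (J y) - br (J x) y"
    by (rule E_eq_iff[OF q, THEN iffD1]) (use 2 in \<open>simp only: E_simps E_N[OF q]\<close>)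
qed

lemma hermitian_lie_algebra_N:
  assumes q: "q \<in> T"
  shows "hermitian_lie_algebra br J ip (N q)"
proof
  show "br y x = - br x y" "br x (y + z) = br x y + br x z" "br x (r *\<^sub>R y) = r *\<^sub>R br x y" for x y z r
    by (rule lie_alg_bracket_bilinear[OF G])+
  show "br (J x) (J y) = br x y + J (br (J x) y) + J (br x (J y))" for x y
    by (rule lie_alg_nijenhuis[OF G JG])
  show "ip (x + y) z = ip x z + ip y z" "ip (r *\<^sub>R x) z = r * ip x z" for x y z r
    using bilinear_ladd[OF ip_bilinear] bilinear_lmul[OF ip_bilinear] by auto
  show "ip x y = ip y x" "ip (J x) (J y) = ip x y" for x y by (rule ip_sym ip_J)+
  show "x \<noteq> 0 \<Longrightarrow> ip x x > 0" for x by (rule ip_pos)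
  show "ip (N q x y) z = - ip y (N q x z)" for x y z by (rule N_skew[OF q])
qed (use N_simps[OF q] N_torsion[OF q] linear_add[OF linear_J] linear_cmul[OF linear_J] in simp_all)

text \<open>Metric compatibility and torsion determine the connection by the bracket and the inner
  product alone.\<close>

lemma N_indep:
  assumes "p \<in> T" "q \<in> T"
  shows "N p x y = N q x y"
proof -
  interpret p: hermitian_lie_algebra br J ip "N p" by (rule hermitian_lie_algebra_N[OF assms(1)])
  interpret q: hermitian_lie_algebra br J ip "N q" by (rule hermitian_lie_algebra_N[OF assms(2)])
  let ?z = "N p x y - N q x y"
  have "ip (N p x y) ?z = ip (N q x y) ?z" using p.ip_M[of x y ?z] q.ip_M[of x y ?z] by simp
  then have "ip ?z ?z = 0" by (simp add: p.ip_diff)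
  then show ?thesis using p.ip_eq_0 by simp
qed

text \<open>The coefficients are those at \<open>p\<close>, the field is evaluated at any
  \<open>q\<close> in \<open>T\<close>: by \<open>N_indep\<close>, differentiating a constant
  coefficient field gives another one on all of \<open>T\<close>, ready to be differentiated
  again.\<close>

lemma cext_D_EE:
  assumes "p \<in> T" "q \<in> T"
  shows "cext D (EE a b) (EE c d) q = EE (N p a c - N p b d) (N p a d + N p b c) q"
  unfolding N_indep[OF assms] cext_def EE_comp EE_def E_simps by (simp add: E_N[OF assms(2)])

text \<open>First derivatives are known to be constant coefficient fields only on \<open>T\<close>;
  locality of the connection permits the replacement inside \<open>D\<close>.\<close>

lemma cext_D_cong:
  assumes "p \<in> T" "\<And>q. q \<in> T \<Longrightarrow> X q = EE a b q" "\<And>q. q \<in> T \<Longrightarrow> Y q = EE c d q"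
  shows "cext D X Y p = cext D (EE a b) (EE c d) p"
proof -
  have X: "(fst \<circ> X) q = E a q" "(snd \<circ> X) q = E b q" "(fst \<circ> Y) q = E c q" "(snd \<circ> Y) q = E d q" if "q \<in> T" for q
    using assms(2,3)[OF that] by (auto simp: EE_def)
  show ?thesis unfolding cext_def EE_comp
    using connection_cong[OF A D T smooth_E smooth_E X(1) X(3) assms(1)] connection_cong[OF A D T smooth_E smooth_E X(1) X(4) assms(1)]
      connection_cong[OF A D T smooth_E smooth_E X(2) X(3) assms(1)] connection_cong[OF A D T smooth_E smooth_E X(2) X(4) assms(1)]
    by (simp add: o_def)
qed

text \<open>For \<open>X = x - i J x\<close> bilinearity gives
  \<open>R(X, cnj X) = 2 i R(x, J x)\<close>, so the component entering \<open>H\<close> reduces to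
  the real operator \<open>?r\<close>.\<close>

lemma curvature_N:
  assumes p: "p \<in> T" and c: "constant_hol_sect_curv A g D c"
  shows "ip (N p x (N p (J x) (J x)) - N p (J x) (N p x (J x)) - N p (br x (J x)) (J x)) x = c * (ip x x)\<^sup>2"
proof (cases "x = 0")
  case True
  then show ?thesis using bilinear_rzero[OF ip_bilinear] by simp
next
  case False
  interpret hermitian_lie_algebra br J ip "N p" by (rule hermitian_lie_algebra_N[OF p])
  let ?X = "EE x (- J x)" and ?Y = "EE x (J x)"
  let ?r = "\<lambda>y. N p x (N p (J x) y) - N p (J x) (N p x y) - N p (br x (J x)) y"
  have br0: "br x x = 0" "br (J x) (J x) = 0" "br (J x) x = - br x (J x)"
    using br_antisym[of x x] br_antisym[of "J x" "J x"] br_antisym[of "J x" x]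
    by (simp_all add: equation_minus_iff vec_eq_iff)
  have YX: "cext D ?Y ?X q = EE (N p x x + N p (J x) (J x)) (N p (J x) x - N p x (J x)) q" if "q \<in> T" for q
    using cext_D_EE[OF p that, of x "J x" x "- J x"] by (simp add: M_neg)
  have XX: "cext D ?X ?X q = EE (N p x x - N p (J x) (J x)) (- N p x (J x) - N p (J x) x) q" if "q \<in> T" for q
    using cext_D_EE[OF p that, of x "- J x" x "- J x"] by (simp add: M_neg M_neg_left)
  have XY: "cext (lie_bracket A) ?X ?Y q = EE 0 (br x (J x) + br x (J x)) q" if "q \<in> T" for q
    using cext_bracket_EE[OF that, of x "- J x" x "J x"] by (simp add: br_neg_left br0)
  have EE_diff: "EE a b q - EE a' b' q = EE (a - a') (b - b') q" for a b a' b' q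
    by (simp add: EE_def E_simps)
  have "curvature A D ?X (cnj_field ?X) ?X p =
      cext D ?X (EE (N p x x + N p (J x) (J x)) (N p (J x) x - N p x (J x))) p -
      cext D ?Y (EE (N p x x - N p (J x) (J x)) (- N p x (J x) - N p (J x) x)) p -
      cext D (EE 0 (br x (J x) + br x (J x))) ?X p"
    unfolding curvature_def cnj_EE minus_minus
    by (intro arg_cong2[where f=minus] cext_D_cong[OF p] YX XX XY refl)
  also have "\<dots> = EE (?r (J x) + ?r (J x)) (?r x + ?r x) p"
    unfolding cext_D_EE[OF p p] EE_diff
    by (intro arg_cong2[where f="\<lambda>a b. EE a b p"])
      (simp_all only: M_neg M_neg_left M_add M_diff M_zero_left M_add_left, simp_all add: algebra_simps)
  finally have cu: "curvature A D ?X (cnj_field ?X) ?X p = EE (?r (J x) + ?r (J x)) (?r x + ?r x) p" .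
  \<comment> \<open>One factor 2 comes from the doubled operator, the other from equal contributions
    of the parts paired with \<open>x\<close> and \<open>J x\<close>. The 4 cancels against the
    square of \<open>|X|^2 = 2 * ip x x\<close>.\<close>
  have "Re (curv_comp A g D ?X ?X ?X ?X p) = 4 * ip (?r (J x)) x"
  proof -
    have "?r (J x) = J (?r x)" by (simp add: M_j j_diff)
    then have rJ: "ip (?r x) (J x) = - ip (?r (J x)) x" by (simp add: ip_j_left)
    have "curv_comp A g D ?X ?X ?X ?X p = cmetric g p (EE (?r (J x) + ?r (J x)) (?r x + ?r x) p) (EE x (J x) p)"
      unfolding curv_comp_def cu by (simp add: cnj_vec_def EE_def E_simps)
    then have "Re (curv_comp A g D ?X ?X ?X ?X p) = ip (?r (J x) + ?r (J x)) x - ip (?r x + ?r x) (J x)"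
      by (simp only: cmetric_def EE_def E_metric[OF p] fst_conv snd_conv complex.sel)
    then show ?thesis unfolding ip_add rJ by simp
  qed
  moreover have "cmetric g p (?X p) (cnj_vec (?X p)) = complex_of_real (2 * ip x x)"
  proof -
    have "cmetric g p (?X p) (cnj_vec (?X p)) = cmetric g p (EE x (- J x) p) (EE x (J x) p)"
      by (simp add: cnj_vec_def EE_def E_simps)
    also have "\<dots> = complex_of_real (2 * ip x x)"
      using ip_j[of x x] ip_sym[of x "J x"]
      by (simp add: cmetric_def EE_def E_metric[OF p] ip_neg complex_eq_iff)
    finally show ?thesis .
  qed
  moreover have "hol_sect_curv A g D ?X p = complex_of_real c"
    by (rule c[unfolded constant_hol_sect_curv_def, rule_format, OF T smooth_10_EE p])
      (use False E_eq_0[OF p, of x] in \<open>auto simp: EE_def zero_prod_def\<close>)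
  ultimately have "curv_comp A g D ?X ?X ?X ?X p = complex_of_real (c * (2 * ip x x)\<^sup>2)"
    "Re (curv_comp A g D ?X ?X ?X ?X p) = 4 * ip (?r (J x)) x"
    using ip_pos[OF False] unfolding hol_sect_curv_def by (auto simp: field_simps)
  then have "4 * ip (?r (J x)) x = c * (2 * ip x x)\<^sup>2" by simp
  then show ?thesis using ip_pos[OF False] by (simp add: field_simps power2_eq_square)
qed

text \<open>The coefficients of \<open>Y\<close> in the frame are smooth because they are the inner products of \<open>Y\<close> with
  the fields of the dual frame.\<close>

lemma D_E_eq_0:
  assumes q: "q \<in> V" "V \<subseteq> T" and V: "open V" and N: "\<And>x y. N q x y = 0" and Y: "smooth_field A V Y"
  shows "D Y (E x) q = 0"
proof -
  have sE: "smooth_field A V (E y)" for y by (rule smooth_field_subset[OF smooth_E q(2)])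
  interpret hermitian_lie_algebra br J ip "N q" using hermitian_lie_algebra_N q by blast
  \<comment> \<open>The Gram map of \<open>ip\<close> with respect to the standard basis; preimages
    of the basis vectors form the dual basis.\<close>
  define R where "R y = (\<Sum>b\<in>Basis. ip y b *\<^sub>R b)" for y
  have R_inner: "R y \<bullet> b = ip y b" if "b \<in> Basis" for y b
    unfolding R_def using that by simp
  have lin: "linear R"
    unfolding R_def by (rule linearI) (simp_all add: ip_add ip_scaleR sum.distrib algebra_simps scaleR_sum_right)
  have "y = 0" if "R y = 0" for y
  proof -
    have b: "ip y b = 0" if "b \<in> Basis" for b using R_inner[OF that, of y] \<open>R y = 0\<close> by simp
    have "linear (ip y)" by (rule linearI) (simp_all add: ip_add_right ip_scaleR_right)
    then have "ip y y = (\<Sum>b\<in>Basis. (y \<bullet> b) *\<^sub>R ip y b)" by (rule linear_sum_Basis)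
    also have "\<dots> = 0" by (rule sum.neutral) (simp add: b)
    finally show "y = 0" using ip_eq_0 by blast
  qed
  then have "surj R" using linear_injective_0[OF lin] linear_injective_imp_surjective[OF lin] by blast
  then obtain y where y: "R (y b) = b" for b by (metis surjD)
  have dual: "ip (y b) z = z \<bullet> b" if "b \<in> Basis" for b z
  proof -
    have "linear (ip (y b))" by (rule linearI) (simp_all add: ip_add_right ip_scaleR_right)
    then have "ip (y b) z = (\<Sum>c\<in>Basis. (z \<bullet> c) *\<^sub>R ip (y b) c)" by (rule linear_sum_Basis)
    also have "\<dots> = (\<Sum>c\<in>Basis. (z \<bullet> c) * (b \<bullet> c))"
      by (rule sum.cong) (simp_all add: R_inner[symmetric] y)
    also have "\<dots> = z \<bullet> b" by (rule euclidean_inner[symmetric])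
    finally show ?thesis .
  qed
  let ?f = "\<lambda>b q. g q (Y q) (E (y b) q)"
  have f: "smooth_fun A V (?f b)" for b
    using Ag V Y sE unfolding hermitian_manifold_def riemannian_metric_def by blast
  have Yeq: "Y r = (\<Sum>b\<in>Basis. ?f b r *\<^sub>R E b r)" if r: "r \<in> V" for r
  proof -
    have rT: "r \<in> T" using r q by blast
    obtain z where z: "Y r = E z r" using E_surj[OF rT] by blast
    have "?f b r = z \<bullet> b" if "b \<in> Basis" for b
      unfolding z E_metric[OF rT] using dual[OF that] ip_sym by metis
    then show ?thesis unfolding z using linear_sum_Basis[OF linear_E, of z r] by (simp cong: sum.cong)
  qed
  \<comment> \<open>Linearity over functions in the direction argument reduces \<open>Y\<close> to
    frame fields, for which the derivative is given by \<open>N\<close>.\<close>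
  have "D Y (E x) q = D (\<lambda>r. \<Sum>b\<in>Basis. ?f b r *\<^sub>R E b r) (E x) q"
    by (rule connection_cong[OF A D V _ sE Yeq refl q(1)])
      (intro smooth_field_sum smooth_field_scaleR A V f sE)
  also have "\<dots> = (\<Sum>b\<in>Basis. ?f b q *\<^sub>R D (E b) (E x) q)"
    by (rule connection_sum_scaleR[OF A D V finite_Basis sE f sE q(1)])
  also have "\<dots> = 0"
    using E_N[of q _ x] N q by (intro sum.neutral) (auto simp: E_simps)
  finally show ?thesis .
qed

text \<open>Vanishing coefficients make the frame parallel. By metric compatibility the inner
  products of \<open>D Y Z\<close> with the frame are then the derivatives along \<open>Y\<close> of
  those of \<open>Z\<close>, and the claim becomes the commutator formula for the bracket.\<close>

lemma flat_real:
  assumes V: "open V" "V \<subseteq> T" "p \<in> V" and N: "\<And>q x y. q \<in> V \<Longrightarrow> N q x y = 0"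
    and X: "smooth_field A V X" and Y: "smooth_field A V Y" and Z: "smooth_field A V Z"
  shows "D X (D Y Z) p - D Y (D X Z) p = D (lie_bracket A X Y) Z p"
proof -
  have sE: "smooth_field A V (E y)" for y by (rule smooth_field_subset[OF smooth_E V(2)])
  have step: "g q (D Y Z q) (E x q) = dfun A (\<lambda>q. g q (Z q) (E x q)) q (Y q)"
    if "q \<in> V" "smooth_field A V Y" "smooth_field A V Z" for q x Y Z
    using chern_metric[OF V(1) that(2,3) sE that(1)] D_E_eq_0[OF that(1) V(2,1) N[OF that(1)] that(2)]
      bilinear_rzero[OF g_bilinear] by simp
  have s: "smooth_field A V (D Y Z)" if "smooth_field A V Y" "smooth_field A V Z" for Y Z
    by (rule smooth_field_connection[OF A D V(1) that])
  have br: "smooth_field A V (lie_bracket A X Y)" by (rule smooth_field_lie_bracket[OF A V(1) X Y])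
  have two: "g p (D X (D Y Z) p) (E x p) = dfun A (\<lambda>q. dfun A (\<lambda>q. g q (Z q) (E x q)) q (Y q)) p (X p)"
    if X: "smooth_field A V X" and Y: "smooth_field A V Y" for x X Y
    unfolding step[OF V(3) X s[OF Y Z]]
    by (rule fun_cong[OF dfun_cong_open[OF A V(1,3)]]) (rule step[OF _ Y Z])
  let ?v = "D X (D Y Z) p - D Y (D X Z) p - D (lie_bracket A X Y) Z p"
  have "g p ?v (E x p) = 0" for x
  proof -
    have f: "smooth_fun A V (\<lambda>q. g q (Z q) (E x q))"
      using Ag V Z sE unfolding hermitian_manifold_def riemannian_metric_def by blast
    show ?thesis
      unfolding bilinear_lsub[OF g_bilinear] two[OF X Y] two[OF Y X] step[OF V(3) br Z]
      by (simp add: dfun_lie_bracket[OF A V(1,3) X Y f])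
  qed
  moreover obtain x where "?v = E x p" using E_surj V by blast
  ultimately have "g p ?v ?v = 0" by metis
  then have "?v = 0" using g_pos[of ?v p] by fastforce
  then show ?thesis by simp
qed

text \<open>Expanding into real and imaginary parts gives a sum of real curvatures; splitting the
  sums inside \<open>D\<close> requires every intermediate field to be smooth.\<close>

lemma flat_local:
  assumes V: "open V" "V \<subseteq> T" "p \<in> V" and N: "\<And>q x y. q \<in> V \<Longrightarrow> N q x y = 0"
    and X: "smooth_cfield A V X" and Y: "smooth_cfield A V Y" and Z: "smooth_cfield A V Z"
  shows "curvature A D X Y Z p = 0"
proof -
  note sm = X[unfolded smooth_cfield_def, THEN conjunct1] X[unfolded smooth_cfield_def, THEN conjunct2]
    Y[unfolded smooth_cfield_def, THEN conjunct1] Y[unfolded smooth_cfield_def, THEN conjunct2]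
    Z[unfolded smooth_cfield_def, THEN conjunct1] Z[unfolded smooth_cfield_def, THEN conjunct2]
  note flat = flat_real[OF V N]
  have comp: "fst \<circ> cext F X Y = (\<lambda>q. F (fst \<circ> X) (fst \<circ> Y) q - F (snd \<circ> X) (snd \<circ> Y) q)"
    "snd \<circ> cext F X Y = (\<lambda>q. F (fst \<circ> X) (snd \<circ> Y) q + F (snd \<circ> X) (fst \<circ> Y) q)"
    for F :: "('m \<Rightarrow> complex ^ 'n) \<Rightarrow> ('m \<Rightarrow> complex ^ 'n) \<Rightarrow> 'm \<Rightarrow> complex ^ 'n" and X Y
    by (auto simp: cext_def)
  have sD: "smooth_field A V (D X Y)" if "smooth_field A V X" "smooth_field A V Y" for X Y
    by (rule smooth_field_connection[OF A D V(1) that])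
  have sB: "smooth_field A V (lie_bracket A X Y)" if "smooth_field A V X" "smooth_field A V Y" for X Y
    by (rule smooth_field_lie_bracket[OF A V(1) that])
  note lin = connection_add[OF A D V(1) _ _ _ V(3)] connection_diff[OF A D V(1) _ _ _ V(3)]
  have r1: "D X (\<lambda>q. D Y Z q - D Y' Z' q) p = D X (D Y Z) p - D X (D Y' Z') p"
    "D X (\<lambda>q. D Y Z q + D Y' Z' q) p = D X (D Y Z) p + D X (D Y' Z') p"
    if "smooth_field A V X" "smooth_field A V Y" "smooth_field A V Z"
      "smooth_field A V Y'" "smooth_field A V Z'" for X Y Z Y' Z'
    by (intro lin sD that)+
  have r2: "D (\<lambda>q. lie_bracket A X Y q - lie_bracket A X' Y' q) Z p = D (lie_bracket A X Y) Z p - D (lie_bracket A X' Y') Z p"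
    "D (\<lambda>q. lie_bracket A X Y q + lie_bracket A X' Y' q) Z p = D (lie_bracket A X Y) Z p + D (lie_bracket A X' Y') Z p"
    if "smooth_field A V X" "smooth_field A V Y" "smooth_field A V Z"
      "smooth_field A V X'" "smooth_field A V Y'" for X Y Z X' Y'
    by (intro lin sB that)+
  show ?thesis
    unfolding curvature_def cext_def[of _ _ _ p] comp
    by (simp add: r1 r2 sm flat[symmetric] zero_prod_def)
qed

end

section \<open>From local frames to the manifold\<close>

lemma lower_central_series_subspace: "subspace (lower_central_series B G k)"
  by (cases k) auto

theorem theoremE:
  fixes A :: "('m::{t2_space, second_countable_topology}, complex ^ 'n::finite) atlas"
    and g :: "('m, complex ^ 'n) metric"
    and B :: "('g::{t2_space, second_countable_topology}, complex ^ 'n) atlas"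
    and h :: "('g, complex ^ 'n) metric"
    and G :: "'g monoid"
    and \<pi> :: "'g \<Rightarrow> 'm"
    and D :: "('m, complex ^ 'n) conn"
    and c :: real
  assumes "complex_nilmanifold A g B h G \<pi>"
    and "chern_connection A g D"
    and "constant_hol_sect_curv A g D c"
  shows "c = 0 \<and> flat A D \<and> complex_lie_group B G"
proof -
  have Ag: "hermitian_manifold A g" and nG: "nilpotent_lie_group B G" and JG: "left_inv_complex_structure B G"
    and Bh: "hermitian_manifold B h" and hG: "left_inv_metric B G h"
    and cov: "covering_space UNIV \<pi> UNIV" and \<pi>: "holomorphic_map B A \<pi>"
    and iso: "\<forall>p v w. g (\<pi> p) (dmap B A \<pi> p v) (dmap B A \<pi> p w) = h p v w"
    using assms(1)[unfolded complex_nilmanifold_def hermitian_universal_cover_def] by - (elim conjE, assumption)+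
  have G: "lie_group B G" using nG unfolding nilpotent_lie_group_def by blast
  obtain k where k: "lower_central_series B G k = {0}" using nG unfolding nilpotent_lie_group_def by blast
  have frame: "\<exists>T U \<sigma>. p \<in> T \<and> local_frame A g B h G \<pi> D T U \<sigma>" for p
  proof -
    from cov[unfolded covering_space_def, THEN conjunct2, THEN conjunct2, THEN bspec, OF UNIV_I, of p]
    obtain T where T: "p \<in> T" "open T" and "\<exists>v. \<Union>v = UNIV \<inter> \<pi> -` T \<and> (\<forall>u\<in>v. openin (top_of_set UNIV) u) \<and>
        pairwise disjnt v \<and> (\<forall>u\<in>v. \<exists>\<sigma>. homeomorphism u T \<pi> \<sigma>)"
      by auto
    then obtain v where v: "\<Union>v = UNIV \<inter> \<pi> -` T" "\<forall>u\<in>v. openin (top_of_set UNIV) u"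
        "\<forall>u\<in>v. \<exists>\<sigma>. homeomorphism u T \<pi> \<sigma>"
      by (elim exE conjE)
    have "range \<pi> = UNIV" using cov[unfolded covering_space_def] by (elim conjE)
    then obtain a where "p = \<pi> a" by (metis surjD)
    then have "a \<in> \<Union>v" using v(1) T(1) by simp
    then obtain U where "U \<in> v" by blast
    then obtain \<sigma> where U: "open U" and hom: "homeomorphism U T \<pi> \<sigma>"
      using v(2,3) by auto
    have "local_frame A g B h G \<pi> D T U \<sigma>"
      by (rule local_frame.intro[OF Ag G JG Bh hG \<pi> iso[rule_format] T(2) U homeomorphism_cont2[OF hom] _
          homeomorphism_apply2[OF hom] homeomorphism_apply1[OF hom] _ assms(2)])
        (simp_all add: homeomorphism_image1[OF hom] homeomorphism_image2[OF hom])
    then show ?thesis using T(1) by blast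
  qed
  have main: "c = 0 \<and> local_frame.N A B G \<pi> D \<sigma> p x y = 0 \<and> lie_alg_bracket B G (J x) y = J (lie_alg_bracket B G x y)"
    if "local_frame A g B h G \<pi> D T U \<sigma>" "p \<in> T" for T U \<sigma> p x y
  proof -
    interpret local_frame A g B h G \<pi> D T U \<sigma> by (rule that(1))
    interpret hermitian_lie_algebra br J ip "N p" by (rule hermitian_lie_algebra_N[OF that(2)])
    have nil: "lprod ys z = 0" if "length ys = k" for ys z
    proof (rule lprod_nilpotent[where C="lower_central_series B G", OF _ _ lower_central_series_subspace k that])
      show "br x y \<in> lower_central_series B G (Suc k)" if "y \<in> lower_central_series B G k" for k x y
        unfolding lower_central_series.simps using that by (intro span_base) blast
    qed simp
    \<comment> \<open>The index type is non-empty, so the model space contains a non-zero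
      vector.\<close>
    have ne: "(1 :: complex ^ 'n) \<noteq> 0" by (simp add: vec_eq_iff)
    have z: "c = 0" "L x y = 0" "N p x y = 0"
      by (rule constant_curvature_L_zero[OF _ ne curvature_N[OF that(2) assms(3)]], rule nil, assumption)+
    \<comment> \<open>\<open>L x y = 0\<close> says that the (1,0) part of a bracket vanishes;
      applying \<open>J\<close> turns this into complex linearity in the first argument.\<close>
    have "br x y + J (br (J x) y) = 0" using z(2) by (simp add: L_eq)
    then have "J (br x y + J (br (J x) y)) = 0" by (simp only: j_zero)
    then have "J (br x y) - br (J x) y = 0" by (simp add: j_add)
    then show ?thesis using z by simp
  qed
  have "c = 0 \<and> complex_lie_group B G"
    unfolding complex_lie_group_def using frame main by blast
  moreover have "flat A D"
    unfolding flat_def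
  proof (intro allI impI ballI)
    fix W X Y Z p
    assume W: "open W" and X: "smooth_cfield A W X" and Y: "smooth_cfield A W Y" and Z: "smooth_cfield A W Z"
      and p: "p \<in> W"
    obtain T U \<sigma> where pT: "p \<in> T" and lf: "local_frame A g B h G \<pi> D T U \<sigma>" using frame by blast
    interpret local_frame A g B h G \<pi> D T U \<sigma> by (rule lf)
    \<comment> \<open>The given fields are smooth on \<open>W\<close>, the frame lives on
      \<open>T\<close>; the curvature at \<open>p\<close> is computed on the intersection.\<close>
    have sub: "smooth_cfield A (W \<inter> T) X" if "smooth_cfield A W X" for X
      using that smooth_field_subset[of A W _ "W \<inter> T"] unfolding smooth_cfield_def by blast
    show "curvature A D X Y Z p = 0"
      by (rule flat_local[OF open_Int[OF W local_frame.T[OF lf]] _ _ _ sub[OF X] sub[OF Y] sub[OF Z]])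
        (use p pT main[OF lf] in auto)
  qed
  ultimately show ?thesis by blast
qed

end
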